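(* Assume that $\sum_{n\ge1}\beta_n^\alpha/\gamma_n<\infty$. (1) Suppose that for every $t>0$ $$\sup_{n\ge1}\frac{e^{-\gamma_nt}\,\gamma_n^{1/\alpha}}{\beta_n}<\infty. \qquad(\ast)$$ Then the laws $\mu_t^x$ and $\mu_t^y$ of $X_t^x$ and $X_t^y$, respectively, are equivalent, for any $t>0$ and $x,y\in H$. Moreover the density $\frac{d\mu_t^x}{d\mu_t^y}$ of $\mu_t^x$ with respect to $\mu_t^y$ is given by $$\frac{d\mu_t^x}{d\mu_t^y}=\lim_{N\to\infty}\prod_{k=1}^N\frac{p_\alpha\Big(\frac{z_k-e^{-\gamma_kt}x_k}{c_k(t)}\Big)}{p_\alpha\Big(\frac{z_k-e^{-\gamma_kt}y_k}{c_k(t)}\Big)}\quad\text{in }L^1(\mu_t^y),\qquad c_k(t)=\beta_k\Big(\frac{1-e^{-\alpha\gamma_kt}}{\alpha\gamma_k}\Big)^{1/\alpha},$$ where $z=(z_k)\in H$ denotes the variable. (2) If $(\ast)$ does not hold for some $t>0$, then for this $t$ there exists $x\in H$ such that $\mu_t^x$ is not absolutely continuous with respect to $\mu_t^0$ (the law of $X_t^0$).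
   Context: Let $H$ be a real separable (infinite-dimensional) Hilbert space with a fixed orthonormal basis $(e_n)_{n\ge1}$; $x\in H$ is identified with $(x_n)=(\langle x,e_n\rangle)\in\ell^2$. Fix $\alpha\in(0,2)$. $(Z^n_t)_{t\ge0}$, $n\ge1$, are independent real normalized symmetric $\alpha$-stable Lévy processes, $\mathbb E[e^{ihZ^n_t}]=e^{-t|h|^\alpha}$, on a stochastic basis $(\Omega,\mathcal F,(\mathcal F_t)_{t\ge0},\mathbb P)$ satisfying the usual assumptions. $(\beta_n)$ is a sequence of positive reals. $A:D(A)\subset H\to H$ is self-adjoint with $e_n\in D(A)$, $Ae_n=-\gamma_ne_n$, $\gamma_n>0$ for all $n\ge 1$, and $\gamma_n\to+\infty$. The Ornstein-Uhlenbeck process starting from $x\in H$ is $X_t^x=\sum_{n\ge1}X_t^ne_n$, $X_t^n=e^{-\gamma_nt}x_n+\int_0^te^{-\gamma_n(t-s)}\beta_n\,dZ^n_s$; under $\sum_n\beta_n^\alpha/\gamma_n<\infty$ it is $H$-valued. $p_\alpha$ is the density of the probability measure on $\mathbb R$ with characteristic function $e^{-|s|^\alpha}$. Two measures are equivalent if each is absolutely continuous with respect to the other. *)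

theory Defs
  imports "HOL-Probability.Probability"
begin

definition orthonormal_basis :: "(nat \<Rightarrow> 'h::real_inner) \<Rightarrow> bool" where
  "orthonormal_basis e \<longleftrightarrow>
     (\<forall>i j. e i \<bullet> e j = (if i = j then 1 else 0)) \<and> closure (span (range e)) = UNIV"

text \<open>
  A densely defined linear operator with domain \<open>D\<close>; the values of \<open>A\<close> outside \<open>D\<close> are irrelevant.
  The last conjunct says that the graph of the adjoint operator is the graph of \<open>A\<close> on \<open>D\<close>,
  equality of the domains included.
\<close>

definition self_adjoint_operator :: "'h::real_inner set \<Rightarrow> ('h \<Rightarrow> 'h) \<Rightarrow> bool" where
  "self_adjoint_operator D A \<longleftrightarrow>
     subspace D \<and> closure D = UNIV \<and>
     (\<forall>x\<in>D. \<forall>y\<in>D. A (x + y) = A x + A y) \<and> (\<forall>c. \<forall>x\<in>D. A (c *\<^sub>R x) = c *\<^sub>R A x) \<and>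
     (\<forall>y z. (\<forall>x\<in>D. A x \<bullet> y = x \<bullet> z) \<longleftrightarrow> y \<in> D \<and> z = A y)"

text \<open>
  Time is a real parameter restricted to \<open>t \<ge> 0\<close>; only the \<open>\<sigma>\<close>-algebra of each \<open>F t\<close> matters.
\<close>

definition usual_stochastic_basis :: "'w measure \<Rightarrow> (real \<Rightarrow> 'w measure) \<Rightarrow> bool" where
  "usual_stochastic_basis M F \<longleftrightarrow>
     prob_space M \<and> complete_measure M \<and>
     (\<forall>t\<ge>0. subalgebra M (F t)) \<and>
     (\<forall>s t. 0 \<le> s \<and> s \<le> t \<longrightarrow> sets (F s) \<subseteq> sets (F t)) \<and>
     null_sets M \<subseteq> sets (F 0) \<and>
     (\<forall>t\<ge>0. sets (F t) = (\<Inter>s\<in>{t<..}. sets (F s)))"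

definition cadlag :: "(real \<Rightarrow> real) \<Rightarrow> bool" where
  "cadlag z \<longleftrightarrow>
     (\<forall>t\<ge>0. (z \<longlongrightarrow> z t) (at_right t)) \<and> (\<forall>t>0. \<exists>l. (z \<longlongrightarrow> l) (at_left t))"

definition levy_process ::
    "'w measure \<Rightarrow> (real \<Rightarrow> 'w measure) \<Rightarrow> (real \<Rightarrow> 'w \<Rightarrow> real) \<Rightarrow> bool" where
  "levy_process M F Z \<longleftrightarrow>
     (\<forall>t\<ge>0. Z t \<in> borel_measurable (F t)) \<and>
     (AE \<omega> in M. Z 0 \<omega> = 0) \<and>
     (\<forall>s t. 0 \<le> s \<and> s \<le> t \<longrightarrow>
        prob_space.indep_set M (sets (F s))
          {(\<lambda>\<omega>. Z t \<omega> - Z s \<omega>) -` B \<inter> space M | B. B \<in> sets borel}) \<and>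
     (\<forall>s t. 0 \<le> s \<and> s \<le> t \<longrightarrow>
        distr M borel (\<lambda>\<omega>. Z t \<omega> - Z s \<omega>) = distr M borel (Z (t - s))) \<and>
     (\<forall>t\<ge>0. \<forall>\<epsilon>>0.
        ((\<lambda>s. measure M {\<omega> \<in> space M. \<epsilon> \<le> \<bar>Z s \<omega> - Z t \<omega>\<bar>}) \<longlongrightarrow> 0) (at t within {0..})) \<and>
     (AE \<omega> in M. cadlag (\<lambda>t. Z t \<omega>))"

definition normalized_symmetric_stable_process ::
    "'w measure \<Rightarrow> (real \<Rightarrow> 'w measure) \<Rightarrow> real \<Rightarrow> (real \<Rightarrow> 'w \<Rightarrow> real) \<Rightarrow> bool" where
  "normalized_symmetric_stable_process M F \<alpha> Z \<longleftrightarrow>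
     levy_process M F Z \<and>
     (\<forall>t\<ge>0. \<forall>h. char (distr M borel (Z t)) h = complex_of_real (exp (- t * \<bar>h\<bar> powr \<alpha>)))"

definition independent_processes :: "'w measure \<Rightarrow> (nat \<Rightarrow> real \<Rightarrow> 'w \<Rightarrow> real) \<Rightarrow> bool" where
  "independent_processes M Z \<longleftrightarrow>
     prob_space.indep_vars M (\<lambda>_. PiM {0..} (\<lambda>_. borel)) (\<lambda>n \<omega>. \<lambda>t\<in>{0..}. Z n t \<omega>) UNIV"

text \<open>
  The stochastic integral of a continuous deterministic integrand \<open>f\<close> over \<open>[0, t]\<close> is the limit in
  probability of the left-endpoint sums as the mesh of the partition tends to \<open>0\<close>.  It is
  determined almost surely; \<open>stochastic_integral\<close> fixes one version.
\<close>

definition is_partition :: "real \<Rightarrow> nat \<Rightarrow> (nat \<Rightarrow> real) \<Rightarrow> bool" where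
  "is_partition t r s \<longleftrightarrow> s 0 = 0 \<and> s r = t \<and> (\<forall>i<r. s i \<le> s (Suc i))"

definition has_stochastic_integral ::
    "'w measure \<Rightarrow> (real \<Rightarrow> 'w \<Rightarrow> real) \<Rightarrow> (real \<Rightarrow> real) \<Rightarrow> real \<Rightarrow> ('w \<Rightarrow> real) \<Rightarrow> bool" where
  "has_stochastic_integral M Z f t I \<longleftrightarrow>
     I \<in> borel_measurable M \<and>
     (\<forall>\<epsilon>>0. \<forall>\<eta>>0. \<exists>\<delta>>0. \<forall>r s.
        is_partition t r s \<and> (\<forall>i<r. s (Suc i) - s i < \<delta>) \<longrightarrow>
        measure M {\<omega> \<in> space M.
          \<epsilon> \<le> \<bar>(\<Sum>i<r. f (s i) * (Z (s (Suc i)) \<omega> - Z (s i) \<omega>)) - I \<omega>\<bar>} < \<eta>)"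

definition stochastic_integral ::
    "'w measure \<Rightarrow> (real \<Rightarrow> 'w \<Rightarrow> real) \<Rightarrow> (real \<Rightarrow> real) \<Rightarrow> real \<Rightarrow> 'w \<Rightarrow> real" where
  "stochastic_integral M Z f t = (SOME I. has_stochastic_integral M Z f t I)"

definition ou_coord ::
    "'w measure \<Rightarrow> (nat \<Rightarrow> real \<Rightarrow> 'w \<Rightarrow> real) \<Rightarrow> (nat \<Rightarrow> real) \<Rightarrow> (nat \<Rightarrow> real) \<Rightarrow>
      (nat \<Rightarrow> 'h::real_inner) \<Rightarrow> 'h \<Rightarrow> nat \<Rightarrow> real \<Rightarrow> 'w \<Rightarrow> real" where
  "ou_coord M Z \<beta> \<gamma> e x n t \<omega> =
     exp (- \<gamma> n * t) * (x \<bullet> e n) +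
     stochastic_integral M (Z n) (\<lambda>s. exp (- \<gamma> n * (t - s)) * \<beta> n) t \<omega>"

text \<open>
  The series converges in \<open>H\<close> only almost surely; on the exceptional null set \<open>suminf\<close> takes a fixed
  unspecified value, which does not affect the law.
\<close>

definition ou_process ::
    "'w measure \<Rightarrow> (nat \<Rightarrow> real \<Rightarrow> 'w \<Rightarrow> real) \<Rightarrow> (nat \<Rightarrow> real) \<Rightarrow> (nat \<Rightarrow> real) \<Rightarrow>
      (nat \<Rightarrow> 'h::real_inner) \<Rightarrow> 'h \<Rightarrow> real \<Rightarrow> 'w \<Rightarrow> 'h" where
  "ou_process M Z \<beta> \<gamma> e x t \<omega> = (\<Sum>n. ou_coord M Z \<beta> \<gamma> e x n t \<omega> *\<^sub>R e n)"

definition ou_law ::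
    "'w measure \<Rightarrow> (nat \<Rightarrow> real \<Rightarrow> 'w \<Rightarrow> real) \<Rightarrow> (nat \<Rightarrow> real) \<Rightarrow> (nat \<Rightarrow> real) \<Rightarrow>
      (nat \<Rightarrow> 'h::real_inner) \<Rightarrow> real \<Rightarrow> 'h \<Rightarrow> 'h measure" where
  "ou_law M Z \<beta> \<gamma> e t x = distr M borel (ou_process M Z \<beta> \<gamma> e x t)"

definition is_stable_density :: "real \<Rightarrow> (real \<Rightarrow> real) \<Rightarrow> bool" where
  "is_stable_density \<alpha> p \<longleftrightarrow>
     p \<in> borel_measurable borel \<and> (\<forall>u. 0 \<le> p u) \<and> prob_space (density lborel p) \<and>
     (\<forall>s. char (density lborel p) s = complex_of_real (exp (- (\<bar>s\<bar> powr \<alpha>))))"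

definition ou_scale :: "real \<Rightarrow> (nat \<Rightarrow> real) \<Rightarrow> (nat \<Rightarrow> real) \<Rightarrow> nat \<Rightarrow> real \<Rightarrow> real" where
  "ou_scale \<alpha> \<beta> \<gamma> k t = \<beta> k * ((1 - exp (- \<alpha> * \<gamma> k * t)) / (\<alpha> * \<gamma> k)) powr (1 / \<alpha>)"

definition equivalent_measures :: "'a measure \<Rightarrow> 'a measure \<Rightarrow> bool" where
  "equivalent_measures \<mu> \<nu> \<longleftrightarrow> absolutely_continuous \<mu> \<nu> \<and> absolutely_continuous \<nu> \<mu>"

definition converges_in_L1 :: "'a measure \<Rightarrow> (nat \<Rightarrow> 'a \<Rightarrow> real) \<Rightarrow> ('a \<Rightarrow> real) \<Rightarrow> bool" where
  "converges_in_L1 \<mu> f g \<longleftrightarrow>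
     (\<forall>N. integrable \<mu> (f N)) \<and> integrable \<mu> g \<and>
     (\<lambda>N. \<integral>z. \<bar>f N z - g z\<bar> \<partial>\<mu>) \<longlonglongrightarrow> 0"

end

theory Submission
  imports Defs "HOL-Real_Asymp.Real_Asymp"
begin

text \<open>
  All laws are images, under \<open>a \<mapsto> \<Sum>n. a n *\<^sub>R e n\<close>, of infinite products of shifted and scaled copies
  of the stable law, so the first part is Kakutani's theorem on products.  It needs a Hellinger
  estimate \<open>1 - \<integral> sqrt (p u * p (u - h)) du \<le> C * h\<^sup>2\<close>.  Instead of tail asymptotics of \<open>p\<close>, use that
  \<open>p\<close> is a mixture of centred Gaussians whose random variance \<open>2 * v\<close> is governed by the positive
  \<open>\<alpha> / 2\<close>-stable law: by Cauchy-Schwarz in \<open>v\<close> the estimate reduces to the explicit Gaussian affinity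
  and to \<open>E[1 / v] = \<integral>\<^sub>0\<^sup>\<infinity> exp (- l powr (\<alpha> / 2)) dl < \<infinity>\<close>.  For the second part a suitable \<open>x\<close>
  shifts infinitely many normalized coordinates by a large amount, and Borel-Cantelli separates
  the two laws.
\<close>

section \<open>Positive stable laws\<close>

text \<open>The obstacle is that \<open>p\<close> has no closed form in general and no second
  moment, so neither the distance between shifted copies nor the convergence of the series in
  \<open>H\<close> can be computed directly; averages over Gaussian variables replace both
  computations. The boundedness condition enters through one quantity. After standardization,
  passing from \<open>y\<close> to \<open>x\<close> shifts coordinate \<open>n\<close> by
  \<open>exp (- \<gamma> n * t) * (x_n - y_n) / c_n(t)\<close>. As \<open>\<gamma> n\<close> tends
  to infinity, \<open>c_n(t) * \<gamma> n powr (1 / \<alpha>) / \<beta> n\<close> tends to a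
  positive constant, so the condition at \<open>t\<close> says exactly that
  \<open>exp (- \<gamma> n * t) / c_n(t)\<close> is bounded. The shifts are then square summable for
  all \<open>x\<close> and \<open>y\<close>, which is what a Hellinger bound of quadratic order can
  use; if the factor is unbounded, some \<open>x\<close> in \<open>H\<close> has arbitrarily large
  standardized shifts along a subsequence. The summability hypothesis has a different role: it
  bounds the noise and makes the series converge in \<open>H\<close> almost surely.\<close>

definition has_laplace :: "real measure \<Rightarrow> (real \<Rightarrow> real) \<Rightarrow> bool" where
  "has_laplace M \<phi> \<longleftrightarrow> real_distribution M \<and> (AE x in M. 0 \<le> x) \<and>
     (\<forall>l\<ge>0. (\<integral>x. exp (- l * x) \<partial>M) = \<phi> l)"

lemma has_laplace_integrable:
  assumes "has_laplace M \<phi>" "0 \<le> l"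
  shows "integrable M (\<lambda>x. exp (- l * x))"
proof -
  interpret real_distribution M using assms by (simp add: has_laplace_def)
  show ?thesis
    using assms by (intro integrable_const_bound[where B=1]) (auto simp: has_laplace_def mult_nonneg_nonneg)
qed

lemma has_laplace_return: "has_laplace (return borel 0) (\<lambda>_. 1)"
proof -
  interpret prob_space "return borel (0::real)" by (rule prob_space_return) simp
  have "real_distribution (return borel (0::real))"
    by unfold_locales auto
  then show ?thesis
    by (simp add: has_laplace_def AE_return integral_return)
qed

lemma has_laplace_mult:
  assumes M: "has_laplace M \<phi>" and N: "has_laplace N \<psi>"
  shows "has_laplace (distr (M \<Otimes>\<^sub>M N) borel (\<lambda>(x, y). x + y)) (\<lambda>l. \<phi> l * \<psi> l)"
proof -
  interpret M: real_distribution M using M by (simp add: has_laplace_def)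
  interpret N: real_distribution N using N by (simp add: has_laplace_def)
  interpret P: pair_prob_space M N ..
  have meas[measurable]: "(\<lambda>(x, y). x + y) \<in> borel_measurable (M \<Otimes>\<^sub>M N)"
    by measurable
  have 1: "real_distribution (distr (M \<Otimes>\<^sub>M N) borel (\<lambda>(x, y). x + y))"
    by (intro P.real_distribution_distr) simp
  have "AE z in M \<Otimes>\<^sub>M N. 0 \<le> fst z + snd z"
  proof (rule P.AE_pair_measure)
    show "{x \<in> space (M \<Otimes>\<^sub>M N). 0 \<le> fst x + snd x} \<in> sets (M \<Otimes>\<^sub>M N)" by measurable
    have "AE x in M. 0 \<le> x" "AE x in N. 0 \<le> x" using M N by (auto simp: has_laplace_def)
    then show "AE x in M. AE y in N. 0 \<le> fst (x, y) + snd (x, y)"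
      by (auto elim!: AE_mp)
  qed
  then have 2: "AE z in distr (M \<Otimes>\<^sub>M N) borel (\<lambda>(x, y). x + y). 0 \<le> z"
    by (subst AE_distr_iff) (auto simp: case_prod_beta)
  have 3: "(\<integral>x. exp (- l * x) \<partial>distr (M \<Otimes>\<^sub>M N) borel (\<lambda>(x, y). x + y)) = \<phi> l * \<psi> l" if "0 \<le> l" for l
  proof -
    have "(\<integral>x. exp (- l * x) \<partial>distr (M \<Otimes>\<^sub>M N) borel (\<lambda>(x, y). x + y)) =
        (\<integral>z. exp (- l * fst z) * exp (- l * snd z) \<partial>(M \<Otimes>\<^sub>M N))"
      by (subst integral_distr) (auto simp: case_prod_beta algebra_simps exp_add[symmetric])
    also have "\<dots> = (\<integral>x. exp (- l * x) \<partial>M) * (\<integral>x. exp (- l * x) \<partial>N)"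
    proof -
      have "integrable (M \<Otimes>\<^sub>M N) (\<lambda>z. exp (- l * fst z) * exp (- l * snd z))"
        using has_laplace_integrable[OF M that] has_laplace_integrable[OF N that]
        by (intro P.Fubini_integrable) auto
      then show ?thesis by (subst P.integral_fst'[symmetric]) auto
    qed
    finally show ?thesis using that M N by (simp add: has_laplace_def)
  qed
  show ?thesis using 1 2 3 by (simp add: has_laplace_def)
qed

lemma has_laplace_power:
  assumes "has_laplace M \<phi>"
  shows "\<exists>N. has_laplace N (\<lambda>l. \<phi> l ^ k)"
proof (induction k)
  case 0 then show ?case using has_laplace_return by auto
next
  case (Suc k) then show ?case using has_laplace_mult[OF assms] by auto
qed

lemma has_laplace_scale:
  assumes M: "has_laplace M \<phi>" and c: "0 \<le> c"
  shows "has_laplace (distr M borel (\<lambda>x. c * x)) (\<lambda>l. \<phi> (l * c))"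
proof -
  interpret M: real_distribution M using M by (simp add: has_laplace_def)
  have "real_distribution (distr M borel (\<lambda>x. c * x))"
    by (intro M.real_distribution_distr) simp
  moreover have "AE x in distr M borel (\<lambda>x. c * x). 0 \<le> x"
    using M c by (subst AE_distr_iff) (auto simp: has_laplace_def)
  ultimately show ?thesis
    using M c by (auto simp: has_laplace_def integral_distr mult.assoc[symmetric])
qed

text \<open>A one-sided continuity theorem. The bound \<open>\<psi>\<close>, uniform in
  \<open>n\<close> and vanishing at 0, gives tightness; a weakly convergent subsequence then
  suffices, because only the existence of a law with transform \<open>\<phi>'\<close> is
  claimed.\<close>

lemma has_laplace_limit:
  assumes M: "\<And>n. has_laplace (M n) (\<phi> n)"
    and lim: "\<And>l. 0 \<le> l \<Longrightarrow> (\<lambda>n. \<phi> n l) \<longlonglongrightarrow> \<phi>' l"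
    and bnd: "\<And>n l. 0 < l \<Longrightarrow> 1 - \<phi> n l \<le> \<psi> l" and \<psi>: "(\<psi> \<longlongrightarrow> 0) (at_right 0)"
  shows "\<exists>N. has_laplace N \<phi>'"
proof -
  interpret M: real_distribution "M n" for n using M by (simp add: has_laplace_def)
  have nonneg: "AE x in M n. 0 \<le> x" for n using M by (simp add: has_laplace_def)
  \<comment> \<open>Markov's inequality at \<open>l = 1 / b\<close>: on \<open>x > b\<close> the
    function \<open>1 - exp (- x / b)\<close> is at least \<open>1 - exp (-1)\<close>, hence at
    least 1/2; this is the factor 2.\<close>
  have tail: "measure (M n) {b<..} \<le> 2 * \<psi> (1 / b)" if b: "0 < b" for b n
  proof -
    have i: "integrable (M n) (\<lambda>x. exp (- (1/b) * x))"
      using has_laplace_integrable[OF M, of "1/b"] b by simp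
    have "(1 - exp (-1)) * measure (M n) {b<..} = (\<integral>x. (1 - exp (-1)) * indicator {b<..} x \<partial>M n)"
      by simp
    also have "\<dots> \<le> (\<integral>x. 1 - exp (- (1/b) * x) \<partial>M n)"
    proof (intro integral_mono_AE)
      show "integrable (M n) (\<lambda>x. (1 - exp (-1)) * indicator {b<..} x :: real)" 
        by (simp add: M.emeasure_eq_measure)
      show "AE x in M n. (1 - exp (-1)) * indicator {b<..} x \<le> 1 - exp (- (1/b) * x)"
        using nonneg[of n]
      proof eventually_elim
        case (elim x)
        then show ?case using b by (auto simp: indicator_def divide_simps)
      qed
    qed (use i in auto)
    also have "\<dots> = 1 - \<phi> n (1/b)"
    proof -
      have "(\<integral>x. exp (- (1/b) * x) \<partial>M n) = \<phi> n (1/b)"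
        using M[of n] b unfolding has_laplace_def by (meson divide_nonneg_pos less_imp_le zero_le_one)
      then show ?thesis
        using i M.prob_space[of n] by (subst Bochner_Integration.integral_diff) auto
    qed
    also have "\<dots> \<le> \<psi> (1/b)" using bnd b by simp
    finally have "(1 - exp (-1)) * measure (M n) {b<..} \<le> \<psi> (1/b)" .
    moreover have e: "exp (-1) \<le> (1/2::real)"
      using exp_ge_add_one_self[of 1] by (simp add: exp_minus field_simps)
    have "(1/2) * measure (M n) {b<..} \<le> (1 - exp (-1)) * measure (M n) {b<..}"
      using e by (intro mult_right_mono) auto
    ultimately show ?thesis by linarith
  qed
  have "tight M"
    unfolding tight_def
  proof (intro conjI allI impI)
    fix \<epsilon> :: real assume "\<epsilon> > 0"
    then have "eventually (\<lambda>l. \<psi> l < \<epsilon> / 2) (at_right 0)" using order_tendstoD(2)[OF \<psi>, of "\<epsilon>/2"] by simp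
    then obtain d where d: "d > 0" "\<And>l. 0 < l \<Longrightarrow> l < d \<Longrightarrow> \<psi> l < \<epsilon> / 2"
      by (auto simp: eventually_at_right_field)
    \<comment> \<open>The point \<open>1 / b = d / 2\<close> lies strictly inside (0, d), where
      \<open>\<psi>\<close> is below \<open>\<epsilon> / 2\<close>.\<close>
    define b where "b = 2 / d"
    have b: "b > 0" "\<psi> (1 / b) < \<epsilon> / 2" using d by (auto simp: b_def)
    show "\<exists>a b. a < b \<and> (\<forall>n. 1 - \<epsilon> < measure (M n) {a<..b})"
    proof (rule exI[of _ "-1"], rule exI[of _ b], intro conjI allI)
      fix n
      have "1 = measure (M n) {0..}"
        using M.prob_eq_1[of "{0..}"] nonneg[of n] by simp
      also have "\<dots> \<le> measure (M n) ({-1<..b} \<union> {b<..})"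
        by (intro M.finite_measure_mono) auto
      also have "\<dots> \<le> measure (M n) {-1<..b} + measure (M n) {b<..}"
        by (intro measure_Un_le) auto
      finally show "1 - \<epsilon> < measure (M n) {-1<..b}" using tail[of b n] b by auto
    qed (use b in auto)
  qed (rule M.real_distribution_axioms)
  then obtain r N where r: "strict_mono (r :: nat \<Rightarrow> nat)" and N: "real_distribution N"
    and w: "weak_conv_m (M \<circ> id \<circ> r) N"
    using tight_imp_convergent_subsubsequence[of M id] by (auto simp: strict_mono_id)
  interpret N: real_distribution N by (rule N)
  have conv: "(\<lambda>n. integral\<^sup>L (M (r n)) f) \<longlonglongrightarrow> integral\<^sup>L N f"
    if "\<And>x. isCont f x" "\<And>x. \<bar>f x\<bar> \<le> B" for f :: "real \<Rightarrow> real" and B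
    using weak_conv_imp_integral_bdd_continuous_conv[of "\<lambda>n. M (r n)" N f B] that w N M.real_distribution_axioms
    by (simp add: o_def)
  \<comment> \<open>This bounded continuous test function vanishes exactly on the half line, so weak
    convergence carries nonnegativity over to \<open>N\<close>.\<close>
  have neg: "(\<lambda>n. integral\<^sup>L (M (r n)) (\<lambda>x. min 1 (max 0 (- x)))) \<longlonglongrightarrow> integral\<^sup>L N (\<lambda>x. min 1 (max 0 (- x)))"
    by (intro conv[of _ 1]) (auto intro!: continuous_intros)
  have "integral\<^sup>L (M n) (\<lambda>x. min 1 (max 0 (- x))) = 0" for n
  proof -
    have "integral\<^sup>L (M n) (\<lambda>x. min 1 (max 0 (- x))) = integral\<^sup>L (M n) (\<lambda>x. 0)"
      using nonneg[of n] by (intro integral_cong_AE) auto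
    then show ?thesis by simp
  qed
  with neg have "integral\<^sup>L N (\<lambda>x. min 1 (max 0 (- x))) = 0"
    by (simp add: LIMSEQ_const_iff)
  moreover have "integrable N (\<lambda>x. min 1 (max 0 (- x)))"
    by (intro N.integrable_const_bound[where B=1]) auto
  ultimately have "AE x in N. min 1 (max 0 (- x)) = 0"
    using integral_nonneg_eq_0_iff_AE[of N "\<lambda>x. min 1 (max 0 (- x))"] by auto
  then have Nn: "AE x in N. 0 \<le> x" by eventually_elim (auto simp: min_def max_def split: if_splits)
  have "(\<integral>x. exp (- l * x) \<partial>N) = \<phi>' l" if l: "0 \<le> l" for l
  proof -
    \<comment> \<open>\<open>exp (- l * x)\<close> is unbounded on the negative axis for
      \<open>l > 0\<close>, so weak convergence is applied to \<open>exp (- l * max 0 x)\<close>,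
      which agrees with it almost surely under every law involved.\<close>
    have pos: "(\<integral>x. exp (- l * x) \<partial>K) = (\<integral>x. exp (- l * max 0 x) \<partial>K)"
      if "AE x in K. 0 \<le> x" "sets K = sets borel" for K
    proof (intro integral_cong_AE)
      show "AE x in K. exp (- l * x) = exp (- l * max 0 x)"
        using that(1) by eventually_elim auto
    qed (use that(2) in \<open>auto simp: measurable_cong_sets[OF that(2) refl]\<close>)
    have "(\<lambda>n. \<integral>x. exp (- l * max 0 x) \<partial>M (r n)) \<longlonglongrightarrow> (\<integral>x. exp (- l * max 0 x) \<partial>N)"
      using l by (intro conv[of _ 1]) (auto intro!: continuous_intros mult_nonneg_nonneg)
    moreover have "(\<integral>x. exp (- l * max 0 x) \<partial>M (r n)) = \<phi> (r n) l" for n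
      using pos[OF nonneg[of "r n"]] M[of "r n"] l by (simp add: has_laplace_def)
    moreover have "(\<lambda>n. \<phi> (r n) l) \<longlonglongrightarrow> \<phi>' l"
      using LIMSEQ_subseq_LIMSEQ[OF lim[OF l] r] by (simp add: o_def)
    ultimately have "(\<integral>x. exp (- l * max 0 x) \<partial>N) = \<phi>' l" using LIMSEQ_unique by simp
    then show ?thesis using pos[OF Nn] by simp
  qed
  then show ?thesis using N Nn by (auto simp: has_laplace_def)
qed

text \<open>The generating function \<open>1 - (1 - z) powr a\<close> puts this law in the domain of attraction of the
  positive \<open>a\<close>-stable law, with no error terms to control.\<close>

lemma sibuya:
  assumes a: "0 < a" "a < 1"
  shows "\<exists>M. has_laplace M (\<lambda>l. 1 - (1 - exp (- l)) powr a)"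
proof -
  \<comment> \<open>The power series coefficients of \<open>1 - (1 - z) powr a\<close>. They are
    nonnegative because \<open>w 1 = a\<close> and
    \<open>w (n + 1) / w n = (n - a) / (n + 1)\<close> with \<open>n \<ge> 1 > a\<close>.\<close>
  define w where "w n = (if n = 0 then 0 else (-1) ^ (n + 1) * (a gchoose n))" for n :: nat
  have nn1: "0 \<le> w (Suc n)" for n
  proof (induction n)
    case (Suc n)
    have eq: "w (Suc (Suc n)) = w (Suc n) * ((of_nat (Suc n) - a) / (of_nat (Suc (Suc n))))"
    proof -
      have "a gchoose Suc (Suc n) = (a - real (Suc n)) * (a gchoose Suc n) / real (Suc (Suc n))"
        using gbinomial_mult_1[of a "Suc n"] by (simp add: field_simps)
      then show ?thesis unfolding w_def by (simp del: of_nat_Suc gbinomial_Suc) (simp add: divide_simps algebra_simps del: of_nat_Suc)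
    qed
    show ?case unfolding eq using a Suc by (intro mult_nonneg_nonneg divide_nonneg_nonneg) auto
  qed (use a in \<open>simp add: w_def\<close>)
  have nn: "0 \<le> w n" for n using nn1[of "n - 1"] by (cases n) (auto simp: w_def)
  have gf: "(\<lambda>n. w n * z ^ n) sums (1 - (1 - z) powr a)" if "0 \<le> z" "z < 1" for z
  proof -
    have "(\<lambda>n. (a gchoose n) * (- z) ^ n) sums (1 + - z) powr a"
      using gen_binomial_real[of "- z" a] that by simp
    from sums_diff[OF sums_single[of 0 "\<lambda>_. 1"] this]
    have "(\<lambda>n. (if n = 0 then 1 else 0) - (a gchoose n) * (- z) ^ n) sums (1 - (1 - z) powr a)"
      by simp
    moreover have "(if n = 0 then 1 else 0) - (a gchoose n) * (- z) ^ n = w n * z ^ n" for n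
      by (auto simp: w_def power_minus[of z])
    ultimately show ?thesis by simp
  qed
  \<comment> \<open>The binomial series is available only for \<open>z < 1\<close>. Letting
    \<open>z\<close> tend to 1 bounds the partial sums, and comparing the series with its value at 1
    then shows that the total mass is exactly 1.\<close>
  have part: "(\<Sum>k<m. w k) \<le> 1" for m
  proof (rule tendsto_upperbound)
    show "((\<lambda>z. \<Sum>k<m. w k * z ^ k) \<longlongrightarrow> (\<Sum>k<m. w k)) (at_left 1)"
      by (auto intro!: tendsto_eq_intros)
    have "(\<Sum>k<m. w k * z ^ k) \<le> 1" if "0 \<le> z" "z < 1" for z
    proof -
      have "(\<Sum>k<m. w k * z ^ k) \<le> 1 - (1 - z) powr a"
        using gf[OF that] nn that sum_le_suminf[of "\<lambda>k. w k * z ^ k" "{..<m}"] by (auto simp: sums_iff)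
      then show ?thesis using powr_ge_zero[of "1 - z" a] by linarith
    qed
    then show "\<forall>\<^sub>F z in at_left 1. (\<Sum>k<m. w k * z ^ k) \<le> 1"
      by (auto simp: eventually_at_left_field intro!: exI[of _ 0])
  qed auto
  have sw: "summable w"
  proof (rule bounded_imp_summable[of _ 1])
    show "(\<Sum>k\<le>n. w k) \<le> 1" for n using part[of "Suc n"] by (simp only: lessThan_Suc_atMost)
  qed (rule nn)
  have "suminf w \<le> 1" using part sw by (intro suminf_le_const) auto
  moreover have "1 \<le> suminf w"
  proof (rule tendsto_upperbound)
    show "((\<lambda>z. 1 - (1 - z) powr a) \<longlongrightarrow> 1) (at_left 1)"
      using a by real_asymp
    have "1 - (1 - z) powr a \<le> suminf w" if "0 \<le> z" "z < 1" for z
    proof (rule sums_le[OF _ gf[OF that] summable_sums[OF sw]])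
      show "w n * z ^ n \<le> w n" for n
        using nn[of n] that by (auto intro!: mult_right_le_one_le power_le_one)
    qed
    then show "\<forall>\<^sub>F z in at_left 1. 1 - (1 - z) powr a \<le> suminf w"
      by (auto simp: eventually_at_left_field intro!: exI[of _ 0])
  qed auto
  ultimately have w1: "w sums 1" using sw summable_sums by fastforce
  have "(\<integral>\<^sup>+ n. ennreal (w n) \<partial>count_space UNIV) = 1"
    using w1 nn sw by (simp add: nn_integral_count_space_nat suminf_ennreal2 sums_unique[symmetric])
  then have pmf: "pmf (embed_pmf w) n = w n" for n
    using nn by (intro pmf_embed_pmf) auto
  define P where "P = embed_pmf w"
  define M where "M = distr (measure_pmf P) borel real"
  have "real_distribution M" unfolding M_def by (intro prob_space.real_distribution_distr measure_pmf.prob_space_axioms) simp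
  moreover have "AE x in M. 0 \<le> x" unfolding M_def by (subst AE_distr_iff) auto
  moreover have "(\<integral>x. exp (- l * x) \<partial>M) = 1 - (1 - exp (- l)) powr a" if l: "0 \<le> l" for l
  proof (cases "l = 0")
    \<comment> \<open>This is \<open>z = 1\<close>, outside the range of \<open>gf\<close>: the
      integral is the total mass, and the right-hand side is 1 because
      \<open>0 powr a = 0\<close>.\<close>
    case True
    then show ?thesis using calculation(1) a by (simp add: real_distribution_def prob_space.prob_space)
  next
    case False
    then have z: "0 \<le> exp (- l)" "exp (- l) < 1" using l by auto
    have s: "(\<lambda>n. w n * exp (- l) ^ n) sums (1 - (1 - exp (- l)) powr a)" by (rule gf[OF z])
    have "(\<integral>x. exp (- l * x) \<partial>M) = (\<integral>n. exp (- l * real n) \<partial>measure_pmf P)"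
      unfolding M_def by (simp add: integral_distr)
    also have "\<dots> = (\<integral>n. w n * exp (- l) ^ n \<partial>count_space UNIV)"
      unfolding measure_pmf_eq_density P_def using pmf nn
      by (subst integral_density) (auto simp: exp_of_nat_mult[symmetric] mult.commute)
    also have "\<dots> = (\<Sum>n. w n * exp (- l) ^ n)"
      using s nn by (intro integral_count_space_nat) (auto simp: integrable_count_space_nat_iff abs_mult sums_iff)
    finally show ?thesis using s by (simp add: sums_iff)
  qed
  ultimately show ?thesis by (auto simp: has_laplace_def)
qed

text \<open>A limit theorem for sums: \<open>k + 1\<close> independent variables with the law of
  \<open>sibuya\<close>, added and divided by \<open>(k + 1) powr (1 / a)\<close>, have the
  transform \<open>\<phi> k\<close>, which behaves like the power \<open>k + 1\<close> of
  \<open>1 - l powr a / (k + 1)\<close>.\<close>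

lemma positive_stable_law:
  assumes a: "0 < a" "a < 1"
  shows "\<exists>M. has_laplace M (\<lambda>l. exp (- (l powr a)))"
proof -
  obtain S where S: "has_laplace S (\<lambda>l. 1 - (1 - exp (- l)) powr a)" using sibuya[OF a] by auto
  define \<phi> where "\<phi> k l = (1 - (1 - exp (- (l * real (Suc k) powr (- 1 / a)))) powr a) ^ Suc k" for k :: nat and l :: real
  have "\<exists>N. has_laplace N (\<phi> k)" for k
    using has_laplace_power[OF has_laplace_scale[OF S, of "real (Suc k) powr (- 1 / a)"], of "Suc k"]
    unfolding \<phi>_def by simp
  then obtain N where N: "\<And>k. has_laplace (N k) (\<phi> k)" by metis
  show ?thesis
  proof (rule has_laplace_limit[OF N, where \<psi>="\<lambda>l. l powr a"])
    fix l :: real assume "0 \<le> l"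
    show "(\<lambda>k. \<phi> k l) \<longlonglongrightarrow> exp (- (l powr a))"
    proof (cases "l = 0")
      case True then show ?thesis using a by (simp add: \<phi>_def)
    next
      case False
      then have l: "l > 0" using \<open>0 \<le> l\<close> by simp
      show ?thesis unfolding \<phi>_def using l a
        by real_asymp
    qed
  next
    fix n :: nat and l :: real assume l: "0 < l"
    \<comment> \<open>Since \<open>1 - exp (- y) \<le> y\<close>, \<open>q\<close> is at most
      \<open>l powr a / (n + 1)\<close>; Bernoulli's inequality bounds
      \<open>1 - (1 - q) ^ (n + 1)\<close> by \<open>(n + 1) * q\<close>, hence by
      \<open>l powr a\<close> uniformly in \<open>n\<close>.\<close>
    define q where "q = (1 - exp (- (l * real (Suc n) powr (- 1 / a)))) powr a"
    have le1: "1 - exp (- (l * real (Suc n) powr (- 1 / a))) \<le> l * real (Suc n) powr (- 1 / a)"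
      using exp_ge_add_one_self[of "- (l * real (Suc n) powr (- 1 / a))"] by simp
    have "q \<le> (l * real (Suc n) powr (- 1 / a)) powr a"
      unfolding q_def using a l le1 by (intro powr_mono2) auto
    also have "\<dots> = l powr a / real (Suc n)"
      using a l by (simp only: powr_mult powr_powr powr_ge_zero less_imp_le) (simp add: powr_minus_divide)
    finally have "real (Suc n) * q \<le> l powr a" by (simp add: field_simps)
    moreover have "1 - real (Suc n) * q \<le> (1 - q) ^ Suc n"
    proof -
      have "q \<le> 1 powr a" unfolding q_def using a l by (intro powr_mono2) auto
      then show ?thesis using Bernoulli_inequality[of "- q" "Suc n"] by simp
    qed
    ultimately show "1 - \<phi> n l \<le> l powr a" unfolding \<phi>_def q_def[symmetric] by linarith
  next
    show "((\<lambda>l. l powr a) \<longlongrightarrow> 0) (at_right 0)" using a by real_asymp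
  qed
qed

section \<open>The stable density as a Gaussian mixture\<close>

text \<open>The integrand decays faster than any power and is dominated by
  \<open>C / (1 + l)\<^sup>2\<close>, whose primitive is explicit;
  \<open>C = (1 + L)\<^sup>2\<close> covers the range before the decay sets in.\<close>

lemma stretched_exp_integrable:
  assumes a: "0 < a"
  shows "(\<integral>\<^sup>+ l. ennreal (exp (- (l powr a))) * indicator {0..} l \<partial>lborel) < \<infinity>"
proof -
  have "((\<lambda>l::real. (1 + l)\<^sup>2 * exp (- (l powr a))) \<longlongrightarrow> 0) at_top" using a by real_asymp
  then have "eventually (\<lambda>l. (1 + l)\<^sup>2 * exp (- (l powr a)) < 1) at_top"
    by (rule order_tendstoD) simp
  then obtain L0 where L0: "\<And>l. L0 \<le> l \<Longrightarrow> (1 + l)\<^sup>2 * exp (- (l powr a)) < 1"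
    by (auto simp: eventually_at_top_linorder)
  define L where "L = max 0 L0"
  define C where "C = (1 + L)\<^sup>2"
  have C: "1 \<le> C" by (simp add: C_def L_def)
  have bnd: "exp (- (l powr a)) \<le> C / (1 + l)\<^sup>2" if "0 \<le> l" for l
  proof -
    have "(1 + l)\<^sup>2 * exp (- (l powr a)) \<le> C"
    proof (cases "L0 \<le> l")
      case True
      then show ?thesis using L0[OF True] C by linarith
    next
      case False
      then have "(1 + l)\<^sup>2 * exp (- (l powr a)) \<le> (1 + L)\<^sup>2 * 1"
        using that by (intro mult_mono power_mono) (auto simp: L_def)
      then show ?thesis by (simp add: C_def)
    qed
    then show ?thesis using that by (simp add: field_simps)
  qed
  have "(\<integral>\<^sup>+ l. ennreal (exp (- (l powr a))) * indicator {0..} l \<partial>lborel) \<le>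
      (\<integral>\<^sup>+ l. ennreal (C / (1 + l)\<^sup>2) * indicator {0..} l \<partial>lborel)"
    by (intro nn_integral_mono) (auto simp: bnd ennreal_leI split: split_indicator)
  also have "\<dots> = ennreal (0 - (- C / (1 + 0)))"
  proof (rule nn_integral_FTC_atLeast)
    show "((\<lambda>l::real. - C / (1 + l)) \<longlongrightarrow> 0) at_top" by real_asymp
    show "((\<lambda>l. - C / (1 + l)) has_real_derivative C / (1 + x)\<^sup>2) (at x)" if "0 \<le> x" for x
      using that by (auto intro!: derivative_eq_intros simp: power2_eq_square)
    show "0 \<le> C / (1 + x)\<^sup>2" if "0 \<le> x" for x using C by simp
  qed auto
  finally show ?thesis by (simp add: order_le_less_trans)
qed

text \<open>Integrate the transform over \<open>l\<close>: by Tonelli the result is the mean of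
  \<open>F v\<close>, which is \<open>1 / v\<close> for positive \<open>v\<close> and infinite at 0.
  One finite integral thus excludes an atom at 0 and bounds the mean of
  \<open>1 / v\<close>.\<close>

lemma has_laplace_inverse_moment:
  assumes M: "has_laplace M (\<lambda>l. exp (- (l powr a)))" and a: "0 < a"
  shows "AE v in M. 0 < v" and "integrable M (\<lambda>v. 1 / v)"
proof -
  interpret M: real_distribution M using M by (simp add: has_laplace_def)
  interpret P: pair_sigma_finite M lborel ..
  define F where "F v = (\<integral>\<^sup>+ l. ennreal (exp (- l * v)) * indicator {0..} l \<partial>lborel)" for v :: real
  have nn: "AE v in M. 0 \<le> v" using M by (simp add: has_laplace_def)
  have Fm[measurable]: "F \<in> borel_measurable M" unfolding F_def by measurable
  have "(\<integral>\<^sup>+ v. F v \<partial>M) = (\<integral>\<^sup>+ l. (\<integral>\<^sup>+ v. ennreal (exp (- l * v)) * indicator {0..} l \<partial>M) \<partial>lborel)"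
    unfolding F_def by (intro P.Fubini'[symmetric]) measurable
  also have "\<dots> = (\<integral>\<^sup>+ l. ennreal (exp (- (l powr a))) * indicator {0..} l \<partial>lborel)"
  proof (intro nn_integral_cong)
    fix l :: real
    have "(\<integral>\<^sup>+ v. ennreal (exp (- l * v)) \<partial>M) = ennreal (exp (- (l powr a)))" if "0 \<le> l"
      using has_laplace_integrable[OF M that] M that
      by (subst nn_integral_eq_integral) (auto simp: has_laplace_def)
    then show "(\<integral>\<^sup>+ v. ennreal (exp (- l * v)) * indicator {0..} l \<partial>M) =
        ennreal (exp (- (l powr a))) * indicator {0..} l"
      by (subst nn_integral_multc) (auto split: split_indicator)
  qed
  also have "\<dots> < \<infinity>" by (rule stretched_exp_integrable[OF a])
  finally have fin: "(\<integral>\<^sup>+ v. F v \<partial>M) < \<infinity>" .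
  \<comment> \<open>Treated apart because \<open>1 / 0 = 0\<close> in HOL: the mean of
    \<open>1 / v\<close> would not see an atom at 0.\<close>
  have F0: "F 0 = \<infinity>"
  proof -
    have "ennreal (real n) \<le> emeasure lborel {0::real..}" for n
      using emeasure_mono[of "{0..real n}" "{0..}" lborel] by auto
    then have "emeasure lborel {0::real..} = \<infinity>"
      using ennreal_Ex_less_of_nat[of "emeasure lborel {0::real..}"]
      unfolding ennreal_of_nat_eq_real_of_nat by (metis infinity_ennreal_def leD less_top)
    then show ?thesis by (simp add: F_def)
  qed
  have F1: "F v = ennreal (1 / v)" if "0 < v" for v
  proof -
    have "F v = ennreal (0 - (- exp (- 0 * v) / v))" unfolding F_def
    proof (rule nn_integral_FTC_atLeast)
      show "((\<lambda>l. - exp (- l * v) / v) \<longlongrightarrow> 0) at_top" using that by real_asymp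
      show "((\<lambda>l. - exp (- l * v) / v) has_real_derivative exp (- x * v)) (at x)" if "0 \<le> x" for x
        using \<open>0 < v\<close> by (auto intro!: derivative_eq_intros)
    qed auto
    then show ?thesis by simp
  qed
  have "AE v in M. F v \<noteq> \<infinity>" using fin by (intro nn_integral_PInf_AE) auto
  with nn show pos: "AE v in M. 0 < v"
    by eventually_elim (use F0 in \<open>force simp: less_le\<close>)
  have "(\<integral>\<^sup>+ v. ennreal (norm (1 / v)) \<partial>M) = (\<integral>\<^sup>+ v. F v \<partial>M)"
    using pos by (intro nn_integral_cong_AE) (auto elim!: eventually_mono simp: F1)
  with fin show "integrable M (\<lambda>v. 1 / v)" by (intro integrableI_bounded) auto
qed

text \<open>Completing the square: the geometric mean of two Gaussian densities with variance
  \<open>2 * v\<close> and centres 0 and \<open>h\<close> is the density centred at the midpoint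
  \<open>h / 2\<close>, times \<open>exp (- h\<^sup>2 / (16 * v))\<close>.\<close>

lemma gaussian_affinity:
  assumes v: "0 < v"
  shows "(\<integral>\<^sup>+u. ennreal (sqrt (normal_density 0 (sqrt (2 * v)) u * normal_density 0 (sqrt (2 * v)) (u - h))) \<partial>lborel)
    = ennreal (exp (- h\<^sup>2 / (16 * v)))"
proof -
  have "sqrt (normal_density 0 (sqrt (2 * v)) u * normal_density 0 (sqrt (2 * v)) (u - h)) =
     exp (- h\<^sup>2 / (16 * v)) * normal_density (h / 2) (sqrt (2 * v)) u" for u
  proof (rule real_sqrt_unique)
    have "- u\<^sup>2 / (4 * v) + - (u - h)\<^sup>2 / (4 * v) = 2 * (- h\<^sup>2 / (16 * v)) + 2 * (- (u - h / 2)\<^sup>2 / (4 * v))"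
      using v by (simp add: field_simps power2_eq_square)
    then have "exp (- u\<^sup>2 / (4 * v)) * exp (- (u - h)\<^sup>2 / (4 * v)) =
        (exp (- h\<^sup>2 / (16 * v)))\<^sup>2 * (exp (- (u - h / 2)\<^sup>2 / (4 * v)))\<^sup>2"
      by (simp add: exp_add[symmetric] exp_double[symmetric])
    then show "(exp (- h\<^sup>2 / (16 * v)) * normal_density (h / 2) (sqrt (2 * v)) u)\<^sup>2 =
        normal_density 0 (sqrt (2 * v)) u * normal_density 0 (sqrt (2 * v)) (u - h)"
      using v by (simp add: normal_density_def power_mult_distrib power_divide power2_eq_square field_simps)
  qed simp
  then show ?thesis
    using v integrable_normal_density[of "sqrt (2 * v)" "h / 2"] integral_normal_density[of "sqrt (2 * v)" "h / 2"]
    by (simp add: ennreal_mult' nn_integral_cmult nn_integral_eq_integral)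
qed

text \<open>For \<open>v\<close> with law \<open>\<sigma>\<close> and an independent standard normal
  \<open>g\<close>, the product \<open>sqrt (2 * v) * g\<close> has characteristic function
  \<open>E[exp (- s\<^sup>2 * v)] = exp (- (\<bar>s\<bar> powr \<alpha>))\<close>, the one belonging
  to \<open>p\<close>. Equality holds almost everywhere only, since \<open>p\<close> is an arbitrary
  version of the density.\<close>

lemma stable_density_gaussian_mixture:
  assumes p: "is_stable_density \<alpha> p" and \<sigma>: "has_laplace \<sigma> (\<lambda>l. exp (- (l powr (\<alpha> / 2))))" and \<alpha>: "0 < \<alpha>"
  shows "AE u in lborel. ennreal (p u) = (\<integral>\<^sup>+ v. ennreal (normal_density 0 (sqrt (2 * v)) u) \<partial>\<sigma>)"
proof -
  have pm[measurable]: "p \<in> borel_measurable borel" using p by (simp add: is_stable_density_def)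
  interpret S: real_distribution \<sigma> using \<sigma> by (simp add: has_laplace_def)
  define N where "N = std_normal_distribution"
  have "prob_space N" unfolding N_def by (intro prob_space_normal_density) simp
  moreover have sN[measurable_cong]: "sets N = sets borel" by (simp add: N_def)
  ultimately interpret N: real_distribution N by (simp add: real_distribution_def real_distribution_axioms_def N_def)
  interpret P: pair_prob_space \<sigma> N ..
  interpret L: pair_sigma_finite \<sigma> lborel ..
  have pos: "AE v in \<sigma>. 0 < v" using has_laplace_inverse_moment[OF \<sigma>] \<alpha> by simp
  define Q where "Q = distr (\<sigma> \<Otimes>\<^sub>M N) borel (\<lambda>(v, x). sqrt (2 * v) * x)"
  have Q: "real_distribution Q" unfolding Q_def by (intro P.real_distribution_distr) measurable
  have char: "char Q s = complex_of_real (exp (- (\<bar>s\<bar> powr \<alpha>)))" for s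
  proof -
    have "char Q s = (\<integral>z. iexp (s * (sqrt (2 * fst z) * snd z)) \<partial>(\<sigma> \<Otimes>\<^sub>M N))"
      unfolding char_def Q_def by (subst integral_distr) (auto simp: case_prod_beta)
    also have "\<dots> = (\<integral>v. (\<integral>x. iexp (s * (sqrt (2 * v) * x)) \<partial>N) \<partial>\<sigma>)"
      by (subst P.integral_fst'[symmetric]) (auto intro!: P.integrable_const_bound[where B=1])
    also have "\<dots> = (\<integral>v. char N (s * sqrt (2 * v)) \<partial>\<sigma>)"
      unfolding char_def by (simp add: mult.assoc)
    also have "\<dots> = (\<integral>v. complex_of_real (exp (- (s\<^sup>2) * v)) \<partial>\<sigma>)"
    proof (intro integral_cong_AE)
      show "AE v in \<sigma>. char N (s * sqrt (2 * v)) = complex_of_real (exp (- (s\<^sup>2) * v))"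
        using pos by eventually_elim (simp add: N_def char_std_normal_distribution power_mult_distrib)
    qed (auto simp: N_def char_std_normal_distribution)
    also have "\<dots> = complex_of_real (exp (- ((s\<^sup>2) powr (\<alpha> / 2))))"
      using \<sigma> unfolding has_laplace_def by (subst integral_complex_of_real) auto
    also have "(s\<^sup>2) powr (\<alpha> / 2) = \<bar>s\<bar> powr \<alpha>"
    proof (cases "s = 0")
      case False
      then have "(s\<^sup>2) powr (\<alpha> / 2) = (\<bar>s\<bar> powr 2) powr (\<alpha> / 2)" by simp
      then show ?thesis by (simp only: powr_powr) simp
    qed simp
    finally show ?thesis .
  qed
  have "density lborel p = Q"
  proof (rule Levy_uniqueness)
    show "real_distribution (density lborel p)"
      using p by (simp add: is_stable_density_def real_distribution_def real_distribution_axioms_def)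
    show "char (density lborel p) = char Q" using p char by (auto simp: is_stable_density_def)
  qed (rule Q)
  also have "Q = density lborel (\<lambda>u. \<integral>\<^sup>+ v. ennreal (normal_density 0 (sqrt (2 * v)) u) \<partial>\<sigma>)"
  proof (rule measure_eqI)
    fix B assume "B \<in> sets Q"
    then have B[measurable]: "B \<in> sets borel" by (simp add: Q_def)
    have "emeasure Q B = (\<integral>\<^sup>+ z. indicator B (sqrt (2 * fst z) * snd z) \<partial>(\<sigma> \<Otimes>\<^sub>M N))"
      unfolding Q_def by (subst nn_integral_indicator[symmetric]) (auto simp: nn_integral_distr case_prod_beta simp del: nn_integral_indicator)
    also have "\<dots> = (\<integral>\<^sup>+ v. (\<integral>\<^sup>+ x. indicator B (sqrt (2 * v) * x) \<partial>N) \<partial>\<sigma>)"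
      by (subst N.nn_integral_fst[symmetric]) auto
    also have "\<dots> = (\<integral>\<^sup>+ v. (\<integral>\<^sup>+ u. ennreal (normal_density 0 (sqrt (2 * v)) u) * indicator B u \<partial>lborel) \<partial>\<sigma>)"
      using pos
    proof (intro nn_integral_cong_AE, eventually_elim)
      case (elim v)
      define c where "c = sqrt (2 * v)"
      have c: "c > 0" using elim by (simp add: c_def)
      have "(\<integral>\<^sup>+ u. ennreal (normal_density 0 c u) * indicator B u \<partial>lborel) =
         ennreal \<bar>c\<bar> * (\<integral>\<^sup>+ x. ennreal (normal_density 0 c (0 + c * x)) * indicator B (0 + c * x) \<partial>lborel)"
        using c by (subst nn_integral_real_affine[where c=c and t=0]) auto
      also have "\<dots> = (\<integral>\<^sup>+ x. ennreal (std_normal_density x) * indicator B (c * x) \<partial>lborel)"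
        using c by (subst nn_integral_cmult[symmetric])
          (auto intro!: nn_integral_cong split: split_indicator
            simp: normal_density_def ennreal_mult'[symmetric] real_sqrt_mult power_mult_distrib)
      also have "\<dots> = (\<integral>\<^sup>+ x. indicator B (c * x) \<partial>N)"
        unfolding N_def by (subst nn_integral_density) auto
      finally show ?case by (simp add: c_def)
    qed
    also have "\<dots> = (\<integral>\<^sup>+ u. (\<integral>\<^sup>+ v. ennreal (normal_density 0 (sqrt (2 * v)) u) * indicator B u \<partial>\<sigma>) \<partial>lborel)"
      unfolding normal_density_def by (intro L.Fubini'[symmetric]) measurable
    also have "\<dots> = (\<integral>\<^sup>+ u. (\<integral>\<^sup>+ v. ennreal (normal_density 0 (sqrt (2 * v)) u) \<partial>\<sigma>) * indicator B u \<partial>lborel)"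
      unfolding normal_density_def by (intro nn_integral_cong nn_integral_multc) measurable
    also have "\<dots> = emeasure (density lborel (\<lambda>u. \<integral>\<^sup>+ v. ennreal (normal_density 0 (sqrt (2 * v)) u) \<partial>\<sigma>)) B"
      unfolding normal_density_def by (subst emeasure_density) auto
    finally show "emeasure Q B = emeasure (density lborel (\<lambda>u. \<integral>\<^sup>+ v. ennreal (normal_density 0 (sqrt (2 * v)) u) \<partial>\<sigma>)) B" .
  qed (simp add: Q_def)
  finally show ?thesis
    by (subst (asm) sigma_finite_measure.density_unique_iff[OF sigma_finite_lborel]) (auto simp: normal_density_def)
qed

lemma ennreal_power2_le_imp_le:
  assumes "a\<^sup>2 \<le> (ennreal b)\<^sup>2" "0 \<le> b"
  shows "a \<le> ennreal b"
proof (cases a)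
  case (real r)
  then show ?thesis using assms
    by (auto simp: ennreal_power intro!: ennreal_leI power2_le_imp_le)
next
  case top
  then show ?thesis using assms by (simp add: top_unique power2_eq_square ennreal_mult[symmetric])
qed

text \<open>Mixing can only increase the affinity: \<open>sqrt (p u * p (u - h))\<close> dominates
  the mean over \<open>v\<close> of its Gaussian counterparts. With
  \<open>exp (- y) \<ge> 1 - y\<close> this yields \<open>C = E[1 / v] / 16\<close>. Positivity
  comes from the same mixture and gives sense to the later quotients of densities.\<close>

lemma stable_density_pos_affinity:
  assumes p: "is_stable_density \<alpha> p" and \<alpha>: "0 < \<alpha>" "\<alpha> < 2"
  shows "AE u in lborel. 0 < p u"
    and "integrable lborel (\<lambda>u. sqrt (p u * p (u - h)))"
    and "\<exists>C. \<forall>h. 1 - C * h\<^sup>2 \<le> (\<integral>u. sqrt (p u * p (u - h)) \<partial>lborel)"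
proof -
  have pm[measurable]: "p \<in> borel_measurable borel" and pnn: "\<And>u. 0 \<le> p u" using p by (auto simp: is_stable_density_def)
  have pint: "integrable lborel p"
  proof -
    interpret prob_space "density lborel p" using p by (simp add: is_stable_density_def)
    have "(\<integral>\<^sup>+u. ennreal (p u) \<partial>lborel) = 1" using emeasure_space_1 by (simp add: emeasure_density)
    then show ?thesis using pnn by (intro integrableI_bounded) auto
  qed
  have int: "integrable lborel (\<lambda>u. sqrt (p u * p (u - h)))" for h
  proof (rule Bochner_Integration.integrable_bound[of _ "\<lambda>u. p u + p (- h + 1 * u)"])
    show "integrable lborel (\<lambda>u. p u + p (- h + 1 * u))"
      using pint by (intro Bochner_Integration.integrable_add lborel_integrable_real_affine) auto
    show "AE u in lborel. norm (sqrt (p u * p (u - h))) \<le> norm (p u + p (- h + 1 * u))"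
    proof (intro AE_I2)
      fix u
      have "sqrt (p u * p (u - h)) \<le> (p u + p (u - h)) / 2" by (rule arith_geo_mean_sqrt) (auto simp: pnn)
      then show "norm (sqrt (p u * p (u - h))) \<le> norm (p u + p (- h + 1 * u))" 
        using pnn[of u] pnn[of "u - h"] by (simp add: algebra_simps)
    qed
  qed measurable
  then show "integrable lborel (\<lambda>u. sqrt (p u * p (u - h)))" .
  obtain \<sigma> where \<sigma>: "has_laplace \<sigma> (\<lambda>l. exp (- (l powr (\<alpha> / 2))))"
    using positive_stable_law[of "\<alpha> / 2"] \<alpha> by auto
  interpret S: real_distribution \<sigma> using \<sigma> by (simp add: has_laplace_def)
  interpret L: pair_sigma_finite \<sigma> lborel ..
  have pos: "AE v in \<sigma>. 0 < v" and inv: "integrable \<sigma> (\<lambda>v. 1 / v)"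
    using has_laplace_inverse_moment[OF \<sigma>] \<alpha> by auto
  define n where "n v u = normal_density 0 (sqrt (2 * v)) u" for v u
  have nm[measurable]: "case_prod n \<in> borel_measurable (borel \<Otimes>\<^sub>M borel)" unfolding n_def normal_density_def by measurable
  have mix: "AE u in lborel. ennreal (p u) = (\<integral>\<^sup>+ v. ennreal (n v u) \<partial>\<sigma>)"
    unfolding n_def using stable_density_gaussian_mixture[OF p \<sigma>] \<alpha> by simp
  have gpos: "(\<integral>\<^sup>+ v. ennreal (n v u) \<partial>\<sigma>) > 0" for u
  proof -
    have "\<not> (AE v in \<sigma>. ennreal (n v u) = 0)"
    proof
      assume "AE v in \<sigma>. ennreal (n v u) = 0"
      with pos have "AE v in \<sigma>. False"
      proof eventually_elim
        case (elim v)
        then show ?case using normal_density_pos[of "sqrt (2 * v)" 0 u] by (auto simp: n_def ennreal_eq_0_iff)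
      qed
      then show False by simp
    qed
    then show ?thesis by (subst (asm) nn_integral_0_iff_AE[symmetric]) (auto simp: zero_less_iff_neq_zero)
  qed
  show "AE u in lborel. 0 < p u"
    using mix by eventually_elim (metis gpos ennreal_less_zero_iff)
  have "1 - (\<integral>v. 1 / v \<partial>\<sigma>) / 16 * h\<^sup>2 \<le> (\<integral>u. sqrt (p u * p (u - h)) \<partial>lborel)" for h
  proof -
    \<comment> \<open>The mixture formula holds only almost everywhere, so its translate by
      \<open>h\<close> relies on translations preserving null sets.\<close>
    have mix': "AE u in lborel. ennreal (p (- h + 1 * u)) = (\<integral>\<^sup>+ v. ennreal (n v (- h + 1 * u)) \<partial>\<sigma>)"
      using mix by (intro AE_borel_affine) auto
    have ih: "integrable \<sigma> (\<lambda>v. exp (- h\<^sup>2 / (16 * v)))"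
      using pos by (intro S.integrable_const_bound[where B=1]) (auto elim!: eventually_mono)
    have "1 - (\<integral>v. 1 / v \<partial>\<sigma>) / 16 * h\<^sup>2 = (\<integral>v. 1 - h\<^sup>2 / 16 * (1 / v) \<partial>\<sigma>)"
      using inv S.prob_space by (subst Bochner_Integration.integral_diff) (auto simp del: times_divide_eq_right)
    also have "\<dots> \<le> (\<integral>v. exp (- h\<^sup>2 / (16 * v)) \<partial>\<sigma>)"
    proof (intro integral_mono_AE)
      have "1 - h\<^sup>2 / 16 * (1 / v) \<le> exp (- h\<^sup>2 / (16 * v))" for v
        using exp_ge_add_one_self[of "- h\<^sup>2 / (16 * v)"] by simp
      then show "AE v in \<sigma>. 1 - h\<^sup>2 / 16 * (1 / v) \<le> exp (- h\<^sup>2 / (16 * v))" by simp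
    qed (use ih inv in \<open>auto simp del: times_divide_eq_right\<close>)
    finally have 1: "1 - (\<integral>v. 1 / v \<partial>\<sigma>) / 16 * h\<^sup>2 \<le> (\<integral>v. exp (- h\<^sup>2 / (16 * v)) \<partial>\<sigma>)" .
    have "ennreal (\<integral>v. exp (- h\<^sup>2 / (16 * v)) \<partial>\<sigma>) = (\<integral>\<^sup>+v. ennreal (exp (- h\<^sup>2 / (16 * v))) \<partial>\<sigma>)"
      using ih by (subst nn_integral_eq_integral) auto
    also have "\<dots> = (\<integral>\<^sup>+v. (\<integral>\<^sup>+u. ennreal (sqrt (n v u * n v (u - h))) \<partial>lborel) \<partial>\<sigma>)"
      using pos by (intro nn_integral_cong_AE) (auto elim!: eventually_mono simp: n_def gaussian_affinity)
    also have "\<dots> = (\<integral>\<^sup>+u. (\<integral>\<^sup>+v. ennreal (sqrt (n v u * n v (u - h))) \<partial>\<sigma>) \<partial>lborel)"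
      by (intro L.Fubini'[symmetric]) measurable
    also have "\<dots> \<le> (\<integral>\<^sup>+u. ennreal (sqrt (p u * p (u - h))) \<partial>lborel)"
      using mix mix'
    proof (intro nn_integral_mono_AE, eventually_elim)
      case (elim u)
      have n0: "0 \<le> n v x" for v x by (simp add: n_def)
      have "(\<integral>\<^sup>+v. ennreal (sqrt (n v u * n v (u - h))) \<partial>\<sigma>)\<^sup>2 =
          (\<integral>\<^sup>+v. ennreal (sqrt (n v u)) * ennreal (sqrt (n v (u - h))) \<partial>\<sigma>)\<^sup>2"
        by (simp add: real_sqrt_mult ennreal_mult' n0)
      also have "\<dots> \<le> (\<integral>\<^sup>+v. (ennreal (sqrt (n v u)))\<^sup>2 \<partial>\<sigma>) * (\<integral>\<^sup>+v. (ennreal (sqrt (n v (u - h))))\<^sup>2 \<partial>\<sigma>)"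
        by (intro Cauchy_Schwarz_nn_integral) measurable
      also have "\<dots> = ennreal (p u) * ennreal (p (u - h))"
        using elim by (simp add: ennreal_power n0)
      also have "\<dots> = (ennreal (sqrt (p u * p (u - h))))\<^sup>2"
        by (simp add: ennreal_power ennreal_mult' pnn)
      finally show ?case
        by (rule ennreal_power2_le_imp_le) (simp add: pnn)
    qed
    also have "\<dots> = ennreal (\<integral>u. sqrt (p u * p (u - h)) \<partial>lborel)"
      using int by (intro nn_integral_eq_integral) (auto simp: pnn)
    finally have "(\<integral>v. exp (- h\<^sup>2 / (16 * v)) \<partial>\<sigma>) \<le> (\<integral>u. sqrt (p u * p (u - h)) \<partial>lborel)"
      by (subst (asm) ennreal_le_iff) (auto intro!: Bochner_Integration.integral_nonneg simp: pnn)
    with 1 show ?thesis by linarith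
  qed
  then show "\<exists>C. \<forall>h. 1 - C * h\<^sup>2 \<le> (\<integral>u. sqrt (p u * p (u - h)) \<partial>lborel)" by blast
qed

section \<open>Kakutani's theorem\<close>

text \<open>The Riesz-Fischer argument: along a subsequence with summable increments the functions
  converge almost everywhere, and Fatou's lemma turns the Cauchy bound into a bound on the distance
  to the limit.\<close>

lemma L1_complete:
  fixes f :: "nat \<Rightarrow> 'a \<Rightarrow> real"
  assumes int: "\<And>n. integrable M (f n)"
    and cauchy: "\<And>e. 0 < e \<Longrightarrow> \<exists>N. \<forall>n\<ge>N. \<forall>m\<ge>n. (\<integral>x. \<bar>f n x - f m x\<bar> \<partial>M) < e"
  shows "\<exists>g. converges_in_L1 M f g"
proof -
  have meas[measurable]: "f n \<in> borel_measurable M" for n using int by auto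
  have nnint: "(\<integral>\<^sup>+x. ennreal \<bar>f n x - f m x\<bar> \<partial>M) = ennreal (\<integral>x. \<bar>f n x - f m x\<bar> \<partial>M)" for n m
    using int by (intro nn_integral_eq_integral) auto
  obtain R where R: "\<And>k n m. R k \<le> n \<Longrightarrow> n \<le> m \<Longrightarrow> (\<integral>x. \<bar>f n x - f m x\<bar> \<partial>M) < (1/2)^k"
  proof -
    have "\<forall>k. \<exists>N. \<forall>n\<ge>N. \<forall>m\<ge>n. (\<integral>x. \<bar>f n x - f m x\<bar> \<partial>M) < (1/2)^k" using cauchy by simp
    then show ?thesis using that by metis
  qed
  \<comment> \<open>Adding up the thresholds makes \<open>r\<close> increasing and at least as large
    as both \<open>k\<close> and \<open>R k\<close>, so consecutive terms of the subsequence are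
    within \<open>(1/2)^k\<close>.\<close>
  define r where "r k = k + (\<Sum>j\<le>k. R j)" for k
  have rR: "R k \<le> r k" for k
    unfolding r_def using member_le_sum[of k "{..k}" R] by simp
  have rSuc: "r k \<le> r (Suc k)" for k by (simp add: r_def)
  have rge: "k \<le> r k" for k by (simp add: r_def)
  have "(\<integral>\<^sup>+x. (\<Sum>k. ennreal \<bar>f (r k) x - f (r (Suc k)) x\<bar>) \<partial>M) = (\<Sum>k. \<integral>\<^sup>+x. ennreal \<bar>f (r k) x - f (r (Suc k)) x\<bar> \<partial>M)"
    by (intro nn_integral_suminf) measurable
  also have "\<dots> \<le> (\<Sum>k. ennreal ((1/2)^k))"
    unfolding nnint by (intro suminf_le ennreal_leI) (auto intro!: less_imp_le R rR rSuc)
  also have "\<dots> = ennreal (\<Sum>k. (1/2)^k)"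
    by (intro suminf_ennreal2) (auto intro!: summable_geometric)
  also have "\<dots> < \<infinity>" by simp
  finally have "AE x in M. (\<Sum>k. ennreal \<bar>f (r k) x - f (r (Suc k)) x\<bar>) \<noteq> \<infinity>"
    by (intro nn_integral_PInf_AE) auto
  then have conv: "AE x in M. convergent (\<lambda>k. f (r k) x)"
  proof eventually_elim
    case (elim x)
    have "summable (\<lambda>k. \<bar>f (r k) x - f (r (Suc k)) x\<bar>)"
      using elim by (intro summable_suminf_not_top) auto
    then have "summable (\<lambda>k. f (r (Suc k)) x - f (r k) x)"
      by (subst (asm) abs_minus_commute) (rule summable_rabs_cancel)
    then have "convergent (\<lambda>n. \<Sum>k<n. f (r (Suc k)) x - f (r k) x)" by (simp add: summable_iff_convergent)
    then have "convergent (\<lambda>n. f (r n) x - f (r 0) x)" by (subst (asm) sum_lessThan_telescope)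
    then show ?case using convergent_add[OF _ convergent_const[of "f (r 0) x"]] by fastforce
  qed
  define g where "g x = lim (\<lambda>k. f (r k) x)" for x
  have gm[measurable]: "g \<in> borel_measurable M" unfolding g_def by measurable
  have close: "(\<integral>\<^sup>+x. ennreal \<bar>f n x - g x\<bar> \<partial>M) \<le> ennreal e"
    if e: "\<And>m. n \<le> m \<Longrightarrow> (\<integral>x. \<bar>f n x - f m x\<bar> \<partial>M) < e" for n e
  proof -
    have "(\<integral>\<^sup>+x. ennreal \<bar>f n x - g x\<bar> \<partial>M) = (\<integral>\<^sup>+x. liminf (\<lambda>k. ennreal \<bar>f n x - f (r k) x\<bar>) \<partial>M)"
      using conv
    proof (intro nn_integral_cong_AE, eventually_elim)
      case (elim x)
      then have "(\<lambda>k. f (r k) x) \<longlonglongrightarrow> g x" unfolding g_def by (simp add: convergent_LIMSEQ_iff)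
      then have "(\<lambda>k. ennreal \<bar>f n x - f (r k) x\<bar>) \<longlonglongrightarrow> ennreal \<bar>f n x - g x\<bar>"
        by (intro tendsto_intros)
      then show ?case by (rule lim_imp_Liminf[OF sequentially_bot, symmetric])
    qed
    also have "\<dots> \<le> liminf (\<lambda>k. \<integral>\<^sup>+x. ennreal \<bar>f n x - f (r k) x\<bar> \<partial>M)"
      by (intro nn_integral_liminf) measurable
    also have "\<dots> \<le> liminf (\<lambda>k. ennreal e)"
    proof (intro Liminf_mono eventually_sequentiallyI[of n])
      fix k assume "n \<le> k"
      then have "n \<le> r k" using rge[of k] by simp
      then show "(\<integral>\<^sup>+x. ennreal \<bar>f n x - f (r k) x\<bar> \<partial>M) \<le> ennreal e"
        unfolding nnint using e by (intro ennreal_leI) (auto intro: less_imp_le)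
    qed
    also have "\<dots> = ennreal e" by (simp add: Liminf_const)
    finally show ?thesis .
  qed
  have "integrable M (\<lambda>x. f (R 0) x - g x)"
    using close[of "R 0" 1] R[of 0 "R 0"] by (intro integrableI_bounded) (auto simp: order_le_less_trans)
  from Bochner_Integration.integrable_diff[OF int this, of "R 0"] have gi: "integrable M g" by simp
  have "(\<lambda>n. \<integral>x. \<bar>f n x - g x\<bar> \<partial>M) \<longlonglongrightarrow> 0"
  proof (rule LIMSEQ_I)
    fix e :: real assume e: "0 < e"
    then obtain N where N: "\<And>n m. N \<le> n \<Longrightarrow> n \<le> m \<Longrightarrow> (\<integral>x. \<bar>f n x - f m x\<bar> \<partial>M) < e / 2"
      using cauchy[of "e / 2"] by auto
    show "\<exists>N. \<forall>n\<ge>N. norm ((\<integral>x. \<bar>f n x - g x\<bar> \<partial>M) - 0) < e"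
    proof (intro exI[of _ N] allI impI)
      fix n assume "N \<le> n"
      then have "(\<integral>\<^sup>+x. ennreal \<bar>f n x - g x\<bar> \<partial>M) \<le> ennreal (e / 2)"
        using close[of n "e / 2"] N by simp
      then have "ennreal (\<integral>x. \<bar>f n x - g x\<bar> \<partial>M) \<le> ennreal (e / 2)"
        using int gi by (subst (asm) nn_integral_eq_integral) auto
      then show "norm ((\<integral>x. \<bar>f n x - g x\<bar> \<partial>M) - 0) < e" using e by (simp add: ennreal_le_iff)
    qed
  qed
  then show ?thesis using int gi by (auto simp: converges_in_L1_def)
qed

text \<open>The Weierstrass product inequality; it converts summability of the deficits
  \<open>1 - H k\<close> into closeness of the tail products of affinities to 1.\<close>

lemma prod_ge_one_minus_sum:
  fixes a :: "'i \<Rightarrow> real"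
  assumes "finite I" "\<And>i. i \<in> I \<Longrightarrow> 0 \<le> a i" "\<And>i. i \<in> I \<Longrightarrow> a i \<le> 1"
  shows "1 - (\<Sum>i\<in>I. 1 - a i) \<le> (\<Prod>i\<in>I. a i)"
  using assms
proof (induction I)
  case (insert i I)
  have "prod a I \<le> 1" using insert by (intro prod_le_1) auto
  then have "(1 - a i) * prod a I \<le> (1 - a i) * 1" using insert by (intro mult_left_mono) auto
  moreover have "1 - (\<Sum>i\<in>I. 1 - a i) \<le> prod a I" using insert by auto
  ultimately show ?case using insert by (simp add: algebra_simps)
qed simp

lemma (in product_prob_space) PiM_integral_prod:
  fixes f :: "'i \<Rightarrow> 'a \<Rightarrow> real"
  assumes J: "finite J" "J \<subseteq> I" and int: "\<And>i. i \<in> J \<Longrightarrow> integrable (M i) (f i)"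
  shows "integrable (PiM I M) (\<lambda>x. \<Prod>i\<in>J. f i (x i))"
    and "(\<integral>x. (\<Prod>i\<in>J. f i (x i)) \<partial>PiM I M) = (\<Prod>i\<in>J. integral\<^sup>L (M i) (f i))"
proof -
  have eq: "PiM J M = distr (PiM I M) (PiM J M) (\<lambda>x. restrict x J)"
    using distr_PiM_restrict_finite[OF J] by simp
  have m[measurable]: "(\<lambda>x. \<Prod>i\<in>J. f i (x i)) \<in> borel_measurable (PiM J M)"
    using int by (intro borel_measurable_prod) (auto intro!: measurable_compose[OF measurable_component_singleton])
  have r[measurable]: "(\<lambda>x. restrict x J) \<in> measurable (PiM I M) (PiM J M)"
    using J by (intro measurable_restrict_subset)
  have "integrable (PiM J M) (\<lambda>x. \<Prod>i\<in>J. f i (x i))"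
    using J int by (intro product_integrable_prod) auto
  then show "integrable (PiM I M) (\<lambda>x. \<Prod>i\<in>J. f i (x i))"
    by (subst (asm) eq, subst (asm) integrable_distr_eq) auto
  have "(\<integral>x. (\<Prod>i\<in>J. f i (x i)) \<partial>PiM I M) = (\<integral>x. (\<Prod>i\<in>J. f i (x i)) \<partial>PiM J M)"
    by (subst eq, subst integral_distr) auto
  also have "\<dots> = (\<Prod>i\<in>J. integral\<^sup>L (M i) (f i))"
    using J int by (intro product_integral_prod)
  finally show "(\<integral>x. (\<Prod>i\<in>J. f i (x i)) \<partial>PiM I M) = (\<Prod>i\<in>J. integral\<^sup>L (M i) (f i))" .
qed

text \<open>The left integrand is \<open>\<bar>u - v\<bar> * \<bar>u + v\<bar>\<close>, and a
  weighted arithmetic-geometric mean inequality with free weight \<open>e\<close> serves in place of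
  Cauchy-Schwarz. For normalized \<open>u\<close> and \<open>v\<close> the integral of
  \<open>(u - v)\<^sup>2\<close> is twice one minus the affinity.\<close>

lemma integral_abs_diff_squares_le:
  fixes u v :: "'a \<Rightarrow> real"
  assumes int: "integrable M (\<lambda>x. (u x)\<^sup>2)" "integrable M (\<lambda>x. (v x)\<^sup>2)" "integrable M (\<lambda>x. u x * v x)"
    and one: "(\<integral>x. (u x)\<^sup>2 \<partial>M) = 1" "(\<integral>x. (v x)\<^sup>2 \<partial>M) = 1" and e: "0 < e"
  shows "(\<integral>x. \<bar>(u x)\<^sup>2 - (v x)\<^sup>2\<bar> \<partial>M) \<le> (1 - (\<integral>x. u x * v x \<partial>M)) / e + 2 * e"
proof -
  let ?i = "\<integral>x. u x * v x \<partial>M"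
  have sq: "(\<integral>x. (u x)\<^sup>2 + (v x)\<^sup>2 - 2 * (u x * v x) \<partial>M) = 2 - 2 * ?i"
    using int one by simp
  have sq': "(\<integral>x. (u x)\<^sup>2 + (v x)\<^sup>2 + 2 * (u x * v x) \<partial>M) = 2 + 2 * ?i"
    using int one by simp
  have "0 \<le> (\<integral>x. (u x)\<^sup>2 + (v x)\<^sup>2 - 2 * (u x * v x) \<partial>M)"
    by (intro Bochner_Integration.integral_nonneg) (use sum_squares_bound in \<open>simp add: algebra_simps\<close>)
  then have i1: "?i \<le> 1" using sq by simp
  have "(\<integral>x. \<bar>(u x)\<^sup>2 - (v x)\<^sup>2\<bar> \<partial>M) \<le>
     (\<integral>x. ((u x)\<^sup>2 + (v x)\<^sup>2 - 2 * (u x * v x)) / (2 * e) + (e / 2) * ((u x)\<^sup>2 + (v x)\<^sup>2 + 2 * (u x * v x)) \<partial>M)"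
  proof (intro integral_mono)
    fix x
    have "2 * e * (\<bar>u x - v x\<bar> * \<bar>u x + v x\<bar>) \<le> \<bar>u x - v x\<bar>\<^sup>2 + e\<^sup>2 * \<bar>u x + v x\<bar>\<^sup>2"
      using sum_squares_bound[of "\<bar>u x - v x\<bar>" "e * \<bar>u x + v x\<bar>"] by (simp add: power_mult_distrib algebra_simps)
    then have "2 * e * \<bar>(u x)\<^sup>2 - (v x)\<^sup>2\<bar> \<le> ((u x)\<^sup>2 + (v x)\<^sup>2 - 2 * (u x * v x)) + e\<^sup>2 * ((u x)\<^sup>2 + (v x)\<^sup>2 + 2 * (u x * v x))"
      by (simp add: abs_mult[symmetric] power2_eq_square algebra_simps)
    then show "\<bar>(u x)\<^sup>2 - (v x)\<^sup>2\<bar> \<le> ((u x)\<^sup>2 + (v x)\<^sup>2 - 2 * (u x * v x)) / (2 * e) + (e / 2) * ((u x)\<^sup>2 + (v x)\<^sup>2 + 2 * (u x * v x))"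
      using e by (simp add: field_simps power2_eq_square)
  qed (use int in auto)
  also have "\<dots> = (2 - 2 * ?i) / (2 * e) + (e / 2) * (2 + 2 * ?i)"
    using int by (subst Bochner_Integration.integral_add) (auto simp: sq sq')
  also have "\<dots> \<le> (1 - ?i) / e + 2 * e"
  proof -
    have "(2 - 2 * ?i) / (2 * e) = (1 - ?i) / e" using e by (simp add: field_simps)
    moreover have "(e / 2) * (2 + 2 * ?i) \<le> (e / 2) * 4" using i1 e by (intro mult_left_mono) auto
    ultimately show ?thesis by linarith
  qed
  finally show ?thesis .
qed

text \<open>The partial products \<open>f N\<close> are squares of unit vectors \<open>u N\<close>
  of L2, whose inner product for \<open>N \<le> m\<close> is the product of the affinities
  \<open>H k\<close> over \<open>N \<le> k < m\<close>. Summable deficits bring it close to 1, so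
  \<open>f N\<close> is Cauchy in L1. The limit is identified on cylinder sets, over which the
  integrals of \<open>f n\<close> are eventually constant.\<close>

theorem kakutani_product_density:
  fixes P :: "nat \<Rightarrow> 'a measure" and q :: "nat \<Rightarrow> 'a \<Rightarrow> real"
  assumes P: "\<And>k. prob_space (P k)"
    and qm: "\<And>k. q k \<in> borel_measurable (P k)" and qnn: "\<And>k x. 0 \<le> q k x"
    and qint: "\<And>k. prob_space (density (P k) (q k))"
    and b: "summable b" "\<And>k. 1 - (\<integral>x. sqrt (q k x) \<partial>P k) \<le> b k"
  shows "\<exists>g. (\<forall>z. 0 \<le> g z) \<and> converges_in_L1 (PiM UNIV P) (\<lambda>N z. \<Prod>k<N. q k (z k)) g \<and>
     PiM UNIV (\<lambda>k. density (P k) (q k)) = density (PiM UNIV P) g"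
proof -
  interpret P: product_prob_space P UNIV by (intro product_prob_spaceI P)
  interpret Q: product_prob_space "\<lambda>k. density (P k) (q k)" UNIV by (intro product_prob_spaceI qint)
  note qm[measurable]
  let ?M = "PiM UNIV P"
  define H where "H k = (\<integral>x. sqrt (q k x) \<partial>P k)" for k
  have q1: "integrable (P k) (q k)" "(\<integral>x. q k x \<partial>P k) = 1" for k
  proof -
    have "(\<integral>\<^sup>+x. ennreal (q k x) \<partial>P k) = ennreal 1"
      using prob_space.emeasure_space_1[OF qint[of k]] by (simp add: emeasure_density)
    then have "has_bochner_integral (P k) (q k) 1"
      by (intro has_bochner_integral_nn_integral) (auto simp: qnn)
    then show "integrable (P k) (q k)" "(\<integral>x. q k x \<partial>P k) = 1"
      by (auto simp: has_bochner_integral_iff)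
  qed
  have sq1: "integrable (P k) (\<lambda>x. sqrt (q k x))" for k
  proof (rule Bochner_Integration.integrable_bound[of _ "\<lambda>x. 1 + q k x"])
    have "sqrt (q k x) \<le> 1 + q k x" for x
      using arith_geo_mean_sqrt[of 1 "q k x"] qnn[of k x] by simp
    then show "AE x in P k. norm (sqrt (q k x)) \<le> norm (1 + q k x)" by (simp add: qnn abs_of_nonneg)
  qed (use q1 in auto)
  have H0: "0 \<le> H k" for k unfolding H_def by (intro Bochner_Integration.integral_nonneg) (simp add: qnn)
  have H1: "H k \<le> 1" for k
  proof -
    have "H k \<le> (\<integral>x. (1 + q k x) / 2 \<partial>P k)"
      unfolding H_def using sq1 q1 arith_geo_mean_sqrt[of 1 "q k _"]
      by (intro integral_mono) (auto simp: qnn)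
    then show ?thesis using q1 P.M.prob_space by simp
  qed
  have sum: "summable (\<lambda>k. 1 - H k)"
    using b H1 unfolding H_def by (intro summable_comparison_test'[OF b(1)]) auto
  define f where "f N z = (\<Prod>k<N. q k (z k))" for N z
  define u where "u N z = (\<Prod>k<N. sqrt (q k (z k)))" for N z
  have uf: "(u N z)\<^sup>2 = f N z" for N z
    by (simp add: u_def f_def prod_power_distrib qnn)
  have f1: "integrable ?M (f N)" "(\<integral>z. f N z \<partial>?M) = 1" for N
    unfolding f_def using P.PiM_integral_prod[of "{..<N}" q] q1 by auto
  have uu: "integrable ?M (\<lambda>z. u N z * u m z)" "1 - (\<integral>z. u N z * u m z \<partial>?M) \<le> (\<Sum>k=N..<m. 1 - H k)" if "N \<le> m" for N m
  proof -
    \<comment> \<open>In \<open>u N * u m\<close> the coordinates below \<open>N\<close> carry two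
      square roots, that is \<open>q k\<close> with integral 1; those from \<open>N\<close> on carry
      one, with integral \<open>H k\<close>.\<close>
    define h where "h k = (if k < N then q k else (\<lambda>x. sqrt (q k x)))" for k
    have hu: "u N z * u m z = (\<Prod>k<m. h k (z k))" for z
    proof -
      have split: "{..<m} = {..<N} \<union> {N..<m}" using that by auto
      have "u m z = u N z * (\<Prod>k=N..<m. sqrt (q k (z k)))"
        unfolding u_def split by (rule prod.union_disjoint) auto
      moreover have "(\<Prod>k<m. h k (z k)) = (\<Prod>k<N. h k (z k)) * (\<Prod>k=N..<m. h k (z k))"
        unfolding split by (rule prod.union_disjoint) auto
      moreover have "(\<Prod>k<N. h k (z k)) = f N z" by (simp add: h_def f_def)
      moreover have "(\<Prod>k=N..<m. h k (z k)) = (\<Prod>k=N..<m. sqrt (q k (z k)))" by (simp add: h_def)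
      ultimately show ?thesis using uf[of N z] by (simp add: power2_eq_square)
    qed
    have hint: "integrable (P k) (h k)" for k using q1 sq1 by (simp add: h_def)
    show "integrable ?M (\<lambda>z. u N z * u m z)"
      unfolding hu using P.PiM_integral_prod(1)[of "{..<m}" h] hint by auto
    have "(\<integral>z. u N z * u m z \<partial>?M) = (\<Prod>k<m. integral\<^sup>L (P k) (h k))"
      unfolding hu using P.PiM_integral_prod(2)[of "{..<m}" h] hint by auto
    also have "\<dots> = (\<Prod>k\<in>{..<N} \<union> {N..<m}. integral\<^sup>L (P k) (h k))"
      using that by (intro prod.cong) auto
    also have "\<dots> = (\<Prod>k<N. integral\<^sup>L (P k) (h k)) * (\<Prod>k=N..<m. integral\<^sup>L (P k) (h k))"
      by (rule prod.union_disjoint) auto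
    also have "\<dots> = (\<Prod>k=N..<m. H k)" using q1 by (simp add: h_def H_def)
    finally show "1 - (\<integral>z. u N z * u m z \<partial>?M) \<le> (\<Sum>k=N..<m. 1 - H k)"
      using prod_ge_one_minus_sum[of "{N..<m}" H] H0 H1 by simp
  qed
  have "\<exists>N. \<forall>n\<ge>N. \<forall>m\<ge>n. (\<integral>z. \<bar>f n z - f m z\<bar> \<partial>?M) < e" if e: "0 < e" for e
  proof -
    \<comment> \<open>The bound \<open>e\<^sup>2 / 32\<close> together with the weight
      \<open>e / 8\<close> makes each of the two terms of the estimate at most
      \<open>e / 4\<close>.\<close>
    obtain N where N: "\<And>n m. N \<le> n \<Longrightarrow> norm (\<Sum>k=n..<m. 1 - H k) < e\<^sup>2 / 32"
      using sum e unfolding summable_Cauchy by (meson divide_pos_pos zero_less_numeral zero_less_power)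
    show ?thesis
    proof (intro exI[of _ N] allI impI)
      fix n m assume nm: "N \<le> n" "n \<le> m"
      have "(\<integral>z. \<bar>f n z - f m z\<bar> \<partial>?M) \<le> (1 - (\<integral>z. u n z * u m z \<partial>?M)) / (e / 8) + 2 * (e / 8)"
        using integral_abs_diff_squares_le[of ?M "u n" "u m" "e / 8"] e f1 uu(1)[OF nm(2)] by (simp add: uf)
      also have "\<dots> \<le> (e\<^sup>2 / 32) / (e / 8) + 2 * (e / 8)"
        using uu(2)[OF nm(2)] N[of n m] nm e by (intro add_right_mono divide_right_mono) auto
      also have "\<dots> < e" using e by (simp add: field_simps power2_eq_square)
      finally show "(\<integral>z. \<bar>f n z - f m z\<bar> \<partial>?M) < e" .
    qed
  qed
  then obtain g0 where g0: "converges_in_L1 ?M f g0" using L1_complete[of ?M f] f1 by blast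
  \<comment> \<open>The limit is nonnegative only almost everywhere. Truncation makes it nonnegative
    everywhere and, since \<open>f N\<close> is nonnegative, does not increase the
    distances.\<close>
  define g where "g z = max 0 (g0 z)" for z
  have gi: "integrable ?M g" using g0 unfolding g_def converges_in_L1_def by auto
  then have gm[measurable]: "g \<in> borel_measurable ?M" by auto
  have gnn: "0 \<le> g z" for z by (simp add: g_def)
  have "converges_in_L1 ?M f g"
    unfolding converges_in_L1_def
  proof (intro conjI allI f1 gi)
    show "(\<lambda>N. \<integral>z. \<bar>f N z - g z\<bar> \<partial>?M) \<longlonglongrightarrow> 0"
    proof (rule tendsto_sandwich[where f="\<lambda>_. 0" and h="\<lambda>N. \<integral>z. \<bar>f N z - g0 z\<bar> \<partial>?M"])
      show "(\<lambda>N. \<integral>z. \<bar>f N z - g0 z\<bar> \<partial>?M) \<longlonglongrightarrow> 0" using g0 by (simp add: converges_in_L1_def)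
      have "0 \<le> f N z" for N z by (simp add: f_def prod_nonneg qnn)
      then have "\<bar>f N z - g z\<bar> \<le> \<bar>f N z - g0 z\<bar>" for N z by (auto simp: g_def max_def)
      then show "\<forall>\<^sub>F N in sequentially. (\<integral>z. \<bar>f N z - g z\<bar> \<partial>?M) \<le> (\<integral>z. \<bar>f N z - g0 z\<bar> \<partial>?M)"
        using f1 gi g0 by (intro always_eventually allI integral_mono) (auto simp: converges_in_L1_def)
    qed (auto intro!: always_eventually)
  qed
  note conv = this
  have "PiM UNIV (\<lambda>k. density (P k) (q k)) = density ?M g"
  proof (rule measure_eqI_PiM_infinite[of _ UNIV P])
    show "sets (PiM UNIV (\<lambda>k. density (P k) (q k))) = sets ?M" by (intro sets_PiM_cong) auto
    show "finite_measure (PiM UNIV (\<lambda>k. density (P k) (q k)))" by unfold_locales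
    fix A and J :: "nat set" assume J: "finite J" and A: "\<And>i. i \<in> J \<Longrightarrow> A i \<in> sets (P i)"
    \<comment> \<open>The cylinder over \<open>J\<close> becomes a condition on every coordinate,
      trivial outside \<open>J\<close>, so that its indicator factorizes like \<open>f n\<close>
      once \<open>n\<close> exceeds all indices in \<open>J\<close>.\<close>
    define B where "B k = (if k \<in> J then A k else space (P k))" for k
    have B[measurable]: "B k \<in> sets (P k)" for k using A by (simp add: B_def)
    define X where "X = prod_emb UNIV P J (Pi\<^sub>E J A)"
    have X[measurable]: "X \<in> sets ?M" unfolding X_def using J A by (intro sets_PiM_I) auto
    \<comment> \<open>Inserting 0 keeps \<open>Max\<close> meaningful for empty
      \<open>J\<close>.\<close>
    define n0 where "n0 = Suc (Max (insert 0 J))"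
    have n0: "J \<subseteq> {..<n}" if "n0 \<le> n" for n
    proof
      fix k assume "k \<in> J"
      then have "k \<le> Max (insert 0 J)" using J by simp
      then show "k \<in> {..<n}" using that by (simp add: n0_def)
    qed
    have val: "(\<integral>z. f n z * indicator X z \<partial>?M) = (\<Prod>k\<in>J. measure (density (P k) (q k)) (A k))" if "n0 \<le> n" for n
    proof -
      have "(\<integral>z. f n z * indicator X z \<partial>?M) = (\<integral>z. (\<Prod>k<n. q k (z k) * indicator (B k) (z k)) \<partial>?M)"
      proof (intro Bochner_Integration.integral_cong refl)
        fix z assume z: "z \<in> space ?M"
        have "(indicator X z :: real) = (\<Prod>k<n. indicator (B k) (z k))"
        proof (cases "z \<in> X")
          case True
          then have "z k \<in> B k" for k using z by (auto simp: X_def B_def prod_emb_def space_PiM PiE_iff)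
          then show ?thesis using True by simp
        next
          case False
          then obtain k where "k \<in> J" "z k \<notin> A k" using z by (auto simp: X_def prod_emb_def space_PiM PiE_iff)
          then have "k < n" "indicator (B k) (z k) = (0::real)" using n0[OF that] by (auto simp: B_def)
          then have "(\<Prod>k<n. indicator (B k) (z k)) = (0::real)" by (intro prod_zero) auto
          then show ?thesis using False by simp
        qed
        then show "f n z * indicator X z = (\<Prod>k<n. q k (z k) * indicator (B k) (z k))"
          by (simp add: f_def prod.distrib)
      qed
      also have "\<dots> = (\<Prod>k<n. (\<integral>x. q k x * indicator (B k) x \<partial>P k))"
        by (rule P.PiM_integral_prod(2)) (auto intro!: integrable_real_mult_indicator q1)
      also have "\<dots> = (\<Prod>k<n. measure (density (P k) (q k)) (B k))"
      proof (intro prod.cong refl)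
        fix k
        have "emeasure (density (P k) (q k)) (B k) = (\<integral>\<^sup>+x. ennreal (q k x * indicator (B k) x) \<partial>P k)"
          by (subst emeasure_density) (auto intro!: nn_integral_cong split: split_indicator)
        also have "\<dots> = ennreal (\<integral>x. q k x * indicator (B k) x \<partial>P k)"
          by (intro nn_integral_eq_integral integrable_real_mult_indicator q1) (auto simp: qnn)
        finally show "(\<integral>x. q k x * indicator (B k) x \<partial>P k) = measure (density (P k) (q k)) (B k)"
          by (simp add: measure_def qnn Bochner_Integration.integral_nonneg)
      qed
      also have "\<dots> = (\<Prod>k\<in>J. measure (density (P k) (q k)) (B k))"
      proof (rule prod.mono_neutral_right)
        show "\<forall>k\<in>{..<n} - J. measure (density (P k) (q k)) (B k) = 1"
          using prob_space.prob_space[OF qint] by (simp add: B_def)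
      qed (use n0[OF that] in auto)
      also have "\<dots> = (\<Prod>k\<in>J. measure (density (P k) (q k)) (A k))" by (simp add: B_def)
      finally show ?thesis .
    qed
    have "(\<lambda>n. \<integral>z. f n z * indicator X z \<partial>?M) \<longlonglongrightarrow> (\<integral>z. g z * indicator X z \<partial>?M)"
    proof (rule Lim_transform[OF tendsto_const],
        rule Lim_null_comparison[where g="\<lambda>n. \<integral>z. \<bar>f n z - g z\<bar> \<partial>?M"])
      show "\<forall>\<^sub>F n in sequentially. norm ((\<integral>z. f n z * indicator X z \<partial>?M) - (\<integral>z. g z * indicator X z \<partial>?M)) \<le> (\<integral>z. \<bar>f n z - g z\<bar> \<partial>?M)"
      proof (intro always_eventually allI)
        fix n
        have "norm ((\<integral>z. f n z * indicator X z \<partial>?M) - (\<integral>z. g z * indicator X z \<partial>?M)) =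
            norm (\<integral>z. f n z * indicator X z - g z * indicator X z \<partial>?M)"
          using f1 gi by (subst Bochner_Integration.integral_diff) (auto intro!: integrable_real_mult_indicator)
        also have "\<dots> \<le> (\<integral>z. norm (f n z * indicator X z - g z * indicator X z) \<partial>?M)"
          by (rule integral_norm_bound)
        also have "\<dots> \<le> (\<integral>z. \<bar>f n z - g z\<bar> \<partial>?M)"
          using f1 gi by (intro integral_mono integrable_norm Bochner_Integration.integrable_diff integrable_real_mult_indicator)
            (auto split: split_indicator)
        finally show "norm ((\<integral>z. f n z * indicator X z \<partial>?M) - (\<integral>z. g z * indicator X z \<partial>?M)) \<le> (\<integral>z. \<bar>f n z - g z\<bar> \<partial>?M)" .
      qed
      show "(\<lambda>n. \<integral>z. \<bar>f n z - g z\<bar> \<partial>?M) \<longlonglongrightarrow> 0" using conv by (simp add: converges_in_L1_def)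
    qed
    moreover have "(\<lambda>n. \<integral>z. f n z * indicator X z \<partial>?M) \<longlonglongrightarrow> (\<Prod>k\<in>J. measure (density (P k) (q k)) (A k))"
      by (rule tendsto_eventually, rule eventually_sequentiallyI[of n0]) (rule val)
    ultimately have eq: "(\<integral>z. g z * indicator X z \<partial>?M) = (\<Prod>k\<in>J. measure (density (P k) (q k)) (A k))"
      by (rule LIMSEQ_unique)
    have "emeasure (density ?M g) X = (\<integral>\<^sup>+z. ennreal (g z * indicator X z) \<partial>?M)"
      by (subst emeasure_density) (auto intro!: nn_integral_cong split: split_indicator)
    also have "\<dots> = ennreal (\<integral>z. g z * indicator X z \<partial>?M)"
      using gi by (intro nn_integral_eq_integral integrable_real_mult_indicator) (auto simp: gnn)
    also have "\<dots> = (\<Prod>k\<in>J. emeasure (density (P k) (q k)) (A k))"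
      unfolding eq by (subst prod_ennreal[symmetric]) (auto simp: Q.M.emeasure_eq_measure)
    also have "\<dots> = emeasure (PiM UNIV (\<lambda>k. density (P k) (q k))) X"
    proof -
      have "X = prod_emb UNIV (\<lambda>k. density (P k) (q k)) J (Pi\<^sub>E J A)" by (simp add: X_def prod_emb_def)
      then show ?thesis using J A by (subst Q.emeasure_PiM_emb[symmetric]) auto
    qed
    finally show "emeasure (PiM UNIV (\<lambda>k. density (P k) (q k))) (prod_emb UNIV P J (Pi\<^sub>E J A)) =
        emeasure (density ?M g) (prod_emb UNIV P J (Pi\<^sub>E J A))" by (simp add: X_def)
  qed simp
  then show ?thesis using conv gnn unfolding f_def by blast
qed

section \<open>Stochastic integrals of smooth integrands\<close>

text \<open>One-sided limits bound the path near every point, and bisection of the interval makes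
  the bound global. The guard \<open>0 \<le> u\<close> in the bisected property reflects that
  nothing is known about the path at negative times.\<close>

lemma cadlag_bounded:
  assumes z: "cadlag z" and t: "0 \<le> t"
  shows "\<exists>B. \<forall>u\<in>{0..t}. \<bar>z u\<bar> \<le> B"
proof -
  have "\<exists>B. \<forall>u. 0 \<le> u \<longrightarrow> 0 \<le> u \<and> u \<le> t \<longrightarrow> \<bar>z u\<bar> \<le> B"
    using t
  proof (induction rule: Bolzano[where P="\<lambda>a b. \<exists>B. \<forall>u. 0 \<le> u \<longrightarrow> a \<le> u \<and> u \<le> b \<longrightarrow> \<bar>z u\<bar> \<le> B"])
    case (trans a b c)
    then obtain B1 B2 where "\<forall>u. 0 \<le> u \<longrightarrow> a \<le> u \<and> u \<le> b \<longrightarrow> \<bar>z u\<bar> \<le> B1"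
      "\<forall>u. 0 \<le> u \<longrightarrow> b \<le> u \<and> u \<le> c \<longrightarrow> \<bar>z u\<bar> \<le> B2" by auto
    then have "\<bar>z u\<bar> \<le> max B1 B2" if "0 \<le> u" "a \<le> u" "u \<le> c" for u
      using that by (cases "u \<le> b") (auto simp: le_max_iff_disj)
    then show ?case by blast
  next
    case (local x)
    have "eventually (\<lambda>u. dist (z u) (z x) < 1) (at_right x)"
      using z local by (intro tendstoD) (auto simp: cadlag_def)
    then obtain d1 where d1: "d1 > x" "\<And>u. x < u \<Longrightarrow> u < d1 \<Longrightarrow> dist (z u) (z x) < 1"
      by (auto simp: eventually_at_right_field)
    have "\<exists>d2 L. d2 < x \<and> (\<forall>u. 0 \<le> u \<longrightarrow> d2 < u \<longrightarrow> u < x \<longrightarrow> \<bar>z u\<bar> \<le> L)"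
    proof (cases "x = 0")
      case True then show ?thesis by (intro exI[of _ "-1"]) auto
    next
      case False
      then obtain l where "(z \<longlongrightarrow> l) (at_left x)" using z local unfolding cadlag_def by (metis less_eq_real_def)
      then have "eventually (\<lambda>u. dist (z u) l < 1) (at_left x)" by (intro tendstoD) auto
      then obtain d2 where "d2 < x" "\<And>u. d2 < u \<Longrightarrow> u < x \<Longrightarrow> dist (z u) l < 1"
        by (auto simp: eventually_at_left_field)
      then show ?thesis by (intro exI[of _ d2] exI[of _ "\<bar>l\<bar> + 1"]) (fastforce simp: dist_real_def)
    qed
    then obtain d2 L where d2: "d2 < x" "\<And>u. 0 \<le> u \<Longrightarrow> d2 < u \<Longrightarrow> u < x \<Longrightarrow> \<bar>z u\<bar> \<le> L" by auto
    have "\<bar>z u\<bar> \<le> max L (\<bar>z x\<bar> + 1)" if u: "0 \<le> u" "d2 < u" "u < d1" for u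
    proof (cases u x rule: linorder_cases)
      case greater
      then show ?thesis using d1(2)[of u] u by (auto simp: dist_real_def)
    qed (use d2(2)[of u] u in auto)
    then show ?case using d1 d2
      by (intro exI[of _ "min (x - d2) (d1 - x)"]) (auto intro!: exI[of _ "max L (\<bar>z x\<bar> + 1)"])
  qed
  then show ?thesis by (metis atLeastAtMost_iff)
qed

lemma partition_mono:
  assumes "is_partition t r s" "i \<le> j" "j \<le> r"
  shows "s i \<le> s j"
  using assms(2,3)
proof (induction rule: dec_induct)
  case (step n)
  then have "s n \<le> s (Suc n)" using assms(1) by (auto simp: is_partition_def)
  then show ?case using step by simp
qed simp

text \<open>Cells are half-open and may be empty, because partition points may repeat; monotonicity
  still leaves only one cell containing \<open>u\<close>.\<close>

lemma partition_locate:
  assumes s: "is_partition t r s" and u: "0 \<le> u" "u < t"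
  shows "\<exists>i<r. s i \<le> u \<and> u < s (Suc i) \<and> (\<forall>j<r. s j \<le> u \<and> u < s (Suc j) \<longrightarrow> j = i)"
proof -
  define j where "j = (LEAST j. u < s j)"
  have sr: "u < s r" using s u by (simp add: is_partition_def)
  have j: "u < s j" "j \<le> r" unfolding j_def using sr by (auto intro: LeastI Least_le)
  have "j \<noteq> 0"
  proof
    assume "j = 0"
    then show False using j(1) s u by (simp add: is_partition_def)
  qed
  then obtain i where i: "j = Suc i" by (cases j) auto
  have "\<not> u < s i" unfolding i[symmetric] using not_less_Least[of i "\<lambda>j. u < s j"] i j_def by auto
  moreover have "k = i" if "k < r" "s k \<le> u" "u < s (Suc k)" for k
  proof (rule ccontr)
    assume "k \<noteq> i"
    then consider "Suc k \<le> i" | "Suc i \<le> k" by linarith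
    then show False
    proof cases
      case 1
      then show False using partition_mono[OF s 1] j i that \<open>\<not> u < s i\<close> by auto
    next
      case 2
      then show False using partition_mono[OF s 2] j i that by auto
    qed
  qed
  ultimately show ?thesis using j i by (intro exI[of _ i]) auto
qed

lemma summation_by_parts:
  fixes f z :: "nat \<Rightarrow> real"
  shows "(\<Sum>i<r. f i * (z (Suc i) - z i)) = f r * z r - f 0 * z 0 - (\<Sum>i<r. z (Suc i) * (f (Suc i) - f i))"
  by (induction r) (auto simp: algebra_simps)

text \<open>Summation by parts moves the increments onto the smooth integrand, so that the sums converge
  along every path separately and no maximal inequality for the integrator is needed.\<close>

lemma cadlag_riemann_sums:
  assumes z: "cadlag z" and t: "0 \<le> t"
    and f: "\<And>u. (f has_real_derivative f' u) (at u)" and f': "continuous_on UNIV f'"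
    and s: "\<And>n. is_partition t (r n) (s n)"
    and mesh: "\<And>n i. i < r n \<Longrightarrow> s n (Suc i) - s n i < \<delta> n" and \<delta>: "\<delta> \<longlonglongrightarrow> 0"
  shows "(\<lambda>n. \<Sum>i<r n. f (s n i) * (z (s n (Suc i)) - z (s n i))) \<longlonglongrightarrow>
    f t * z t - f 0 * z 0 - (\<integral>u. indicator {0..<t} u * (z u * f' u) \<partial>lborel)"
proof -
  obtain B where B: "\<And>u. 0 \<le> u \<Longrightarrow> u \<le> t \<Longrightarrow> \<bar>z u\<bar> \<le> B" using cadlag_bounded[OF z t] by (meson atLeastAtMost_iff)
  have B0: "0 \<le> B" using B[of 0] t by auto
  have "bounded (f' ` {0..t})"
    by (intro compact_imp_bounded compact_continuous_image continuous_on_subset[OF f']) auto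
  then obtain K where K: "\<And>u. 0 \<le> u \<Longrightarrow> u \<le> t \<Longrightarrow> \<bar>f' u\<bar> \<le> K"
    unfolding bounded_iff by (metis atLeastAtMost_iff imageI real_norm_def)
  have f'm[measurable]: "f' \<in> borel_measurable borel" by (rule borel_measurable_continuous_onI[OF f'])
  have s0: "s n 0 = 0" and sr: "s n (r n) = t" for n using s by (auto simp: is_partition_def)
  have srange: "0 \<le> s n i" "s n i \<le> t" if "i \<le> r n" for n i
    using partition_mono[OF s, of 0 i n] partition_mono[OF s, of i "r n" n] that s0 sr by auto
  have smono: "s n i \<le> s n (Suc i)" if "i < r n" for n i using s that by (auto simp: is_partition_def)
  \<comment> \<open>The sum left over by summation by parts is the integral of \<open>G n\<close>:
    on each cell \<open>f'\<close> is multiplied by the value of the path at the right end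
    point.\<close>
  define G where "G n u = (\<Sum>i<r n. z (s n (Suc i)) * (f' u * indicator {s n i..<s n (Suc i)} u))" for n u
  have Gm[measurable]: "G n \<in> borel_measurable borel" for n unfolding G_def by measurable
  have piece: "has_bochner_integral lborel (\<lambda>u. f' u * indicator {a..<b} u) (f b - f a)" if "a \<le> b" for a b
  proof -
    have "has_bochner_integral lborel (\<lambda>u. f' u * indicator {a..b} u) (f b - f a)"
      using f f' that by (intro has_bochner_integral_FTC_Icc_real) (auto simp: continuous_on_eq_continuous_at)
    moreover have "AE u in lborel. f' u * indicator {a..b} u = f' u * indicator {a..<b} u"
      using AE_lborel_singleton[of b] by eventually_elim (auto split: split_indicator)
    ultimately show ?thesis by (subst has_bochner_integral_cong_AE[symmetric]) auto
  qed
  have Gint: "(\<integral>u. G n u \<partial>lborel) = (\<Sum>i<r n. z (s n (Suc i)) * (f (s n (Suc i)) - f (s n i)))" for n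
    unfolding G_def using piece[OF smono, of _ n]
    by (subst Bochner_Integration.integral_sum) (auto simp: has_bochner_integral_iff intro!: sum.cong)
  have Gout: "G n u = 0" if "\<not> (0 \<le> u \<and> u < t)" for n u
  proof -
    have "u \<notin> {s n i..<s n (Suc i)}" if "i < r n" for i
      using srange(1)[of i n] srange(2)[of "Suc i" n] that \<open>\<not> (0 \<le> u \<and> u < t)\<close> by auto
    then show ?thesis by (simp add: G_def)
  qed
  \<comment> \<open>The sampling point lies strictly to the right of \<open>u\<close>, so
    right-continuity gives the pointwise convergence to \<open>z u * f' u\<close>.\<close>
  have Gin: "\<exists>v. u < v \<and> v < u + \<delta> n \<and> v \<le> t \<and> G n u = z v * f' u" if u: "0 \<le> u" "u < t" for n u
  proof -
    obtain i where i: "i < r n" "s n i \<le> u" "u < s n (Suc i)"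
      and uniq: "\<And>j. j < r n \<Longrightarrow> s n j \<le> u \<Longrightarrow> u < s n (Suc j) \<Longrightarrow> j = i"
      using partition_locate[OF s u] by metis
    have "G n u = (\<Sum>j<r n. if j = i then z (s n (Suc i)) * f' u else 0)"
      unfolding G_def
    proof (intro sum.cong refl)
      fix j assume "j \<in> {..<r n}"
      then show "z (s n (Suc j)) * (f' u * indicator {s n j..<s n (Suc j)} u) = (if j = i then z (s n (Suc i)) * f' u else 0)"
      proof (cases "j = i")
        case True
        then have "u \<in> {s n j..<s n (Suc j)}" using i by simp
        then show ?thesis using True by simp
      next
        case False
        then have "u \<notin> {s n j..<s n (Suc j)}" using uniq[of j] \<open>j \<in> {..<r n}\<close> by auto
        then show ?thesis using False by simp
      qed
    qed
    also have "\<dots> = z (s n (Suc i)) * f' u" using i by simp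
    finally show ?thesis using mesh[OF i(1)] i srange(2)[of "Suc i" n] by (intro exI[of _ "s n (Suc i)"]) auto
  qed
  have lim: "(\<lambda>n. G n u) \<longlonglongrightarrow> indicator {0..<t} u * (z u * f' u)" for u
  proof (cases "0 \<le> u \<and> u < t")
    case False
    then show ?thesis using Gout by (auto split: split_indicator)
  next
    case True
    then obtain v where v: "\<And>n. u < v n" "\<And>n. v n < u + \<delta> n" "\<And>n. G n u = z (v n) * f' u"
    proof -
      have "\<forall>n. \<exists>v. u < v \<and> v < u + \<delta> n \<and> G n u = z v * f' u" using Gin[of u] True by blast
      from choice[OF this] show ?thesis using that by blast
    qed
    have "v \<longlonglongrightarrow> u"
    proof (rule tendsto_sandwich[where f="\<lambda>_. u" and h="\<lambda>n. u + \<delta> n"])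
      show "(\<lambda>n. u + \<delta> n) \<longlonglongrightarrow> u" using tendsto_add[OF tendsto_const \<delta>, of u] by simp
    qed (auto intro!: always_eventually less_imp_le v)
    then have "filterlim v (at_right u) sequentially"
      using v(1) by (auto simp: filterlim_at intro!: always_eventually)
    moreover have "(z \<longlongrightarrow> z u) (at_right u)" using z True by (simp add: cadlag_def)
    ultimately have "(\<lambda>n. z (v n)) \<longlonglongrightarrow> z u" by (rule filterlim_compose[rotated])
    then have "(\<lambda>n. z (v n) * f' u) \<longlonglongrightarrow> z u * f' u" by (rule tendsto_mult_right)
    then show ?thesis using True by (simp add: v(3))
  qed
  have "(\<lambda>n. \<integral>u. G n u \<partial>lborel) \<longlonglongrightarrow> (\<integral>u. indicator {0..<t} u * (z u * f' u) \<partial>lborel)"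
  proof (rule integral_dominated_convergence)
    \<comment> \<open>Measurability of this product is inherited from the \<open>G n\<close>, of
      which it is the pointwise limit.\<close>
    show "(\<lambda>u. indicator {0..<t} u * (z u * f' u)) \<in> borel_measurable lborel"
      by (rule borel_measurable_LIMSEQ_real[OF lim]) simp
    show "integrable lborel (\<lambda>u. B * K * indicator {0..t} u)" using t by simp
    show "AE u in lborel. norm (G n u) \<le> B * K * indicator {0..t} u" for n
    proof (intro AE_I2)
      fix u
      show "norm (G n u) \<le> B * K * indicator {0..t} u"
      proof (cases "0 \<le> u \<and> u < t")
        case True
        then obtain v where "u < v" "v \<le> t" "G n u = z v * f' u" using Gin[of u n] by auto
        then show ?thesis using True B[of v] K[of u] B0 by (auto simp: abs_mult intro!: mult_mono)
      next
        case False
        then have "0 \<le> B * K" using B0 K[of 0] t by auto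
        then show ?thesis using Gout[OF False] by simp
      qed
    qed
  qed (use lim in auto)
  then have "(\<lambda>n. f t * z t - f 0 * z 0 - (\<integral>u. G n u \<partial>lborel)) \<longlonglongrightarrow>
    f t * z t - f 0 * z 0 - (\<integral>u. indicator {0..<t} u * (z u * f' u) \<partial>lborel)"
    by (intro tendsto_diff tendsto_const)
  moreover have "(\<Sum>i<r n. f (s n i) * (z (s n (Suc i)) - z (s n i))) =
      f t * z t - f 0 * z 0 - (\<integral>u. G n u \<partial>lborel)" for n
    unfolding Gint using summation_by_parts[of "\<lambda>i. f (s n i)" "\<lambda>i. z (s n i)" "r n"] s0[of n] sr[of n] by simp
  ultimately show ?thesis by simp
qed

text \<open>One explicit sequence of partitions, so that the integral becomes a sequential limit of
  path functionals and stays measurable; \<open>Suc m\<close> cells avoid a division by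
  zero.\<close>

definition uniform_sum :: "(real \<Rightarrow> real) \<Rightarrow> real \<Rightarrow> nat \<Rightarrow> (real \<Rightarrow> real) \<Rightarrow> real" where
  "uniform_sum f t m z =
     (\<Sum>i<Suc m. f (t * real i / real (Suc m)) * (z (t * real (Suc i) / real (Suc m)) - z (t * real i / real (Suc m))))"

lemma uniform_partition:
  assumes "0 \<le> t"
  shows "is_partition t (Suc m) (\<lambda>i. t * real i / real (Suc m))"
    and "t * real (Suc i) / real (Suc m) - t * real i / real (Suc m) = t / real (Suc m)"
proof -
  show "is_partition t (Suc m) (\<lambda>i. t * real i / real (Suc m))"
    using assms by (auto simp: is_partition_def intro!: divide_right_mono mult_left_mono simp del: of_nat_Suc)
  show "t * real (Suc i) / real (Suc m) - t * real i / real (Suc m) = t / real (Suc m)"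
    by (simp only: diff_divide_distrib[symmetric] right_diff_distrib[symmetric]) simp
qed

text \<open>Pathwise convergence along every sequence of partitions with vanishing mesh gives
  convergence in probability over all fine partitions: otherwise there would be bad partitions with
  mesh below \<open>1 / (n + 1)\<close>, and dominated convergence for the indicators of the
  exceptional events would contradict the lower bound \<open>\<eta>\<close> on their
  probabilities.\<close>

lemma
  fixes Z :: "real \<Rightarrow> 'w \<Rightarrow> real"
  assumes M: "prob_space M" and Z: "\<And>u. 0 \<le> u \<Longrightarrow> Z u \<in> borel_measurable M"
    and cad: "AE \<omega> in M. cadlag (\<lambda>u. Z u \<omega>)" and t: "0 \<le> t"
    and f: "\<And>u. (f has_real_derivative f' u) (at u)" and f': "continuous_on UNIV f'"
  defines "I \<equiv> \<lambda>\<omega>. lim (\<lambda>m. uniform_sum f t m (\<lambda>u. Z u \<omega>))"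
  shows uniform_sum_tendsto: "AE \<omega> in M. (\<lambda>m. uniform_sum f t m (\<lambda>u. Z u \<omega>)) \<longlonglongrightarrow> I \<omega>"
    and has_stochastic_integral_lim: "has_stochastic_integral M Z f t I"
proof -
  interpret prob_space M by (rule M)
  define J where "J \<omega> = f t * Z t \<omega> - f 0 * Z 0 \<omega> - (\<integral>u. indicator {0..<t} u * (Z u \<omega> * f' u) \<partial>lborel)" for \<omega>
  \<comment> \<open>Twice the cell length plus \<open>1 / (m + 1)\<close>: the mesh bound has to be
    strict, also for \<open>t = 0\<close>.\<close>
  have t0: "(\<lambda>m. 2 * (t / real (Suc m)) + 1 / real (Suc m)) \<longlonglongrightarrow> 0" by real_asymp
  have um: "(\<lambda>\<omega>. uniform_sum f t m (\<lambda>u. Z u \<omega>)) \<in> borel_measurable M" for m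
    unfolding uniform_sum_def using t
    by (intro borel_measurable_sum borel_measurable_times borel_measurable_const borel_measurable_diff Z) auto
  have Im[measurable]: "I \<in> borel_measurable M" unfolding I_def by (intro borel_measurable_lim_metric um)
  have uJ: "AE \<omega> in M. (\<lambda>m. uniform_sum f t m (\<lambda>u. Z u \<omega>)) \<longlonglongrightarrow> J \<omega>"
    using cad
  proof eventually_elim
    case (elim \<omega>)
    have "t / real (Suc m) < 2 * (t / real (Suc m)) + 1 / real (Suc m)" for m
    proof -
      have "0 \<le> t / real (Suc m)" "0 < 1 / real (Suc m)" using t by auto
      then show ?thesis by linarith
    qed
    then have "t * real (Suc i) / real (Suc m) - t * real i / real (Suc m) < 2 * (t / real (Suc m)) + 1 / real (Suc m)" for i m
      unfolding uniform_partition(2)[OF t] .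
    from cadlag_riemann_sums[OF elim t f f' uniform_partition(1)[OF t] this t0]
    show ?case by (simp add: uniform_sum_def J_def)
  qed
  have IJ: "AE \<omega> in M. I \<omega> = J \<omega>" using uJ by eventually_elim (simp add: I_def limI)
  with uJ show "AE \<omega> in M. (\<lambda>m. uniform_sum f t m (\<lambda>u. Z u \<omega>)) \<longlonglongrightarrow> I \<omega>"
    by eventually_elim simp
  show "has_stochastic_integral M Z f t I"
    unfolding has_stochastic_integral_def
  proof (intro conjI allI impI Im)
    fix \<epsilon> \<eta> :: real assume \<epsilon>: "0 < \<epsilon>" and \<eta>: "0 < \<eta>"
    define S where "S r s \<omega> = (\<Sum>i<r. f (s i) * (Z (s (Suc i)) \<omega> - Z (s i) \<omega>))" for r and s :: "nat \<Rightarrow> real" and \<omega>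
    show "\<exists>\<delta>>0. \<forall>r s. is_partition t r s \<and> (\<forall>i<r. s (Suc i) - s i < \<delta>) \<longrightarrow>
        prob {\<omega> \<in> space M. \<epsilon> \<le> \<bar>(\<Sum>i<r. f (s i) * (Z (s (Suc i)) \<omega> - Z (s i) \<omega>)) - I \<omega>\<bar>} < \<eta>"
    proof (rule ccontr)
      assume "\<not> ?thesis"
      then have "\<forall>\<delta>>0. \<exists>r s. is_partition t r s \<and> (\<forall>i<r. s (Suc i) - s i < \<delta>) \<and>
          \<eta> \<le> prob {\<omega> \<in> space M. \<epsilon> \<le> \<bar>S r s \<omega> - I \<omega>\<bar>}"
        unfolding S_def by (auto simp: not_less not_le[symmetric])
      then have ex: "\<forall>n. \<exists>r s. is_partition t r s \<and> (\<forall>i<r. s (Suc i) - s i < 1 / real (Suc n)) \<and>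
          \<eta> \<le> prob {\<omega> \<in> space M. \<epsilon> \<le> \<bar>S r s \<omega> - I \<omega>\<bar>}" by simp
      obtain r s where s: "\<And>n. is_partition t (r n) (s n)"
        and mesh: "\<And>n i. i < r n \<Longrightarrow> s n (Suc i) - s n i < 1 / real (Suc n)"
        and bad: "\<And>n. \<eta> \<le> prob {\<omega> \<in> space M. \<epsilon> \<le> \<bar>S (r n) (s n) \<omega> - I \<omega>\<bar>}"
      proof -
        define Q where "Q n p \<longleftrightarrow> is_partition t (fst p) (snd p) \<and> (\<forall>i<fst p. snd p (Suc i) - snd p i < 1 / real (Suc n)) \<and>
          \<eta> \<le> prob {\<omega> \<in> space M. \<epsilon> \<le> \<bar>S (fst p) (snd p) \<omega> - I \<omega>\<bar>}" for n p
        have "\<forall>n. \<exists>p. Q n p" unfolding Q_def using ex by (simp del: of_nat_Suc)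
        from choice[OF this] obtain p where "\<forall>n. Q n (p n)" by blast
        then show ?thesis using that[of "\<lambda>n. fst (p n)" "\<lambda>n. snd (p n)"] unfolding Q_def by blast
      qed
      have snn: "0 \<le> s n i" if "i \<le> r n" for n i
        using partition_mono[OF s, of 0 i n] that s[of n] by (auto simp: is_partition_def)
      have Sm[measurable]: "S (r n) (s n) \<in> borel_measurable M" for n
        unfolding S_def using snn
        by (intro borel_measurable_sum borel_measurable_times borel_measurable_const borel_measurable_diff Z) auto
      have n0: "(\<lambda>n. 1 / real (Suc n)) \<longlonglongrightarrow> 0" by real_asymp
      have conv: "AE \<omega> in M. (\<lambda>n. S (r n) (s n) \<omega>) \<longlonglongrightarrow> I \<omega>"
        using cad IJ
      proof eventually_elim
        case (elim \<omega>)
        from cadlag_riemann_sums[OF elim(1) t f f' s mesh n0] show ?case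
          unfolding S_def elim(2) J_def .
      qed
      have "(\<lambda>n. \<integral>\<omega>. indicator {\<omega> \<in> space M. \<epsilon> \<le> \<bar>S (r n) (s n) \<omega> - I \<omega>\<bar>} \<omega> \<partial>M) \<longlonglongrightarrow> (\<integral>\<omega>. (0::real) \<partial>M)"
      proof (rule integral_dominated_convergence)
        show "AE \<omega> in M. (\<lambda>n. indicator {\<omega> \<in> space M. \<epsilon> \<le> \<bar>S (r n) (s n) \<omega> - I \<omega>\<bar>} \<omega>) \<longlonglongrightarrow> (0::real)"
          using conv
        proof eventually_elim
          case (elim \<omega>)
          have "eventually (\<lambda>n. dist (S (r n) (s n) \<omega>) (I \<omega>) < \<epsilon>) sequentially"
            using elim \<epsilon> by (rule tendstoD)
          then show ?case
            by (intro tendsto_eventually) (auto elim!: eventually_mono simp: dist_real_def indicator_def)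
        qed
        show "integrable M (\<lambda>_. 1::real)" by simp
      qed (auto simp: indicator_def)
      then have "(\<lambda>n. prob {\<omega> \<in> space M. \<epsilon> \<le> \<bar>S (r n) (s n) \<omega> - I \<omega>\<bar>}) \<longlonglongrightarrow> 0" by simp
      then have "eventually (\<lambda>n. prob {\<omega> \<in> space M. \<epsilon> \<le> \<bar>S (r n) (s n) \<omega> - I \<omega>\<bar>} < \<eta>) sequentially"
        using \<eta> by (rule order_tendstoD)
      then show False using bad by (auto simp: eventually_sequentially not_less[symmetric])
    qed
  qed
qed

text \<open>\<open>stochastic_integral\<close> is an unspecified choice among limits in probability,
  so any two of them must agree almost surely; both are compared with the same uniform sums.\<close>

lemma has_stochastic_integral_unique:
  assumes M: "prob_space M" and t: "0 \<le> t"
    and Z: "\<And>u. 0 \<le> u \<Longrightarrow> Z u \<in> borel_measurable M"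
    and I: "has_stochastic_integral M Z f t I" and I': "has_stochastic_integral M Z f t I'"
  shows "AE \<omega> in M. I \<omega> = I' \<omega>"
proof -
  interpret prob_space M by (rule M)
  have [measurable]: "I \<in> borel_measurable M" "I' \<in> borel_measurable M"
    using I I' by (auto simp: has_stochastic_integral_def)
  define S where "S m \<omega> = uniform_sum f t m (\<lambda>u. Z u \<omega>)" for m \<omega>
  have Sm[measurable]: "S m \<in> borel_measurable M" for m
    unfolding uniform_sum_def S_def using t
    by (intro borel_measurable_sum borel_measurable_times borel_measurable_const borel_measurable_diff Z) auto
  have *: "\<exists>m0. \<forall>m\<ge>m0. prob {\<omega> \<in> space M. \<epsilon> \<le> \<bar>S m \<omega> - I \<omega>\<bar>} < \<eta>"
    if H: "has_stochastic_integral M Z f t I" and pos: "0 < \<epsilon>" "0 < \<eta>" for I \<epsilon> \<eta>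
  proof -
    obtain \<delta> where \<delta>: "\<delta> > 0" "\<And>r s. is_partition t r s \<Longrightarrow> (\<forall>i<r. s (Suc i) - s i < \<delta>) \<Longrightarrow>
        prob {\<omega> \<in> space M. \<epsilon> \<le> \<bar>(\<Sum>i<r. f (s i) * (Z (s (Suc i)) \<omega> - Z (s i) \<omega>)) - I \<omega>\<bar>} < \<eta>"
      using H[unfolded has_stochastic_integral_def, THEN conjunct2, rule_format, OF pos] by blast
    have "(\<lambda>m. t / real (Suc m)) \<longlonglongrightarrow> 0" by real_asymp
    then have "eventually (\<lambda>m. t / real (Suc m) < \<delta>) sequentially" using \<delta>(1) by (rule order_tendstoD)
    then obtain m0 where m0: "\<And>m. m0 \<le> m \<Longrightarrow> t / real (Suc m) < \<delta>" by (auto simp: eventually_sequentially)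
    show ?thesis
    proof (intro exI[of _ m0] allI impI)
      fix m assume "m0 \<le> m"
      then have "\<forall>i<Suc m. t * real (Suc i) / real (Suc m) - t * real i / real (Suc m) < \<delta>"
        unfolding uniform_partition(2)[OF t] using m0 by simp
      from \<delta>(2)[OF uniform_partition(1)[OF t] this]
      show "prob {\<omega> \<in> space M. \<epsilon> \<le> \<bar>S m \<omega> - I \<omega>\<bar>} < \<eta>" unfolding S_def uniform_sum_def .
    qed
  qed
  have "prob {\<omega> \<in> space M. 2 * \<epsilon> \<le> \<bar>I \<omega> - I' \<omega>\<bar>} = 0" if \<epsilon>: "0 < \<epsilon>" for \<epsilon>
  proof (rule antisym[OF field_le_epsilon])
    fix \<eta> :: real assume \<eta>: "0 < \<eta>"
    obtain m1 where m1: "\<And>m. m1 \<le> m \<Longrightarrow> prob {\<omega> \<in> space M. \<epsilon> \<le> \<bar>S m \<omega> - I \<omega>\<bar>} < \<eta> / 2"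
      using *[OF I \<epsilon>, of "\<eta> / 2"] \<eta> by auto
    obtain m2 where m2: "\<And>m. m2 \<le> m \<Longrightarrow> prob {\<omega> \<in> space M. \<epsilon> \<le> \<bar>S m \<omega> - I' \<omega>\<bar>} < \<eta> / 2"
      using *[OF I' \<epsilon>, of "\<eta> / 2"] \<eta> by auto
    define m where "m = max m1 m2"
    have "prob {\<omega> \<in> space M. 2 * \<epsilon> \<le> \<bar>I \<omega> - I' \<omega>\<bar>} \<le>
        prob ({\<omega> \<in> space M. \<epsilon> \<le> \<bar>S m \<omega> - I \<omega>\<bar>} \<union> {\<omega> \<in> space M. \<epsilon> \<le> \<bar>S m \<omega> - I' \<omega>\<bar>})"
      by (intro finite_measure_mono) auto
    also have "\<dots> \<le> prob {\<omega> \<in> space M. \<epsilon> \<le> \<bar>S m \<omega> - I \<omega>\<bar>} + prob {\<omega> \<in> space M. \<epsilon> \<le> \<bar>S m \<omega> - I' \<omega>\<bar>}"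
      by (intro measure_Un_le) measurable
    also have "\<dots> \<le> 0 + \<eta>" using m1[of m] m2[of m] by (simp add: m_def)
    finally show "prob {\<omega> \<in> space M. 2 * \<epsilon> \<le> \<bar>I \<omega> - I' \<omega>\<bar>} \<le> 0 + \<eta>" .
  qed simp
  from this[of "1 / (2 * real (Suc k))" for k] have "prob {\<omega> \<in> space M. 1 / real (Suc k) \<le> \<bar>I \<omega> - I' \<omega>\<bar>} = 0" for k
    by (simp del: of_nat_Suc)
  then have "AE \<omega> in M. \<not> 1 / real (Suc k) \<le> \<bar>I \<omega> - I' \<omega>\<bar>" for k
    by (subst AE_iff_measurable[OF _ refl]) (auto simp: emeasure_eq_measure)
  then have "AE \<omega> in M. \<forall>k. \<not> 1 / real (Suc k) \<le> \<bar>I \<omega> - I' \<omega>\<bar>" by (simp add: AE_all_countable)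
  then show ?thesis
  proof eventually_elim
    case (elim \<omega>)
    show ?case
    proof (rule ccontr)
      assume "I \<omega> \<noteq> I' \<omega>"
      then obtain k where "inverse (real (Suc k)) < \<bar>I \<omega> - I' \<omega>\<bar>" using reals_Archimedean[of "\<bar>I \<omega> - I' \<omega>\<bar>"] by auto
      then show False using elim by (auto simp: inverse_eq_divide not_le dest: spec[of _ k])
    qed
  qed
qed

section \<open>The law of the Ornstein-Uhlenbeck coordinates\<close>

text \<open>Translates the independence in \<open>levy_process\<close>, stated for families of
  events, into independence of random variables. Both families are closed under intersection, so
  independence extends to the generated sigma-algebras.\<close>

lemma (in prob_space) indep_var_of_indep_set:
  assumes N: "subalgebra M N" and X: "X \<in> borel_measurable N" and D: "D \<in> borel_measurable M"
    and indep: "indep_set (sets N) {D -` B \<inter> space M | B. B \<in> sets borel}"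
  shows "indep_var borel X borel D"
proof -
  have sp: "space N = space M" and sub: "sets N \<subseteq> sets M" using N by (auto simp: subalgebra_def)
  have XM: "X \<in> borel_measurable M" using X sp sub by (auto simp: measurable_def)
  have "Int_stable {D -` B \<inter> space M | B. B \<in> sets borel}"
  proof (rule Int_stableI)
    fix a b assume "a \<in> {D -` B \<inter> space M | B. B \<in> sets borel}" "b \<in> {D -` B \<inter> space M | B. B \<in> sets borel}"
    then obtain A B where "A \<in> sets borel" "B \<in> sets borel" "a = D -` A \<inter> space M" "b = D -` B \<inter> space M" by auto
    then show "a \<inter> b \<in> {D -` B \<inter> space M | B. B \<in> sets borel}" by (auto intro!: exI[of _ "A \<inter> B"])
  qed
  then have 1: "indep_set (sigma_sets (space M) (sets N)) (sigma_sets (space M) {D -` B \<inter> space M | B. B \<in> sets borel})"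
    using indep_set_sigma_sets[OF indep] sets.Int_stable by blast
  have 2: "sigma_sets (space M) {X -` A \<inter> space M | A. A \<in> sets borel} \<subseteq> sigma_sets (space M) (sets N)"
    using measurable_sets[OF X] sp by (intro sigma_sets_mono') auto
  have "indep_set (sigma_sets (space M) {X -` A \<inter> space M | A. A \<in> sets borel})
      (sigma_sets (space M) {D -` B \<inter> space M | B. B \<in> sets borel})"
    unfolding indep_set_def
    by (rule indep_sets_mono_sets[OF 1[unfolded indep_set_def]]) (use 2 in \<open>auto split: bool.split\<close>)
  then show ?thesis using XM D by (simp add: indep_var_eq)
qed

lemma char_distr_cmult:
  fixes X :: "'a \<Rightarrow> real"
  assumes "X \<in> borel_measurable M"
  shows "char (distr M borel (\<lambda>\<omega>. c * X \<omega>)) h = char (distr M borel X) (h * c)"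
proof -
  have [measurable]: "X \<in> borel_measurable M" by fact
  show ?thesis unfolding char_def by (subst (1 2) integral_distr) (auto simp: mult.assoc)
qed

lemma usual_stochastic_basisD:
  assumes "usual_stochastic_basis M F"
  shows "prob_space M"
    and "0 \<le> u \<Longrightarrow> subalgebra M (F u)"
    and "0 \<le> u \<Longrightarrow> u \<le> v \<Longrightarrow> sets (F u) \<subseteq> sets (F v)"
proof -
  note basis = assms[unfolded usual_stochastic_basis_def]
  show "prob_space M" using basis by (elim conjE)
  show "0 \<le> u \<Longrightarrow> subalgebra M (F u)"
    by (rule basis[THEN conjunct2, THEN conjunct2, THEN conjunct1, rule_format])
  show "0 \<le> u \<Longrightarrow> u \<le> v \<Longrightarrow> sets (F u) \<subseteq> sets (F v)"
    by (rule basis[THEN conjunct2, THEN conjunct2, THEN conjunct2, THEN conjunct1, rule_format, OF conjI])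
qed

lemma stable_process_measurable:
  assumes "usual_stochastic_basis M F" "normalized_symmetric_stable_process M F \<alpha> Z" "0 \<le> u" "u \<le> v"
  shows "Z u \<in> borel_measurable (F v)" and "Z u \<in> borel_measurable M"
proof -
  have Zu: "Z u \<in> borel_measurable (F u)"
    using assms by (auto simp: normalized_symmetric_stable_process_def levy_process_def)
  have s: "subalgebra M (F u)" "subalgebra M (F v)" "sets (F u) \<subseteq> sets (F v)"
    using assms(3,4) by (intro usual_stochastic_basisD[OF assms(1)]; linarith)+
  show "Z u \<in> borel_measurable M" by (rule measurable_from_subalg[OF s(1) Zu])
  have "subalgebra (F v) (F u)" using s by (auto simp: subalgebra_def)
  then show "Z u \<in> borel_measurable (F v)" by (rule measurable_from_subalg[OF _ Zu])
qed

text \<open>Induction on the number of increments: the partial sum is measurable with respect to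
  \<open>F (s k)\<close>, hence independent of the next increment, and characteristic functions
  multiply.\<close>

lemma char_stable_sum:
  assumes basis: "usual_stochastic_basis M F" and Z: "normalized_symmetric_stable_process M F \<alpha> Z"
    and s: "0 \<le> s 0" "\<And>i. i < k \<Longrightarrow> s i \<le> s (Suc i)"
  shows "char (distr M borel (\<lambda>\<omega>. \<Sum>i<k. c i * (Z (s (Suc i)) \<omega> - Z (s i) \<omega>))) h =
    complex_of_real (exp (- (\<Sum>i<k. (s (Suc i) - s i) * \<bar>h * c i\<bar> powr \<alpha>)))"
  using s(2)
proof (induction k)
  interpret prob_space M by (rule usual_stochastic_basisD(1)[OF basis])
  {
    case 0
    then show ?case unfolding char_def by (subst integral_distr) (simp_all add: prob_space)
  next
    case (Suc k)
    define X where "X \<omega> = (\<Sum>i<k. c i * (Z (s (Suc i)) \<omega> - Z (s i) \<omega>))" for \<omega>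
    define Y where "Y \<omega> = Z (s (Suc k)) \<omega> - Z (s k) \<omega>" for \<omega>
    have smono: "s i \<le> s j" if "i \<le> j" "j \<le> Suc k" for i j
      using that
    proof (induction rule: dec_induct)
      case (step n)
      then have "s n \<le> s (Suc n)" using Suc.prems by auto
      then show ?case using step by simp
    qed simp
    have snn: "0 \<le> s i" if "i \<le> Suc k" for i using smono[of 0 i] that s(1) by simp
    have Xm: "X \<in> borel_measurable (F (s k))" unfolding X_def
      by (intro borel_measurable_sum borel_measurable_times borel_measurable_const borel_measurable_diff
          stable_process_measurable[OF basis Z] snn smono) auto
    have Ym[measurable]: "Y \<in> borel_measurable M" unfolding Y_def
      by (intro borel_measurable_diff stable_process_measurable(2)[OF basis Z _ order_refl] snn) auto
    have k: "0 \<le> s k" "s k \<le> s (Suc k)" using snn smono by auto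
    have levy: "levy_process M F Z" using Z by (simp add: normalized_symmetric_stable_process_def)
    have "subalgebra M (F (s k))" by (rule usual_stochastic_basisD(2)[OF basis k(1)])
    moreover have "indep_set (sets (F (s k))) {Y -` B \<inter> space M | B. B \<in> sets borel}"
      using levy k unfolding levy_process_def Y_def by blast
    ultimately have "indep_var borel X borel Y"
      by (intro indep_var_of_indep_set[OF _ Xm Ym])
    then have "indep_var borel ((\<lambda>x. x) \<circ> X) borel ((\<lambda>y. c k * y) \<circ> Y)"
      by (rule indep_var_compose) auto
    then have ind: "indep_var borel X borel (\<lambda>\<omega>. c k * Y \<omega>)" by (simp add: o_def)
    have "distr M borel Y = distr M borel (Z (s (Suc k) - s k))"
      using levy k unfolding levy_process_def Y_def by blast
    then have "char (distr M borel (\<lambda>\<omega>. c k * Y \<omega>)) h = complex_of_real (exp (- ((s (Suc k) - s k) * \<bar>h * c k\<bar> powr \<alpha>)))"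
      using Z k unfolding char_distr_cmult[OF Ym] normalized_symmetric_stable_process_def by simp
    moreover have "char (distr M borel X) h = complex_of_real (exp (- (\<Sum>i<k. (s (Suc i) - s i) * \<bar>h * c i\<bar> powr \<alpha>)))"
      unfolding X_def using Suc by auto
    ultimately have "char (distr M borel (\<lambda>\<omega>. X \<omega> + c k * Y \<omega>)) h =
      complex_of_real (exp (- (\<Sum>i<k. (s (Suc i) - s i) * \<bar>h * c i\<bar> powr \<alpha>))) * complex_of_real (exp (- ((s (Suc k) - s k) * \<bar>h * c k\<bar> powr \<alpha>)))"
      using char_distr_add[OF ind] by simp
    also have "\<dots> = complex_of_real (exp (- (\<Sum>i<Suc k. (s (Suc i) - s i) * \<bar>h * c i\<bar> powr \<alpha>)))"
      by (simp add: exp_add[symmetric] del: of_real_exp flip: of_real_mult)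
    finally show ?case by (simp add: X_def Y_def)
  }
qed

text \<open>For positive \<open>t\<close> these are Riemann sums of
  \<open>exp (- A + A * s / t)\<close> over [0, t]. They are geometric, so everything reduces to the
  limit \<open>1 / A\<close> of \<open>y / (exp (A * y) - 1)\<close> as \<open>y\<close> tends to 0.
  With \<open>A = \<alpha> * g * t\<close> they produce the constant in
  \<open>ou_scale\<close>.\<close>

lemma exponential_riemann_sum:
  assumes A: "0 < A"
  shows "(\<lambda>m. \<Sum>i<Suc m. (t / real (Suc m)) * exp (- A + A * real i / real (Suc m))) \<longlonglongrightarrow> t * (1 - exp (- A)) / A"
proof -
  have "(\<Sum>i<Suc m. (t / real (Suc m)) * exp (- A + A * real i / real (Suc m))) =
      (t / real (Suc m)) * exp (- A) * ((exp A - 1) / (exp (A / real (Suc m)) - 1))" for m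
  proof -
    have ne: "exp (A / real (Suc m)) \<noteq> 1" using A by simp
    have "(\<Sum>i<Suc m. (t / real (Suc m)) * exp (- A + A * real i / real (Suc m))) =
        (t / real (Suc m)) * exp (- A) * (\<Sum>i<Suc m. exp (A / real (Suc m)) ^ i)"
      unfolding sum_distrib_left exp_add by (intro sum.cong refl) (simp add: exp_of_nat_mult[symmetric] mult.commute)
    also have "(\<Sum>i<Suc m. exp (A / real (Suc m)) ^ i) = (exp (A / real (Suc m)) ^ Suc m - 1) / (exp (A / real (Suc m)) - 1)"
      by (rule geometric_sum[OF ne])
    also have "exp (A / real (Suc m)) ^ Suc m = exp A"
      unfolding exp_of_nat_mult[symmetric] by simp
    finally show ?thesis .
  qed
  moreover have "(\<lambda>m. (t / real (Suc m)) * exp (- A) * ((exp A - 1) / (exp (A / real (Suc m)) - 1))) \<longlonglongrightarrow> t * exp (- A) * (exp A - 1) * (1 / A)"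
  proof -
    have "(\<lambda>m. (1 / real (Suc m)) / (exp (A / real (Suc m)) - 1)) \<longlonglongrightarrow> 1 / A"
      using A unfolding inverse_eq_divide[symmetric] by real_asymp
    from tendsto_mult_left[OF this, of "t * exp (- A) * (exp A - 1)"] show ?thesis
      by (simp add: mult_ac)
  qed
  moreover have "t * exp (- A) * (exp A - 1) * (1 / A) = t * (1 - exp (- A)) / A"
    using A by (simp add: field_simps exp_minus)
  ultimately show ?thesis by (simp only:)
qed

text \<open>The Ornstein-Uhlenbeck integral as a measurable function of the whole path, which makes
  independence of the coordinates immediate.\<close>

definition ou_functional :: "real \<Rightarrow> real \<Rightarrow> real \<Rightarrow> (real \<Rightarrow> real) \<Rightarrow> real" where
  "ou_functional b g t z = lim (\<lambda>m. uniform_sum (\<lambda>s. exp (- g * (t - s)) * b) t m z)"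

lemma ou_functional_measurable:
  assumes "0 \<le> t"
  shows "ou_functional b g t \<in> borel_measurable (PiM {0..} (\<lambda>_. borel))"
  unfolding ou_functional_def uniform_sum_def using assms
  by (intro borel_measurable_lim_metric borel_measurable_sum borel_measurable_times borel_measurable_const
      borel_measurable_diff measurable_component_singleton) auto

text \<open>All sampling times lie in [0, t]; the paths in \<open>independent_processes\<close> are
  restricted to nonnegative times.\<close>

lemma ou_functional_restrict:
  assumes "0 \<le> t"
  shows "ou_functional b g t (\<lambda>u\<in>{0..}. z u) = ou_functional b g t z"
  using assms unfolding ou_functional_def uniform_sum_def by simp

lemma stable_scale_distr:
  assumes p: "is_stable_density \<alpha> p" and M: "prob_space M" and X: "X \<in> borel_measurable M"
    and char: "\<And>h. char (distr M borel X) h = complex_of_real (exp (- (\<bar>h * c\<bar> powr \<alpha>)))"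
  shows "distr M borel X = distr (density lborel p) borel (\<lambda>u. c * u)"
proof (rule Levy_uniqueness)
  interpret prob_space M by (rule M)
  interpret D: prob_space "density lborel p" using p by (simp add: is_stable_density_def)
  show "real_distribution (distr M borel X)" using X by (rule real_distribution_distr)
  show "real_distribution (distr (density lborel p) borel (\<lambda>u. c * u))"
    by (intro D.real_distribution_distr) simp
  have "distr (density lborel p) borel (\<lambda>u. u) = density lborel p"
    by (rule distr_id2) simp
  then show "char (distr M borel X) = char (distr (density lborel p) borel (\<lambda>u. c * u))"
    using p char by (auto simp: char_distr_cmult is_stable_density_def)
qed

text \<open>The uniform sums are combinations of independent stable increments, and their
  characteristic exponents are Riemann sums of \<open>\<bar>h * b\<bar> powr \<alpha> * exp (-
  \<alpha> * g * (t - s))\<close> over [0, t]. The value of that integral is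
  \<open>\<bar>h * c\<bar> powr \<alpha>\<close>, which is the origin of \<open>c\<close>.\<close>

lemma stable_integral:
  assumes basis: "usual_stochastic_basis M F" and Z: "normalized_symmetric_stable_process M F \<alpha> Z"
    and \<alpha>: "0 < \<alpha>" and b: "0 < b" and g: "0 < g" and t: "0 < t" and p: "is_stable_density \<alpha> p"
  defines "I \<equiv> \<lambda>\<omega>. ou_functional b g t (\<lambda>u. Z u \<omega>)"
  defines "c \<equiv> b * ((1 - exp (- \<alpha> * g * t)) / (\<alpha> * g)) powr (1 / \<alpha>)"
  shows "I \<in> borel_measurable M"
    and "stochastic_integral M Z (\<lambda>s. exp (- g * (t - s)) * b) t \<in> borel_measurable M"
    and "AE \<omega> in M. stochastic_integral M Z (\<lambda>s. exp (- g * (t - s)) * b) t \<omega> = I \<omega>"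
    and "distr M borel I = distr (density lborel p) borel (\<lambda>u. c * u)"
proof -
  interpret prob_space M by (rule usual_stochastic_basisD(1)[OF basis])
  define f where "f s = exp (- g * (t - s)) * b" for s
  have f: "(f has_real_derivative g * exp (- g * (t - u)) * b) (at u)" for u
    unfolding f_def by (auto intro!: derivative_eq_intros)
  have f': "continuous_on UNIV (\<lambda>u. g * exp (- g * (t - u)) * b)" by (intro continuous_intros)
  have Zm: "\<And>u. 0 \<le> u \<Longrightarrow> Z u \<in> borel_measurable M"
    using stable_process_measurable(2)[OF basis Z] by auto
  have cad: "AE \<omega> in M. cadlag (\<lambda>u. Z u \<omega>)"
    using Z by (simp add: normalized_symmetric_stable_process_def levy_process_def)
  have t0: "0 \<le> t" using t by simp
  have feq: "(\<lambda>s. exp (- g * (t - s)) * b) = f" by (rule ext) (simp only: f_def)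
  have I: "I = (\<lambda>\<omega>. lim (\<lambda>m. uniform_sum f t m (\<lambda>u. Z u \<omega>)))"
    unfolding I_def ou_functional_def feq ..
  have has: "has_stochastic_integral M Z f t I"
    unfolding I by (rule has_stochastic_integral_lim[OF prob_space_axioms Zm cad t0 f f'])
  then show Im: "I \<in> borel_measurable M" by (simp add: has_stochastic_integral_def)
  \<comment> \<open>The existence of \<open>I\<close> makes the choice in
    \<open>stochastic_integral\<close> meaningful; uniqueness then ties the chosen version to
    \<open>I\<close>.\<close>
  have si: "has_stochastic_integral M Z f t (stochastic_integral M Z f t)"
    using someI[of "has_stochastic_integral M Z f t", OF has] by (simp add: stochastic_integral_def[abs_def])
  show "stochastic_integral M Z (\<lambda>s. exp (- g * (t - s)) * b) t \<in> borel_measurable M"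
    using si unfolding feq by (simp add: has_stochastic_integral_def)
  show "AE \<omega> in M. stochastic_integral M Z (\<lambda>s. exp (- g * (t - s)) * b) t \<omega> = I \<omega>"
    unfolding feq by (rule has_stochastic_integral_unique[OF prob_space_axioms t0 Zm si has])
  have lim: "AE \<omega> in M. (\<lambda>m. uniform_sum f t m (\<lambda>u. Z u \<omega>)) \<longlonglongrightarrow> I \<omega>"
    unfolding I by (rule uniform_sum_tendsto[OF prob_space_axioms Zm cad t0 f f'])
  have um[measurable]: "(\<lambda>\<omega>. uniform_sum f t m (\<lambda>u. Z u \<omega>)) \<in> borel_measurable M" for m
    unfolding uniform_sum_def using t
    by (intro borel_measurable_sum borel_measurable_times borel_measurable_const borel_measurable_diff Zm) auto
  have c: "\<bar>h * c\<bar> powr \<alpha> = \<bar>h\<bar> powr \<alpha> * b powr \<alpha> * ((1 - exp (- \<alpha> * g * t)) / (\<alpha> * g))" for h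
    unfolding c_def using b \<alpha> g t by (simp add: abs_mult powr_mult powr_powr)
  have "char (distr M borel I) h = complex_of_real (exp (- (\<bar>h * c\<bar> powr \<alpha>)))" for h
  proof (rule LIMSEQ_unique)
    have "(\<lambda>m. \<integral>\<omega>. iexp (h * uniform_sum f t m (\<lambda>u. Z u \<omega>)) \<partial>M) \<longlonglongrightarrow> (\<integral>\<omega>. iexp (h * I \<omega>) \<partial>M)"
    proof (rule integral_dominated_convergence)
      show "AE \<omega> in M. (\<lambda>m. iexp (h * uniform_sum f t m (\<lambda>u. Z u \<omega>))) \<longlonglongrightarrow> iexp (h * I \<omega>)"
        using lim by eventually_elim (intro tendsto_intros)
      show "integrable M (\<lambda>_. 1::real)" by simp
      show "(\<lambda>\<omega>. iexp (h * I \<omega>)) \<in> borel_measurable M" using Im by measurable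
    qed auto
    then show "(\<lambda>m. char (distr M borel (\<lambda>\<omega>. uniform_sum f t m (\<lambda>u. Z u \<omega>))) h) \<longlonglongrightarrow> char (distr M borel I) h"
      using Im unfolding char_def by (simp add: integral_distr)
    have "char (distr M borel (\<lambda>\<omega>. uniform_sum f t m (\<lambda>u. Z u \<omega>))) h =
      complex_of_real (exp (- (\<bar>h\<bar> powr \<alpha> * b powr \<alpha> * (\<Sum>i<Suc m. (t / real (Suc m)) * exp (- (\<alpha> * g * t) + (\<alpha> * g * t) * real i / real (Suc m))))))" for m
    proof -
      have "char (distr M borel (\<lambda>\<omega>. uniform_sum f t m (\<lambda>u. Z u \<omega>))) h =
        complex_of_real (exp (- (\<Sum>i<Suc m. (t * real (Suc i) / real (Suc m) - t * real i / real (Suc m)) * \<bar>h * f (t * real i / real (Suc m))\<bar> powr \<alpha>)))"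
        unfolding uniform_sum_def using uniform_partition(1)[OF t0, of m]
        by (intro char_stable_sum[OF basis Z, where s="\<lambda>i. t * real i / real (Suc m)" and c="\<lambda>i. f (t * real i / real (Suc m))"])
          (auto simp: is_partition_def)
      moreover have "\<bar>h * f x\<bar> powr \<alpha> = \<bar>h\<bar> powr \<alpha> * b powr \<alpha> * exp (- (\<alpha> * g * t) + \<alpha> * g * x)" for x
        unfolding f_def using b by (simp add: abs_mult powr_mult exp_powr_real algebra_simps)
      ultimately show ?thesis
        unfolding uniform_partition(2)[OF t0] sum_distrib_left by (simp add: mult_ac)
    qed
    moreover have "(\<lambda>m. exp (- (\<bar>h\<bar> powr \<alpha> * b powr \<alpha> * (\<Sum>i<Suc m. (t / real (Suc m)) * exp (- (\<alpha> * g * t) + (\<alpha> * g * t) * real i / real (Suc m))))))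
       \<longlonglongrightarrow> exp (- (\<bar>h\<bar> powr \<alpha> * b powr \<alpha> * (t * (1 - exp (- (\<alpha> * g * t))) / (\<alpha> * g * t))))"
      using \<alpha> g t by (intro tendsto_intros exponential_riemann_sum) auto
    moreover have "\<bar>h\<bar> powr \<alpha> * b powr \<alpha> * (t * (1 - exp (- (\<alpha> * g * t))) / (\<alpha> * g * t)) = \<bar>h * c\<bar> powr \<alpha>"
      unfolding c using t by simp
    ultimately show "(\<lambda>m. char (distr M borel (\<lambda>\<omega>. uniform_sum f t m (\<lambda>u. Z u \<omega>))) h) \<longlonglongrightarrow> complex_of_real (exp (- (\<bar>h * c\<bar> powr \<alpha>)))"
      by (simp only: tendsto_of_real)
  qed
  then show "distr M borel I = distr (density lborel p) borel (\<lambda>u. c * u)"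
    by (rule stable_scale_distr[OF p prob_space_axioms Im])
qed

lemma ou_functional_indep:
  assumes M: "prob_space M" and indep: "independent_processes M Z" and t: "0 \<le> t"
  shows "prob_space.indep_vars M (\<lambda>_. borel) (\<lambda>n \<omega>. a n + ou_functional (b n) (g n) t (\<lambda>u. Z n u \<omega>)) UNIV"
proof -
  interpret prob_space M by (rule M)
  have "indep_vars (\<lambda>_. borel) (\<lambda>n \<omega>. a n + ou_functional (b n) (g n) t (\<lambda>u\<in>{0..}. Z n u \<omega>)) UNIV"
    using indep unfolding independent_processes_def
    by (rule indep_vars_compose2) (intro borel_measurable_add borel_measurable_const ou_functional_measurable t)
  then show ?thesis by (simp only: ou_functional_restrict[OF t])
qed

section \<open>The Ornstein-Uhlenbeck law on the Hilbert space\<close>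

lemma norm_orthonormal_sum:
  assumes e: "\<And>i j. e i \<bullet> e j = (if i = j then 1 else 0)" and J: "finite J"
  shows "(norm (\<Sum>i\<in>J. a i *\<^sub>R e i :: 'h::real_inner))\<^sup>2 = (\<Sum>i\<in>J. (a i)\<^sup>2)"
proof -
  have "(norm (\<Sum>i\<in>J. a i *\<^sub>R e i))\<^sup>2 = (\<Sum>i\<in>J. \<Sum>j\<in>J. a i * (a j * (e j \<bullet> e i)))"
    by (simp add: power2_norm_eq_inner inner_sum_left inner_sum_right sum_distrib_left)
  also have "\<dots> = (\<Sum>i\<in>J. \<Sum>j\<in>J. if i = j then (a i)\<^sup>2 else 0)"
    by (intro sum.cong refl) (auto simp: e power2_eq_square)
  also have "\<dots> = (\<Sum>i\<in>J. (a i)\<^sup>2)" using J by simp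
  finally show ?thesis .
qed

text \<open>Square summable coefficients need not give absolute convergence; Pythagoras reduces the
  Cauchy criterion to that of the squares.\<close>

lemma orthonormal_series_summable:
  fixes e :: "nat \<Rightarrow> 'h::{real_inner, banach}"
  assumes e: "\<And>i j. e i \<bullet> e j = (if i = j then 1 else 0)" and a: "summable (\<lambda>n. (a n)\<^sup>2)"
  shows "summable (\<lambda>n. a n *\<^sub>R e n)"
  unfolding summable_Cauchy
proof (intro allI impI)
  fix \<epsilon> :: real assume \<epsilon>: "0 < \<epsilon>"
  then obtain N where N: "\<And>m n. N \<le> m \<Longrightarrow> norm (\<Sum>k=m..<n. (a k)\<^sup>2) < \<epsilon>\<^sup>2"
    using a[unfolded summable_Cauchy, rule_format, of "\<epsilon>\<^sup>2"] by auto
  have "norm (\<Sum>k=m..<n. a k *\<^sub>R e k) < \<epsilon>" if "N \<le> m" for m n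
  proof -
    have "(norm (\<Sum>k=m..<n. a k *\<^sub>R e k))\<^sup>2 < \<epsilon>\<^sup>2"
      using N[OF that, of n] norm_orthonormal_sum[OF e, of "{m..<n}" a] by simp
    then show ?thesis using \<epsilon> by (rule power2_less_imp_less[OF _ less_imp_le])
  qed
  then show "\<exists>N. \<forall>m\<ge>N. \<forall>n. norm (\<Sum>k=m..<n. a k *\<^sub>R e k) < \<epsilon>" by blast
qed

lemma orthonormal_series_inner:
  fixes e :: "nat \<Rightarrow> 'h::real_inner"
  assumes e: "\<And>i j. e i \<bullet> e j = (if i = j then 1 else 0)" and s: "summable (\<lambda>n. a n *\<^sub>R e n)"
  shows "(\<Sum>n. a n *\<^sub>R e n) \<bullet> e k = a k"
proof -
  have "(\<lambda>n. (a n *\<^sub>R e n) \<bullet> e k) sums ((\<Sum>n. a n *\<^sub>R e n) \<bullet> e k)"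
    using bounded_linear.sums[OF bounded_linear_inner_left summable_sums[OF s]] .
  moreover have "(\<lambda>n. (a n *\<^sub>R e n) \<bullet> e k) = (\<lambda>n. if n = k then a n else 0)" by (auto simp: e)
  ultimately show ?thesis using sums_single[of k a] by (simp add: sums_iff)
qed

lemma orthonormal_remainder:
  fixes e :: "nat \<Rightarrow> 'h::real_inner"
  assumes e: "\<And>i j. e i \<bullet> e j = (if i = j then 1 else 0)"
  shows "(norm (z - (\<Sum>i<N. (z \<bullet> e i) *\<^sub>R e i)))\<^sup>2 = (norm z)\<^sup>2 - (\<Sum>i<N. (z \<bullet> e i)\<^sup>2)"
proof -
  let ?P = "\<Sum>i<N. (z \<bullet> e i) *\<^sub>R e i"
  have "?P \<bullet> ?P = (\<Sum>i<N. (z \<bullet> e i)\<^sup>2)"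
    using norm_orthonormal_sum[OF e, of "{..<N}" "\<lambda>i. z \<bullet> e i"] by (simp add: power2_norm_eq_inner)
  moreover have "z \<bullet> ?P = (\<Sum>i<N. (z \<bullet> e i)\<^sup>2)"
    by (simp add: inner_sum_right power2_eq_square)
  ultimately show ?thesis by (simp add: power2_norm_eq_inner inner_diff_left inner_diff_right inner_commute)
qed

lemma bessel_summable:
  fixes e :: "nat \<Rightarrow> 'h::real_inner"
  assumes e: "\<And>i j. e i \<bullet> e j = (if i = j then 1 else 0)"
  shows "summable (\<lambda>n. (z \<bullet> e n)\<^sup>2)"
proof (rule bounded_imp_summable)
  show "(\<Sum>k\<le>n. (z \<bullet> e k)\<^sup>2) \<le> (norm z)\<^sup>2" for n
    using orthonormal_remainder[OF e, of z "Suc n"] zero_le_power2[of "norm (z - (\<Sum>i<Suc n. (z \<bullet> e i) *\<^sub>R e i))"]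
    unfolding lessThan_Suc_atMost by linarith
qed simp

text \<open>Averaging the characteristic function against a standard Gaussian turns it into
  \<open>E[1 - exp (- X\<^sup>2 / 2)]\<close>, a bounded substitute for the (infinite) second moment.\<close>

lemma stable_truncated_moment:
  assumes M: "prob_space M" and X: "X \<in> borel_measurable M" and \<alpha>: "0 < \<alpha>" "\<alpha> < 2"
    and char: "\<And>h. char (distr M borel X) h = complex_of_real (exp (- (\<bar>h * c\<bar> powr \<alpha>)))"
  shows "(\<integral>\<omega>. 1 - exp (- (X \<omega>)\<^sup>2 / 2) \<partial>M) \<le> 2 * \<bar>c\<bar> powr \<alpha>"
proof -
  interpret M: prob_space M by (rule M)
  define N where "N = std_normal_distribution"
  have "prob_space N" unfolding N_def by (intro prob_space_normal_density) simp
  moreover have sN[measurable_cong]: "sets N = sets borel" by (simp add: N_def)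
  ultimately interpret N: real_distribution N by (simp add: real_distribution_def real_distribution_axioms_def N_def)
  interpret P: pair_prob_space M N ..
  note X[measurable]
  have ex: "integrable M (\<lambda>\<omega>. exp (- (X \<omega>)\<^sup>2 / 2))"
    by (intro M.integrable_const_bound[where B=1]) auto
  have eg: "integrable N (\<lambda>g. exp (- (\<bar>g * c\<bar> powr \<alpha>)))"
    by (intro N.integrable_const_bound[where B=1]) auto
  have "complex_of_real (\<integral>\<omega>. exp (- (X \<omega>)\<^sup>2 / 2) \<partial>M) = (\<integral>\<omega>. complex_of_real (exp (- (X \<omega>)\<^sup>2 / 2)) \<partial>M)"
    by simp
  also have "\<dots> = (\<integral>\<omega>. (\<integral>g. iexp (X \<omega> * g) \<partial>N) \<partial>M)"
    using char_std_normal_distribution by (simp add: N_def char_def fun_eq_iff)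
  also have "\<dots> = (\<integral>g. (\<integral>\<omega>. iexp (X \<omega> * g) \<partial>M) \<partial>N)"
    by (intro P.Fubini_integral[symmetric] P.integrable_const_bound[where B=1]) auto
  also have "\<dots> = (\<integral>g. complex_of_real (exp (- (\<bar>g * c\<bar> powr \<alpha>))) \<partial>N)"
    unfolding char[symmetric] char_def by (simp add: integral_distr mult.commute)
  also have "\<dots> = complex_of_real (\<integral>g. exp (- (\<bar>g * c\<bar> powr \<alpha>)) \<partial>N)" by simp
  finally have eq: "(\<integral>\<omega>. exp (- (X \<omega>)\<^sup>2 / 2) \<partial>M) = (\<integral>g. exp (- (\<bar>g * c\<bar> powr \<alpha>)) \<partial>N)"
    by (simp only: of_real_eq_iff)
  \<comment> \<open>\<open>E[1 + g\<^sup>2] = 2\<close> is the origin of the factor 2; it enters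
    through \<open>\<bar>g\<bar> powr \<alpha> \<le> 1 + g\<^sup>2\<close>, valid for exponents
    between 0 and 2.\<close>
  have m2: "has_bochner_integral N (\<lambda>g. 1 + g\<^sup>2) 2"
  proof -
    have "has_bochner_integral lborel (\<lambda>g. std_normal_density g * g ^ (2 * 1)) (fact (2 * 1) / (2 ^ 1 * fact 1))"
      by (rule std_normal_moment_even)
    then have "has_bochner_integral lborel (\<lambda>g. std_normal_density g *\<^sub>R g\<^sup>2) 1"
      by (simp add: numeral_2_eq_2)
    then have "has_bochner_integral N (\<lambda>g. g\<^sup>2) 1" unfolding N_def
      by (intro has_bochner_integral_density) auto
    moreover have "has_bochner_integral N (\<lambda>g. 1) (1::real)"
      using N.prob_space by (simp add: has_bochner_integral_iff)
    ultimately have "has_bochner_integral N (\<lambda>g. 1 + g\<^sup>2) (1 + 1)" by (rule has_bochner_integral_add[rotated])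
    then show ?thesis by simp
  qed
  have "(\<integral>\<omega>. 1 - exp (- (X \<omega>)\<^sup>2 / 2) \<partial>M) = (\<integral>g. 1 - exp (- (\<bar>g * c\<bar> powr \<alpha>)) \<partial>N)"
    using ex eg M.prob_space N.prob_space eq by (simp add: Bochner_Integration.integral_diff)
  also have "\<dots> \<le> (\<integral>g. \<bar>c\<bar> powr \<alpha> * (1 + g\<^sup>2) \<partial>N)"
  proof (intro integral_mono)
    fix g :: real
    have "\<bar>g\<bar> powr \<alpha> \<le> 1 + g\<^sup>2"
    proof (cases "\<bar>g\<bar> \<le> 1")
      case True
      then have "\<bar>g\<bar> powr \<alpha> \<le> 1 powr \<alpha>" using \<alpha> by (intro powr_mono2) auto
      also have "\<dots> \<le> 1 + g\<^sup>2" by simp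
      finally show ?thesis .
    next
      case False
      then have "\<bar>g\<bar> powr \<alpha> \<le> \<bar>g\<bar> powr 2" using \<alpha> by (intro powr_mono) auto
      also have "\<dots> = g\<^sup>2" using False by (simp add: powr_numeral)
      finally show ?thesis by simp
    qed
    then have "\<bar>c\<bar> powr \<alpha> * \<bar>g\<bar> powr \<alpha> \<le> \<bar>c\<bar> powr \<alpha> * (1 + g\<^sup>2)" by (intro mult_left_mono) auto
    then have "\<bar>g * c\<bar> powr \<alpha> \<le> \<bar>c\<bar> powr \<alpha> * (1 + g\<^sup>2)" by (simp add: abs_mult powr_mult mult.commute)
    then show "1 - exp (- (\<bar>g * c\<bar> powr \<alpha>)) \<le> \<bar>c\<bar> powr \<alpha> * (1 + g\<^sup>2)"
      using exp_ge_add_one_self[of "- (\<bar>g * c\<bar> powr \<alpha>)"] by linarith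
  qed (use eg m2 in \<open>auto simp: has_bochner_integral_iff simp del: distrib_left\<close>)
  also have "\<dots> = 2 * \<bar>c\<bar> powr \<alpha>"
    using m2 by (simp add: has_bochner_integral_iff)
  finally show ?thesis .
qed

text \<open>The bound \<open>1 - exp (- u) \<ge> u / (1 + u)\<close> forces \<open>u < 1\<close>
  once the left side is below 1/2, and from then on the left side is at least
  \<open>u / 2\<close>.\<close>

lemma summable_of_summable_one_minus_exp:
  fixes u :: "nat \<Rightarrow> real"
  assumes u: "\<And>n. 0 \<le> u n" and s: "summable (\<lambda>n. 1 - exp (- u n))"
  shows "summable u"
proof -
  have "(\<lambda>n. 1 - exp (- u n)) \<longlonglongrightarrow> 0" by (rule summable_LIMSEQ_zero[OF s])
  then have "eventually (\<lambda>n. 1 - exp (- u n) < 1 / 2) sequentially" by (rule order_tendstoD) simp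
  then have "eventually (\<lambda>n. norm (u n) \<le> 2 * (1 - exp (- u n))) sequentially"
  proof eventually_elim
    case (elim n)
    have "1 - exp (- u n) \<ge> u n / (1 + u n)"
    proof -
      have "exp (- u n) \<le> 1 / (1 + u n)"
        using exp_ge_add_one_self[of "u n"] u[of n] by (simp add: exp_minus field_simps)
      then show ?thesis using u[of n] by (simp add: field_simps)
    qed
    moreover from this elim have "u n / (1 + u n) < 1 / 2" by linarith
    then have "u n < 1" using u[of n] by (simp add: field_simps)
    then have "u n / 2 \<le> u n / (1 + u n)" using u[of n] by (intro divide_left_mono) auto
    ultimately have "u n / 2 \<le> 1 - exp (- u n)" by linarith
    then show ?case using u[of n] by simp
  qed
  then show ?thesis by (rule summable_comparison_test_ev) (intro summable_mult s)
qed

text \<open>The truncated moments have a finite sum, so the series of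
  \<open>1 - exp (- (X n)\<^sup>2 / 2)\<close> converges almost surely, and with it the series of
  squares. This puts the noise into the Hilbert space without second moments.\<close>

lemma stable_square_summable:
  assumes M: "prob_space M" and X: "\<And>n. X n \<in> borel_measurable M" and \<alpha>: "0 < \<alpha>" "\<alpha> < 2"
    and char: "\<And>n h. char (distr M borel (X n)) h = complex_of_real (exp (- (\<bar>h * c n\<bar> powr \<alpha>)))"
    and c: "summable (\<lambda>n. \<bar>c n\<bar> powr \<alpha>)"
  shows "AE \<omega> in M. summable (\<lambda>n. (X n \<omega>)\<^sup>2)"
proof -
  interpret M: prob_space M by (rule M)
  note X[measurable]
  have int: "integrable M (\<lambda>\<omega>. 1 - exp (- (X n \<omega>)\<^sup>2 / 2))" for n
    by (intro M.integrable_const_bound[where B=1]) auto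
  have "(\<integral>\<^sup>+\<omega>. (\<Sum>n. ennreal (1 - exp (- (X n \<omega>)\<^sup>2 / 2))) \<partial>M) = (\<Sum>n. \<integral>\<^sup>+\<omega>. ennreal (1 - exp (- (X n \<omega>)\<^sup>2 / 2)) \<partial>M)"
    by (intro nn_integral_suminf) measurable
  also have "\<dots> \<le> (\<Sum>n. ennreal (2 * \<bar>c n\<bar> powr \<alpha>))"
  proof (intro suminf_le)
    show "(\<integral>\<^sup>+\<omega>. ennreal (1 - exp (- (X n \<omega>)\<^sup>2 / 2)) \<partial>M) \<le> ennreal (2 * \<bar>c n\<bar> powr \<alpha>)" for n
      using stable_truncated_moment[OF M X \<alpha> char] int
      by (subst nn_integral_eq_integral) (auto intro!: ennreal_leI)
  qed auto
  also have "\<dots> = ennreal (\<Sum>n. 2 * \<bar>c n\<bar> powr \<alpha>)"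
    using c by (intro suminf_ennreal2) auto
  also have "\<dots> < \<infinity>" by simp
  finally have "AE \<omega> in M. (\<Sum>n. ennreal (1 - exp (- (X n \<omega>)\<^sup>2 / 2))) \<noteq> \<infinity>"
    by (intro nn_integral_PInf_AE) auto
  then show ?thesis
  proof eventually_elim
    case (elim \<omega>)
    then have "summable (\<lambda>n. 1 - exp (- ((X n \<omega>)\<^sup>2 / 2)))"
      by (intro summable_suminf_not_top) auto
    then have "summable (\<lambda>n. (X n \<omega>)\<^sup>2 / 2)" by (rule summable_of_summable_one_minus_exp[rotated]) simp
    from summable_mult[OF this, of 2] show ?case by simp
  qed
qed

lemma summable_square_add:
  fixes a b :: "nat \<Rightarrow> real"
  assumes "summable (\<lambda>n. (a n)\<^sup>2)" "summable (\<lambda>n. (b n)\<^sup>2)"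
  shows "summable (\<lambda>n. (a n + b n)\<^sup>2)"
proof (rule summable_comparison_test')
  show "summable (\<lambda>n. 2 * (a n)\<^sup>2 + 2 * (b n)\<^sup>2)"
    using assms by (intro summable_add summable_mult)
  show "norm ((a n + b n)\<^sup>2) \<le> 2 * (a n)\<^sup>2 + 2 * (b n)\<^sup>2" for n
  proof -
    have "(a n + b n)\<^sup>2 \<le> 2 * (a n)\<^sup>2 + 2 * (b n)\<^sup>2"
      unfolding power2_sum using sum_squares_bound[of "a n" "b n"] by linarith
    then show ?thesis by simp
  qed
qed

section \<open>Product form of the law of the process\<close>

definition affine_law :: "(real \<Rightarrow> real) \<Rightarrow> real \<Rightarrow> real \<Rightarrow> real measure" where
  "affine_law p m c = distr (density lborel p) borel (\<lambda>u. m + c * u)"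

lemma sets_affine_law[measurable_cong, simp]: "sets (affine_law p m c) = sets borel"
  by (simp add: affine_law_def)

lemma prob_space_affine_law:
  assumes "is_stable_density \<alpha> p"
  shows "prob_space (affine_law p m c)"
proof -
  interpret prob_space "density lborel p" using assms by (simp add: is_stable_density_def)
  show ?thesis unfolding affine_law_def by (intro prob_space_distr) simp
qed

lemma ou_scale_pos:
  assumes "0 < \<alpha>" "0 < \<gamma> k" "0 < \<beta> k" "0 < t"
  shows "0 < ou_scale \<alpha> \<beta> \<gamma> k t"
proof -
  have "exp (- \<alpha> * \<gamma> k * t) < 1" using assms by simp
  then show ?thesis unfolding ou_scale_def using assms by (intro mult_pos_pos) auto
qed

text \<open>The first form isolates \<open>\<beta> k / \<gamma> k powr (1 / \<alpha>)\<close>; the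
  other factor is bounded above and tends to a positive limit as \<open>\<gamma> k\<close> grows, so
  the scale can stand in for that quotient in the boundedness condition. The second form transfers
  the summability hypothesis to the scales.\<close>

lemma ou_scale_bounds:
  assumes \<alpha>: "0 < \<alpha>" and "0 < \<gamma> k" "0 < \<beta> k" "0 < t"
  shows "ou_scale \<alpha> \<beta> \<gamma> k t = \<beta> k / \<gamma> k powr (1 / \<alpha>) * ((1 - exp (- \<alpha> * \<gamma> k * t)) / \<alpha>) powr (1 / \<alpha>)"
    and "\<bar>ou_scale \<alpha> \<beta> \<gamma> k t\<bar> powr \<alpha> \<le> (1 / \<alpha>) * (\<beta> k powr \<alpha> / \<gamma> k)"
proof -
  have e: "0 < 1 - exp (- \<alpha> * \<gamma> k * t)" using assms by simp
  have "(1 - exp (- \<alpha> * \<gamma> k * t)) / (\<alpha> * \<gamma> k) = ((1 - exp (- \<alpha> * \<gamma> k * t)) / \<alpha>) / \<gamma> k" by simp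
  then show "ou_scale \<alpha> \<beta> \<gamma> k t = \<beta> k / \<gamma> k powr (1 / \<alpha>) * ((1 - exp (- \<alpha> * \<gamma> k * t)) / \<alpha>) powr (1 / \<alpha>)"
    unfolding ou_scale_def using assms e by (simp only: powr_divide) simp
  have "\<bar>ou_scale \<alpha> \<beta> \<gamma> k t\<bar> powr \<alpha> = \<beta> k powr \<alpha> * ((1 - exp (- \<alpha> * \<gamma> k * t)) / (\<alpha> * \<gamma> k))"
    unfolding ou_scale_def using assms e by (simp add: abs_mult powr_mult powr_powr)
  also have "\<dots> \<le> \<beta> k powr \<alpha> * (1 / (\<alpha> * \<gamma> k))"
    using assms by (intro mult_left_mono divide_right_mono) auto
  finally show "\<bar>ou_scale \<alpha> \<beta> \<gamma> k t\<bar> powr \<alpha> \<le> (1 / \<alpha>) * (\<beta> k powr \<alpha> / \<gamma> k)" by simp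
qed

text \<open>Moves the problem from the sample space to a product of one-dimensional laws. The second
  claim holds because the coefficients are almost surely square summable: the series then converges
  and its coordinates give back the sequence, whereas a divergent \<open>suminf\<close> would carry
  no information.\<close>

lemma ou_law_product:
  fixes e :: "nat \<Rightarrow> 'h::{real_inner, banach, polish_space}" and x :: 'h
  assumes basis: "orthonormal_basis e"
    and alpha: "0 < \<alpha>" "\<alpha> < 2"
    and sb: "usual_stochastic_basis M F"
    and stable: "\<And>n. normalized_symmetric_stable_process M F \<alpha> (Z n)"
    and indep: "independent_processes M Z"
    and beta: "\<And>n. 0 < \<beta> n" and gamma: "\<And>n. 0 < \<gamma> n"
    and p: "is_stable_density \<alpha> p"
    and summable: "summable (\<lambda>n. \<beta> n powr \<alpha> / \<gamma> n)" and t: "0 < t"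
  defines "\<nu> \<equiv> PiM UNIV (\<lambda>n. affine_law p (exp (- \<gamma> n * t) * (x \<bullet> e n)) (ou_scale \<alpha> \<beta> \<gamma> n t))"
  shows "ou_law M Z \<beta> \<gamma> e t x = distr \<nu> borel (\<lambda>a. \<Sum>n. a n *\<^sub>R e n)"
    and "AE a in \<nu>. \<forall>k. (\<Sum>n. a n *\<^sub>R e n) \<bullet> e k = a k"
proof -
  interpret prob_space M by (rule usual_stochastic_basisD(1)[OF sb])
  have e: "\<And>i j. e i \<bullet> e j = (if i = j then 1 else 0)" using basis by (auto simp: orthonormal_basis_def)
  define m where "m n = exp (- \<gamma> n * t) * (x \<bullet> e n)" for n
  define I where "I n \<omega> = ou_functional (\<beta> n) (\<gamma> n) t (\<lambda>u. Z n u \<omega>)" for n \<omega>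
  define c where "c n = ou_scale \<alpha> \<beta> \<gamma> n t" for n
  have t0: "0 \<le> t" using t by simp
  note si = stable_integral[OF sb stable alpha(1) beta gamma t p]
  have Im[measurable]: "I n \<in> borel_measurable M" for n unfolding I_def by (rule si(1))
  have sim[measurable]: "stochastic_integral M (Z n) (\<lambda>s. exp (- \<gamma> n * (t - s)) * \<beta> n) t \<in> borel_measurable M" for n
    by (rule si(2))
  have siI: "AE \<omega> in M. \<forall>n. stochastic_integral M (Z n) (\<lambda>s. exp (- \<gamma> n * (t - s)) * \<beta> n) t \<omega> = I n \<omega>"
    unfolding AE_all_countable I_def by (intro allI si(3))
  have dI: "distr M borel (I n) = distr (density lborel p) borel (\<lambda>u. c n * u)" for n
    unfolding I_def c_def ou_scale_def by (rule si(4))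
  have "distr (density lborel p) borel (\<lambda>u. u) = density lborel p" by (rule distr_id2) simp
  then have char: "char (distr M borel (I n)) h = complex_of_real (exp (- (\<bar>h * c n\<bar> powr \<alpha>)))" for n h
    unfolding dI using p by (simp add: char_distr_cmult is_stable_density_def)
  have cs: "summable (\<lambda>n. \<bar>c n\<bar> powr \<alpha>)"
  proof (rule summable_comparison_test')
    show "summable (\<lambda>n. (1 / \<alpha>) * (\<beta> n powr \<alpha> / \<gamma> n))" by (intro summable_mult summable)
    show "norm (\<bar>c n\<bar> powr \<alpha>) \<le> (1 / \<alpha>) * (\<beta> n powr \<alpha> / \<gamma> n)" for n
      unfolding c_def using ou_scale_bounds(2)[OF alpha(1) gamma beta t] by simp
  qed
  have Is: "AE \<omega> in M. summable (\<lambda>n. (I n \<omega>)\<^sup>2)"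
    by (rule stable_square_summable[OF prob_space_axioms Im alpha char cs])
  have ms: "summable (\<lambda>n. (m n)\<^sup>2)"
  proof (rule summable_comparison_test'[OF bessel_summable[OF e]])
    fix n
    have "exp (- \<gamma> n * t) \<le> 1" using gamma[of n] t by simp
    then have "(exp (- \<gamma> n * t))\<^sup>2 \<le> 1" by (simp add: power_le_one)
    then show "norm ((m n)\<^sup>2) \<le> (x \<bullet> e n)\<^sup>2"
      unfolding m_def power_mult_distrib by (simp add: mult_left_le_one_le)
  qed
  \<comment> \<open>\<open>X\<close> is built from the path functionals \<open>I n\<close> and not
    from the versions chosen by \<open>stochastic_integral\<close>: functions of independent paths
    are independent, and the two differ only on a null set.\<close>
  define X where "X n \<omega> = m n + I n \<omega>" for n \<omega>
  have Xm[measurable]: "X n \<in> borel_measurable M" for n unfolding X_def by measurable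
  have Xs: "AE \<omega> in M. summable (\<lambda>n. (X n \<omega>)\<^sup>2)"
    using Is by eventually_elim (simp add: X_def summable_square_add[OF ms])
  have dX: "distr M borel (X n) = affine_law p (m n) (c n)" for n
  proof -
    have "distr M borel (X n) = distr (distr M borel (I n)) borel (\<lambda>u. m n + u)"
      unfolding X_def by (subst distr_distr) (auto simp: o_def)
    then show ?thesis unfolding dI affine_law_def by (subst (asm) distr_distr) (auto simp: o_def)
  qed
  have "indep_vars (\<lambda>_. borel) X UNIV"
    unfolding X_def I_def by (rule ou_functional_indep[OF prob_space_axioms indep t0])
  then have "distr M (PiM UNIV (\<lambda>_. borel)) (\<lambda>\<omega> n. X n \<omega>) = PiM UNIV (\<lambda>n. distr M borel (X n))"
    by (subst (asm) indep_vars_iff_distr_eq_PiM') (auto simp: restrict_UNIV)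
  then have \<nu>: "\<nu> = distr M (PiM UNIV (\<lambda>_. borel)) (\<lambda>\<omega> n. X n \<omega>)"
    unfolding \<nu>_def dX m_def c_def by simp
  have tup[measurable]: "(\<lambda>\<omega> n. X n \<omega>) \<in> measurable M (PiM UNIV (\<lambda>_. borel))"
    by (rule measurable_abs_UNIV) measurable
  have T[measurable]: "(\<lambda>a. \<Sum>n. a n *\<^sub>R e n) \<in> borel_measurable (PiM UNIV (\<lambda>_::nat. borel :: real measure))"
    by measurable
  have "ou_law M Z \<beta> \<gamma> e t x = distr M borel (\<lambda>\<omega>. \<Sum>n. X n \<omega> *\<^sub>R e n)"
    unfolding ou_law_def ou_process_def ou_coord_def
  proof (rule distr_cong_AE)
    show "AE \<omega> in M. (\<Sum>n. (exp (- \<gamma> n * t) * (x \<bullet> e n) +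
        stochastic_integral M (Z n) (\<lambda>s. exp (- \<gamma> n * (t - s)) * \<beta> n) t \<omega>) *\<^sub>R e n) = (\<Sum>n. X n \<omega> *\<^sub>R e n)"
      using siI by eventually_elim (simp add: X_def m_def)
  qed measurable
  also have "\<dots> = distr \<nu> borel (\<lambda>a. \<Sum>n. a n *\<^sub>R e n)"
    unfolding \<nu> by (subst distr_distr) (auto simp: o_def)
  finally show "ou_law M Z \<beta> \<gamma> e t x = distr \<nu> borel (\<lambda>a. \<Sum>n. a n *\<^sub>R e n)" .
  have "AE \<omega> in M. \<forall>k. (\<Sum>n. X n \<omega> *\<^sub>R e n) \<bullet> e k = X k \<omega>"
    using Xs
  proof eventually_elim
    case (elim \<omega>)
    show ?case using orthonormal_series_inner[OF e orthonormal_series_summable[OF e elim]] by simp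
  qed
  moreover have "{a \<in> space (PiM UNIV (\<lambda>_::nat. borel)). \<forall>k. (\<Sum>n. a n *\<^sub>R e n) \<bullet> e k = a k}
      \<in> sets (PiM UNIV (\<lambda>_::nat. borel :: real measure))"
    by (intro sets.sets_Collect_countable_All borel_measurable_eq borel_measurable_inner T
        borel_measurable_const measurable_component_singleton) simp
  ultimately show "AE a in \<nu>. \<forall>k. (\<Sum>n. a n *\<^sub>R e n) \<bullet> e k = a k"
    unfolding \<nu> by (subst AE_distr_iff[OF tup])
qed

section \<open>Equivalence and non-equivalence\<close>

lemma nn_integral_affine_law:
  assumes p: "is_stable_density \<alpha> p" and f: "f \<in> borel_measurable borel"
  shows "(\<integral>\<^sup>+z. f z \<partial>affine_law p m c) = (\<integral>\<^sup>+u. ennreal (p u) * f (m + c * u) \<partial>lborel)"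
proof -
  have [measurable]: "p \<in> borel_measurable borel" using p by (simp add: is_stable_density_def)
  note f[measurable]
  show ?thesis unfolding affine_law_def
    by (subst nn_integral_distr) (auto simp: nn_integral_density)
qed

text \<open>Both laws have Lebesgue densities and \<open>p\<close> is positive almost everywhere, so
  the quotient is a density; points with zero denominator, where HOL sets the quotient to 0, form a
  null set.\<close>

lemma affine_law_likelihood_ratio:
  assumes p: "is_stable_density \<alpha> p" and \<alpha>: "0 < \<alpha>" "\<alpha> < 2" and c: "0 < c"
  shows "density (affine_law p m' c) (\<lambda>z. ennreal (p ((z - m) / c) / p ((z - m') / c))) = affine_law p m c"
proof (rule measure_eqI)
  have [measurable]: "p \<in> borel_measurable borel" and pnn: "\<And>u. 0 \<le> p u" using p by (auto simp: is_stable_density_def)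
  fix B assume "B \<in> sets (density (affine_law p m' c) (\<lambda>z. ennreal (p ((z - m) / c) / p ((z - m') / c))))"
  then have B[measurable]: "B \<in> sets borel" by simp
  define d where "d = (m' - m) / c"
  have "emeasure (density (affine_law p m' c) (\<lambda>z. ennreal (p ((z - m) / c) / p ((z - m') / c)))) B =
      (\<integral>\<^sup>+u. ennreal (p u) * (ennreal (p ((m' + c * u - m) / c) / p ((m' + c * u - m') / c)) * indicator B (m' + c * u)) \<partial>lborel)"
    by (subst emeasure_density) (auto simp: nn_integral_affine_law[OF p])
  also have "\<dots> = (\<integral>\<^sup>+u. ennreal (p (d + 1 * u)) * indicator B (m + c * (d + 1 * u)) \<partial>lborel)"
    using stable_density_pos_affinity(1)[OF p \<alpha>]
  proof (intro nn_integral_cong_AE, eventually_elim)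
    case (elim u)
    have "(m' + c * u - m) / c = d + 1 * u" "m' + c * u = m + c * (d + 1 * u)" "(m' + c * u - m') / c = u"
      using c by (auto simp: d_def field_simps)
    moreover have "ennreal (p u) * ennreal (p (d + 1 * u) / p u) = ennreal (p (d + 1 * u))"
      using elim by (subst ennreal_mult[symmetric]) (auto simp: pnn)
    ultimately show ?case by (simp only: mult.assoc[symmetric])
  qed
  also have "\<dots> = (\<integral>\<^sup>+u. ennreal (p u) * indicator B (m + c * u) \<partial>lborel)"
    by (subst (2) nn_integral_real_affine[where c=1 and t=d]) auto
  also have "\<dots> = (\<integral>\<^sup>+z. indicator B z \<partial>affine_law p m c)"
    by (subst nn_integral_affine_law[OF p]) auto
  also have "\<dots> = emeasure (affine_law p m c) B" by simp
  finally show "emeasure (density (affine_law p m' c) (\<lambda>z. ennreal (p ((z - m) / c) / p ((z - m') / c)))) B =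
      emeasure (affine_law p m c) B" .
qed simp

text \<open>Substituting \<open>z = m' + c * u\<close> leaves only the standardized shift
  \<open>(m - m') / c\<close>, so one constant serves all coordinates.\<close>

lemma affine_law_affinity:
  assumes p: "is_stable_density \<alpha> p" and \<alpha>: "0 < \<alpha>" "\<alpha> < 2"
  shows "\<exists>C. \<forall>m m' c. 0 < c \<longrightarrow>
    1 - (\<integral>z. sqrt (p ((z - m) / c) / p ((z - m') / c)) \<partial>affine_law p m' c) \<le> C * ((m - m') / c)\<^sup>2"
proof -
  have [measurable]: "p \<in> borel_measurable borel" and pnn: "\<And>u. 0 \<le> p u" using p by (auto simp: is_stable_density_def)
  obtain C where C: "\<And>h. 1 - C * h\<^sup>2 \<le> (\<integral>u. sqrt (p u * p (u - h)) \<partial>lborel)"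
    using stable_density_pos_affinity(3)[OF p \<alpha>] by auto
  have "(\<integral>z. sqrt (p ((z - m) / c) / p ((z - m') / c)) \<partial>affine_law p m' c) =
      (\<integral>u. sqrt (p u * p (u - (m - m') / c)) \<partial>lborel)" if c: "0 < c" for m m' c
  proof -
    have "(\<integral>z. sqrt (p ((z - m) / c) / p ((z - m') / c)) \<partial>affine_law p m' c) =
        (\<integral>u. p u * sqrt (p ((m' + c * u - m) / c) / p ((m' + c * u - m') / c)) \<partial>lborel)"
      unfolding affine_law_def by (subst integral_distr) (auto simp: integral_density pnn)
    also have "\<dots> = (\<integral>u. sqrt (p u * p (u - (m - m') / c)) \<partial>lborel)"
    proof (intro integral_cong_AE)
      show "AE u in lborel. p u * sqrt (p ((m' + c * u - m) / c) / p ((m' + c * u - m') / c)) = sqrt (p u * p (u - (m - m') / c))"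
        using stable_density_pos_affinity(1)[OF p \<alpha>]
      proof eventually_elim
        case (elim u)
        have 1: "(m' + c * u - m) / c = u - (m - m') / c" "(m' + c * u - m') / c = u"
          using c by (auto simp: field_simps)
        have "p u * sqrt (p (u - (m - m') / c) / p u) = sqrt ((p u)\<^sup>2 * (p (u - (m - m') / c) / p u))"
          using elim by (simp only: real_sqrt_mult real_sqrt_abs abs_of_pos)
        also have "(p u)\<^sup>2 * (p (u - (m - m') / c) / p u) = p u * p (u - (m - m') / c)"
          using elim by (simp add: power2_eq_square)
        finally show ?case unfolding 1 .
      qed
    qed auto
    finally show ?thesis .
  qed
  then have "1 - (\<integral>z. sqrt (p ((z - m) / c) / p ((z - m') / c)) \<partial>affine_law p m' c) \<le> C * ((m - m') / c)\<^sup>2"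
    if "0 < c" for m m' c
    using C[of "(m - m') / c"] that by simp
  then show ?thesis by blast
qed

text \<open>Almost surely \<open>z \<mapsto> (z \<bullet> e k)\<^sub>k\<close> inverts the series map, so densities and \<open>L\<^sup>1\<close> limits
  on the sequence space carry over to the Hilbert space.\<close>

lemma transport_density:
  fixes e :: "nat \<Rightarrow> 'h::{real_inner, banach, polish_space}" and f :: "nat \<Rightarrow> (nat \<Rightarrow> real) \<Rightarrow> real"
  assumes \<nu>: "prob_space \<nu>" "sets \<nu> = sets (PiM UNIV (\<lambda>_::nat. borel :: real measure))"
    and inv: "AE a in \<nu>. \<forall>k. (\<Sum>n. a n *\<^sub>R e n) \<bullet> e k = a k"
    and conv: "converges_in_L1 \<nu> f g" and g: "\<And>a. 0 \<le> g a"
  defines "\<mu> \<equiv> distr \<nu> borel (\<lambda>a. \<Sum>n. a n *\<^sub>R e n)"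
    and "\<mu>' \<equiv> distr (density \<nu> g) borel (\<lambda>a. \<Sum>n. a n *\<^sub>R e n)"
  shows "absolutely_continuous \<mu> \<mu>'"
    and "converges_in_L1 \<mu> (\<lambda>N z. f N (\<lambda>k. z \<bullet> e k)) (\<lambda>z. enn2real (RN_deriv \<mu> \<mu>' z))"
proof -
  note sets[measurable_cong] = \<nu>(2)
  define T where "T a = (\<Sum>n. a n *\<^sub>R e n)" for a
  define R where "R z = (\<lambda>k. z \<bullet> e k)" for z :: 'h
  have T[measurable]: "T \<in> borel_measurable \<nu>" unfolding T_def measurable_cong_sets[OF sets refl] by measurable
  have R[measurable]: "R \<in> measurable borel \<nu>" unfolding R_def measurable_cong_sets[OF refl sets]
    by (rule measurable_abs_UNIV) measurable
  have RT: "AE a in \<nu>. R (T a) = a" using inv by eventually_elim (auto simp: R_def T_def)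
  have fint: "\<And>N. integrable \<nu> (f N)" and gint: "integrable \<nu> g"
    and lim: "(\<lambda>N. \<integral>a. \<bar>f N a - g a\<bar> \<partial>\<nu>) \<longlonglongrightarrow> 0"
    using conv by (auto simp: converges_in_L1_def)
  then have [measurable]: "f N \<in> borel_measurable \<nu>" "g \<in> borel_measurable \<nu>" for N by auto
  have \<mu>: "\<mu> = distr \<nu> borel T" and \<mu>': "\<mu>' = distr (density \<nu> g) borel T"
    by (simp_all add: \<mu>_def \<mu>'_def T_def[abs_def])
  interpret \<nu>: prob_space \<nu> by (rule \<nu>)
  interpret \<mu>: prob_space \<mu> unfolding \<mu> by (rule \<nu>.prob_space_distr) simp
  have dens: "\<mu>' = density \<mu> (\<lambda>z. ennreal (g (R z)))"
  proof (rule measure_eqI)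
    fix B assume "B \<in> sets \<mu>'"
    then have [measurable]: "B \<in> sets borel" by (simp add: \<mu>')
    have "emeasure \<mu>' B = (\<integral>\<^sup>+z. indicator B z \<partial>\<mu>')" by (simp add: \<mu>')
    also have "\<dots> = (\<integral>\<^sup>+a. ennreal (g a) * indicator B (T a) \<partial>\<nu>)"
      unfolding \<mu>' by (subst nn_integral_distr) (auto simp: nn_integral_density)
    also have "\<dots> = (\<integral>\<^sup>+a. ennreal (g (R (T a))) * indicator B (T a) \<partial>\<nu>)"
      using RT by (intro nn_integral_cong_AE) (auto elim!: eventually_mono)
    also have "\<dots> = (\<integral>\<^sup>+z. ennreal (g (R z)) * indicator B z \<partial>\<mu>)"
      unfolding \<mu> by (subst nn_integral_distr) auto
    also have "\<dots> = emeasure (density \<mu> (\<lambda>z. ennreal (g (R z)))) B"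
      by (subst emeasure_density) (auto simp: \<mu>)
    finally show "emeasure \<mu>' B = emeasure (density \<mu> (\<lambda>z. ennreal (g (R z)))) B" .
  qed (simp add: \<mu> \<mu>')
  have gRm: "(\<lambda>z. ennreal (g (R z))) \<in> borel_measurable \<mu>" by (simp add: \<mu>)
  show "absolutely_continuous \<mu> \<mu>'"
    unfolding dens using gRm by (rule absolutely_continuousI_density)
  \<comment> \<open>\<open>RN_deriv\<close> is one version of the derivative; it is identified with
    \<open>g (R z)\<close> almost everywhere, which suffices under integrals.\<close>
  have "AE z in \<mu>. ennreal (g (R z)) = RN_deriv \<mu> \<mu>' z"
    using gRm dens[symmetric] by (rule \<mu>.RN_deriv_unique)
  then have RN: "AE z in \<mu>. enn2real (RN_deriv \<mu> \<mu>' z) = g (R z)"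
    by eventually_elim (metis enn2real_ennreal g)
  \<comment> \<open>Integrals under \<open>\<mu>\<close> of functions of the coordinates are
    integrals under \<open>\<nu>\<close>, because \<open>R\<close> inverts \<open>T\<close> almost
    surely.\<close>
  have pull: "integrable \<mu> (\<lambda>z. k (R z)) \<and> (\<integral>z. k (R z) \<partial>\<mu>) = (\<integral>a. k a \<partial>\<nu>)"
    if k: "integrable \<nu> k" for k :: "_ \<Rightarrow> real"
  proof -
    have [measurable]: "k \<in> borel_measurable \<nu>" using k by auto
    have AE: "AE a in \<nu>. k a = k (R (T a))" using RT by eventually_elim simp
    have "integrable \<nu> (\<lambda>a. k (R (T a)))" using k AE by (subst integrable_cong_AE[symmetric]) auto
    moreover have "(\<integral>a. k (R (T a)) \<partial>\<nu>) = (\<integral>a. k a \<partial>\<nu>)" using AE by (intro integral_cong_AE) auto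
    ultimately show ?thesis unfolding \<mu> by (simp add: integrable_distr_eq integral_distr)
  qed
  have "integrable \<mu> (\<lambda>z. enn2real (RN_deriv \<mu> \<mu>' z))"
    using pull[OF gint] RN by (subst integrable_cong_AE[where g="\<lambda>z. g (R z)"]) auto
  moreover have "(\<integral>z. \<bar>f N (R z) - enn2real (RN_deriv \<mu> \<mu>' z)\<bar> \<partial>\<mu>) = (\<integral>a. \<bar>f N a - g a\<bar> \<partial>\<nu>)" for N
  proof -
    have "(\<integral>z. \<bar>f N (R z) - enn2real (RN_deriv \<mu> \<mu>' z)\<bar> \<partial>\<mu>) = (\<integral>z. \<bar>f N (R z) - g (R z)\<bar> \<partial>\<mu>)"
      using RN pull[OF fint, of N] calculation pull[OF gint]
      by (intro integral_cong_AE) (auto elim!: eventually_mono)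
    then show ?thesis using pull[of "\<lambda>a. \<bar>f N a - g a\<bar>"] fint gint by simp
  qed
  ultimately show "converges_in_L1 \<mu> (\<lambda>N z. f N (\<lambda>k. z \<bullet> e k)) (\<lambda>z. enn2real (RN_deriv \<mu> \<mu>' z))"
    using pull[OF fint] lim by (simp add: converges_in_L1_def R_def[symmetric])
qed

text \<open>By the quadratic affinity bound the squared standardized shifts, times \<open>C\<close>,
  majorize the deficits in \<open>kakutani_product_density\<close>. The summability hypothesis is
  symmetric in \<open>m\<close> and \<open>m'\<close>, which prepares the exchange of the two
  laws.\<close>

lemma affine_product_equivalence:
  fixes e :: "nat \<Rightarrow> 'h::{real_inner, banach, polish_space}"
  assumes p: "is_stable_density \<alpha> p" and \<alpha>: "0 < \<alpha>" "\<alpha> < 2" and c: "\<And>n. 0 < c n"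
    and sum: "summable (\<lambda>n. ((m n - m' n) / c n)\<^sup>2)"
    and inv: "AE a in PiM UNIV (\<lambda>n. affine_law p (m' n) (c n)). \<forall>k. (\<Sum>n. a n *\<^sub>R e n) \<bullet> e k = a k"
  defines "\<mu> \<equiv> distr (PiM UNIV (\<lambda>n. affine_law p (m n) (c n))) borel (\<lambda>a. \<Sum>n. a n *\<^sub>R e n)"
    and "\<mu>' \<equiv> distr (PiM UNIV (\<lambda>n. affine_law p (m' n) (c n))) borel (\<lambda>a. \<Sum>n. a n *\<^sub>R e n)"
  shows "absolutely_continuous \<mu>' \<mu>"
    and "converges_in_L1 \<mu>' (\<lambda>N z. \<Prod>k<N. p ((z \<bullet> e k - m k) / c k) / p ((z \<bullet> e k - m' k) / c k))
      (\<lambda>z. enn2real (RN_deriv \<mu>' \<mu> z))"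
proof -
  have [measurable]: "p \<in> borel_measurable borel" and pnn: "\<And>u. 0 \<le> p u" using p by (auto simp: is_stable_density_def)
  define P where "P n = affine_law p (m' n) (c n)" for n
  define q where "q n z = p ((z - m n) / c n) / p ((z - m' n) / c n)" for n z
  obtain C where C: "\<And>m m' c. 0 < c \<Longrightarrow> 1 - (\<integral>z. sqrt (p ((z - m) / c) / p ((z - m') / c)) \<partial>affine_law p m' c) \<le> C * ((m - m') / c)\<^sup>2"
    using affine_law_affinity[OF p \<alpha>] by blast
  have dens: "density (P n) (q n) = affine_law p (m n) (c n)" for n
    unfolding P_def q_def by (rule affine_law_likelihood_ratio[OF p \<alpha> c])
  have prob: "prob_space (P n)" for n unfolding P_def by (rule prob_space_affine_law[OF p])
  have "\<exists>g. (\<forall>z. 0 \<le> g z) \<and> converges_in_L1 (PiM UNIV P) (\<lambda>N z. \<Prod>k<N. q k (z k)) g \<and>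
      PiM UNIV (\<lambda>k. density (P k) (q k)) = density (PiM UNIV P) g"
  proof (rule kakutani_product_density[OF prob])
    show "q k \<in> borel_measurable (P k)" for k unfolding q_def P_def by measurable
    show "0 \<le> q k z" for k z by (simp add: q_def pnn)
    show "prob_space (density (P k) (q k))" for k unfolding dens by (rule prob_space_affine_law[OF p])
    show "summable (\<lambda>n. C * ((m n - m' n) / c n)\<^sup>2)" by (intro summable_mult sum)
    show "1 - (\<integral>x. sqrt (q k x) \<partial>P k) \<le> C * ((m k - m' k) / c k)\<^sup>2" for k
      unfolding q_def P_def by (rule C[OF c])
  qed
  then obtain g where g: "\<And>z. 0 \<le> g z" "converges_in_L1 (PiM UNIV P) (\<lambda>N z. \<Prod>k<N. q k (z k)) g"
    and eq: "PiM UNIV (\<lambda>n. affine_law p (m n) (c n)) = density (PiM UNIV P) g"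
    unfolding dens by blast
  have \<nu>: "prob_space (PiM UNIV P)" by (rule prob_space_PiM[OF prob])
  have sets: "sets (PiM UNIV P) = sets (PiM UNIV (\<lambda>_::nat. borel :: real measure))"
    by (intro sets_PiM_cong) (auto simp: P_def)
  note tr = transport_density[OF \<nu> sets inv[folded P_def] g(2,1)]
  show "absolutely_continuous \<mu>' \<mu>" using tr(1) unfolding \<mu>_def \<mu>'_def eq P_def by simp
  show "converges_in_L1 \<mu>' (\<lambda>N z. \<Prod>k<N. p ((z \<bullet> e k - m k) / c k) / p ((z \<bullet> e k - m' k) / c k))
      (\<lambda>z. enn2real (RN_deriv \<mu>' \<mu> z))"
    using tr(2) unfolding \<mu>_def \<mu>'_def eq P_def q_def by simp
qed

section \<open>Separation of the laws under large shifts\<close>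

lemma tail_measure_small:
  assumes "prob_space N" "sets N = sets borel" and \<epsilon>: "0 < \<epsilon>"
  shows "\<exists>h>0. measure N {u::real. h \<le> \<bar>u\<bar>} \<le> \<epsilon>"
proof -
  interpret prob_space N by fact
  have "(\<lambda>n. measure N {u. real n \<le> \<bar>u\<bar>}) \<longlonglongrightarrow> measure N (\<Inter>n. {u. real n \<le> \<bar>u\<bar>})"
    by (intro finite_Lim_measure_decseq) (auto simp: decseq_def assms(2))
  moreover have "(\<Inter>n. {u::real. real n \<le> \<bar>u\<bar>}) = {}"
  proof -
    have "\<exists>n. \<not> real n \<le> \<bar>u\<bar>" for u :: real
      using reals_Archimedean2[of "\<bar>u\<bar>"] by (auto simp: not_le)
    then show ?thesis by blast
  qed
  ultimately have "(\<lambda>n. measure N {u. real n \<le> \<bar>u\<bar>}) \<longlonglongrightarrow> 0" by simp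
  then have "eventually (\<lambda>n. measure N {u. real n \<le> \<bar>u\<bar>} < \<epsilon>) sequentially"
    using \<epsilon> by (rule order_tendstoD)
  then obtain n0 where "\<And>n. n0 \<le> n \<Longrightarrow> measure N {u. real n \<le> \<bar>u\<bar>} < \<epsilon>" by (auto simp: eventually_sequentially)
  from this[of "Suc n0"] show ?thesis by (intro exI[of _ "real (Suc n0)"]) auto
qed

text \<open>Finitely many terms are bounded, so every bound is reached beyond any given index, and
  the indices can be chosen recursively.\<close>

lemma unbounded_subsequence:
  fixes r b :: "nat \<Rightarrow> real"
  assumes "\<not> bdd_above (range r)"
  shows "\<exists>s. strict_mono s \<and> (\<forall>j. b j \<le> r (s j))"
proof -
  have ex: "\<exists>n>k. B \<le> r n" for k B
  proof (rule ccontr)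
    assume "\<not> (\<exists>n>k. B \<le> r n)"
    then have "r n \<le> max B (Max (r ` {..k}))" for n
      by (cases "n \<le> k") (auto simp: le_max_iff_disj not_le intro: less_imp_le)
    then show False using assms by (auto simp: bdd_above_def)
  qed
  define s where "s = rec_nat (SOME n. b 0 \<le> r n) (\<lambda>j k. SOME n. k < n \<and> b (Suc j) \<le> r n)"
  have s0: "b 0 \<le> r (s 0)" unfolding s_def using someI_ex[of "\<lambda>n. b 0 \<le> r n"] ex[of 0 "b 0"] by auto
  have sS: "s j < s (Suc j) \<and> b (Suc j) \<le> r (s (Suc j))" for j
  proof -
    have "s (Suc j) = (SOME n. s j < n \<and> b (Suc j) \<le> r n)" by (simp add: s_def)
    then show ?thesis using someI_ex[of "\<lambda>n. s j < n \<and> b (Suc j) \<le> r n"] ex[of "s j" "b (Suc j)"] by auto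
  qed
  have "b j \<le> r (s j)" for j using s0 sS by (cases j) auto
  then show ?thesis using sS by (intro exI[of _ s]) (auto simp: strict_mono_Suc_iff)
qed

text \<open>The witness \<open>x\<close> moves the normalized coordinate \<open>s j\<close> by \<open>2 * h j\<close>, where the stable mass outside
  \<open>{- h j<..<h j}\<close> is summable in \<open>j\<close>.\<close>

lemma affine_product_not_absolutely_continuous:
  fixes e :: "nat \<Rightarrow> 'h::{real_inner, banach, polish_space}"
  assumes basis: "orthonormal_basis e" and p: "is_stable_density \<alpha> p"
    and c: "\<And>n. 0 < c n" and \<rho>: "\<And>n. 0 < \<rho> n" and unb: "\<not> bdd_above (range (\<lambda>n. \<rho> n / c n))"
    and \<mu>: "\<And>x. \<mu> x = distr (PiM UNIV (\<lambda>n. affine_law p (\<rho> n * (x \<bullet> e n)) (c n))) borel (\<lambda>a. \<Sum>n. a n *\<^sub>R e n)"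
    and inv: "\<And>x. AE a in PiM UNIV (\<lambda>n. affine_law p (\<rho> n * (x \<bullet> e n)) (c n)). \<forall>k. (\<Sum>n. a n *\<^sub>R e n) \<bullet> e k = a k"
  shows "\<exists>x. \<not> absolutely_continuous (\<mu> 0) (\<mu> x)"
proof -
  have e: "\<And>i j. e i \<bullet> e j = (if i = j then 1 else 0)" using basis by (auto simp: orthonormal_basis_def)
  have pm[measurable]: "p \<in> borel_measurable borel" using p by (auto simp: is_stable_density_def)
  define \<kappa> where "\<kappa> = density lborel p"
  have \<kappa>: "prob_space \<kappa>" "sets \<kappa> = sets borel" using p by (auto simp: \<kappa>_def is_stable_density_def)
  have "\<forall>j. \<exists>h>0. measure \<kappa> {u. h \<le> \<bar>u\<bar>} \<le> (1/2)^j" for j :: nat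
    using tail_measure_small[OF \<kappa>] by simp
  then obtain h where h0: "\<And>j. 0 < h j" and h: "\<And>j::nat. measure \<kappa> {u. h j \<le> \<bar>u\<bar>} \<le> (1/2)^j" by metis
  define r where "r n = \<rho> n / c n" for n
  have r0: "0 < r n" for n using c \<rho> by (simp add: r_def)
  \<comment> \<open>The threshold \<open>2 ^ j * (2 * h j)\<close> makes \<open>w j\<close> at most
    \<open>(1/2)^j\<close>, so that the series for \<open>x\<close> converges, while the
    standardized shift \<open>r (s j) * w j\<close> is still \<open>2 * h j\<close>.\<close>
  obtain s where s: "strict_mono s" and rs: "\<And>j. 2 ^ j * (2 * h j) \<le> r (s j)"
    using unbounded_subsequence[of r "\<lambda>j. 2 ^ j * (2 * h j)"] unb unfolding r_def by auto
  have injs: "s i = s j \<longleftrightarrow> i = j" for i j using s by (simp add: strict_mono_eq)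
  define w where "w j = 2 * h j / r (s j)" for j
  have w: "0 \<le> w j" "w j \<le> (1/2)^j" for j
    using r0[of "s j"] h0[of j] rs[of j] by (auto simp: w_def field_simps power_one_over)
  have sw: "summable (\<lambda>j. w j *\<^sub>R e (s j))"
  proof (rule summable_comparison_test'[OF summable_geometric[of "1/2::real"]])
    show "norm (w j *\<^sub>R e (s j)) \<le> (1/2)^j" for j using w[of j] by (simp add: norm_eq_sqrt_inner e)
  qed simp
  define x where "x = (\<Sum>j. w j *\<^sub>R e (s j))"
  have xe: "x \<bullet> e (s j) = w j" for j
    unfolding x_def by (rule orthonormal_series_inner[OF _ sw]) (simp add: e injs)
  have marg: "distr (\<mu> y) borel (\<lambda>z. z \<bullet> e n) = affine_law p (\<rho> n * (y \<bullet> e n)) (c n)" for y n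
  proof -
    let ?P = "\<lambda>n. affine_law p (\<rho> n * (y \<bullet> e n)) (c n)"
    interpret P: product_prob_space ?P UNIV
      by (intro product_prob_spaceI prob_space_affine_law[OF p])
    have comp: "(\<lambda>a. a n) \<in> borel_measurable (PiM UNIV ?P)"
      using measurable_component_singleton[of n UNIV ?P] by (simp add: measurable_cong_sets[OF refl sets_affine_law])
    have T: "(\<lambda>a. \<Sum>n. a n *\<^sub>R e n) \<in> borel_measurable (PiM UNIV ?P)"
      using measurable_component_singleton[of _ UNIV ?P]
      by (intro borel_measurable_suminf borel_measurable_scaleR borel_measurable_const)
        (simp add: measurable_cong_sets[OF refl sets_affine_law])
    have "distr (\<mu> y) borel (\<lambda>z. z \<bullet> e n) = distr (PiM UNIV ?P) borel (\<lambda>a. (\<Sum>n. a n *\<^sub>R e n) \<bullet> e n)"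
      unfolding \<mu> using T by (subst distr_distr) (auto simp: o_def)
    also have "\<dots> = distr (PiM UNIV ?P) borel (\<lambda>a. a n)"
    proof (rule distr_cong_AE)
      show "AE a in PiM UNIV ?P. (\<Sum>n. a n *\<^sub>R e n) \<bullet> e n = a n" using inv[of y] by eventually_elim simp
      show "(\<lambda>a. (\<Sum>n. a n *\<^sub>R e n) \<bullet> e n) \<in> borel_measurable (PiM UNIV ?P)"
        using T by (rule borel_measurable_inner) simp
    qed (use comp in auto)
    also have "\<dots> = distr (PiM UNIV ?P) (?P n) (\<lambda>a. a n)" by (rule distr_cong) auto
    also have "\<dots> = ?P n" by (rule P.PiM_component) simp
    finally show ?thesis .
  qed
  have prob: "prob_space (\<mu> y)" for y
  proof -
    interpret A: prob_space "affine_law p (\<rho> 0 * (y \<bullet> e 0)) (c 0)" by (rule prob_space_affine_law[OF p])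
    have "emeasure (\<mu> y) (space (\<mu> y)) = emeasure (distr (\<mu> y) borel (\<lambda>z. z \<bullet> e 0)) UNIV"
      by (subst emeasure_distr) (auto simp: \<mu>)
    then show ?thesis using A.emeasure_space_1 unfolding marg
      by (intro prob_spaceI) (simp add: affine_law_def)
  qed
  have meas: "measure (\<mu> y) {z. z \<bullet> e n \<in> B} = measure \<kappa> {u. \<rho> n * (y \<bullet> e n) + c n * u \<in> B}"
    if [measurable]: "B \<in> sets borel" for y n B
  proof -
    have "measure (\<mu> y) {z. z \<bullet> e n \<in> B} = measure (distr (\<mu> y) borel (\<lambda>z. z \<bullet> e n)) B"
      by (subst measure_distr) (auto simp: \<mu> vimage_def)
    also have "\<dots> = measure \<kappa> {u. \<rho> n * (y \<bullet> e n) + c n * u \<in> B}"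
      unfolding marg affine_law_def \<kappa>_def by (subst measure_distr) (auto simp: vimage_def)
    finally show ?thesis .
  qed
  have \<mu>sets[measurable_cong]: "sets (\<mu> y) = sets borel" for y by (simp add: \<mu>)
  \<comment> \<open>The common form for both laws: if a value in \<open>B j\<close> forces the
    standardized noise of coordinate \<open>s j\<close> to size at least \<open>h j\<close>, the
    probabilities are at most \<open>(1/2)^j\<close> and Borel-Cantelli applies.\<close>
  have BC: "AE z in \<mu> y. eventually (\<lambda>j. z \<bullet> e (s j) \<notin> B j) sequentially"
    if B: "\<And>j. B j \<in> sets borel" and sub: "\<And>j. {u. \<rho> (s j) * (y \<bullet> e (s j)) + c (s j) * u \<in> B j} \<subseteq> {u. h j \<le> \<bar>u\<bar>}" for y and B :: "nat \<Rightarrow> real set"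
  proof -
    interpret prob_space "\<mu> y" by (rule prob)
    interpret \<kappa>: prob_space \<kappa> by (rule \<kappa>)
    note B[measurable]
    have Am: "{z. z \<bullet> e (s j) \<in> B j} \<in> sets (\<mu> y)" for j by measurable
    have bound: "measure (\<mu> y) {z. z \<bullet> e (s j) \<in> B j} \<le> (1/2)^j" for j
    proof -
      have "measure (\<mu> y) {z. z \<bullet> e (s j) \<in> B j} \<le> measure \<kappa> {u. h j \<le> \<bar>u\<bar>}"
        unfolding meas[OF B] by (intro \<kappa>.finite_measure_mono sub) (simp add: \<kappa>(2))
      then show ?thesis using h[of j] by simp
    qed
    have "AE z in \<mu> y. eventually (\<lambda>j. z \<in> space (\<mu> y) - {z. z \<bullet> e (s j) \<in> B j}) sequentially"
    proof (rule borel_cantelli_AE1[OF Am])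
      show "emeasure (\<mu> y) {z. z \<bullet> e (s j) \<in> B j} < \<infinity>" for j by (simp add: less_top[symmetric])
      show "summable (\<lambda>j. measure (\<mu> y) {z. z \<bullet> e (s j) \<in> B j})"
        by (rule summable_comparison_test'[OF summable_geometric[of "1/2::real"]]) (use bound in auto)
    qed
    then show ?thesis by eventually_elim (auto elim!: eventually_mono)
  qed
  have 0: "AE z in \<mu> 0. eventually (\<lambda>j. z \<bullet> e (s j) \<notin> {v. c (s j) * h j \<le> \<bar>v\<bar>}) sequentially"
  proof (rule BC)
    show "{u. \<rho> (s j) * (0 \<bullet> e (s j)) + c (s j) * u \<in> {v. c (s j) * h j \<le> \<bar>v\<bar>}} \<subseteq> {u. h j \<le> \<bar>u\<bar>}" for j
      using c[of "s j"] by (auto simp: abs_mult)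
  qed measurable
  \<comment> \<open>Under \<open>\<mu> x\<close> coordinate \<open>s j\<close> is shifted by
    \<open>2 * c (s j) * h j\<close>, so a value of size below \<open>c (s j) * h j\<close> takes
    noise of size at least \<open>h j\<close>. These sets are the complements of those used for
    \<open>\<mu> 0\<close>, so both conclusions cannot hold at one point.\<close>
  have 1: "AE z in \<mu> x. eventually (\<lambda>j. z \<bullet> e (s j) \<notin> {v. \<bar>v\<bar> < c (s j) * h j}) sequentially"
  proof (rule BC)
    fix j
    have "\<rho> (s j) * (x \<bullet> e (s j)) = c (s j) * (2 * h j)"
      using c[of "s j"] \<rho>[of "s j"] unfolding xe w_def r_def by (simp add: field_simps)
    then have "\<rho> (s j) * (x \<bullet> e (s j)) + c (s j) * u = c (s j) * (2 * h j + u)" for u by (simp add: algebra_simps)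
    then show "{u. \<rho> (s j) * (x \<bullet> e (s j)) + c (s j) * u \<in> {v. \<bar>v\<bar> < c (s j) * h j}} \<subseteq> {u. h j \<le> \<bar>u\<bar>}"
      using c[of "s j"] by (auto simp: abs_mult)
  qed measurable
  have "\<not> absolutely_continuous (\<mu> 0) (\<mu> x)"
  proof
    assume "absolutely_continuous (\<mu> 0) (\<mu> x)"
    then have "AE z in \<mu> x. eventually (\<lambda>j. z \<bullet> e (s j) \<notin> {v. c (s j) * h j \<le> \<bar>v\<bar>}) sequentially"
      using 0 by (rule absolutely_continuous_AE[rotated]) (simp add: \<mu>sets)
    with 1 have "AE z in \<mu> x. False"
    proof eventually_elim
      case (elim z)
      then have "eventually (\<lambda>j. False) sequentially" by eventually_elim auto
      then show ?case by simp
    qed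
    then show False using prob_space.AE_False[OF prob] by simp
  qed
  then show ?thesis by blast
qed

theorem theorem4p14:
  fixes e :: "nat \<Rightarrow> 'h::{real_inner, banach, polish_space}"
    and A :: "'h \<Rightarrow> 'h" and D :: "'h set"
    and M :: "'w measure" and F :: "real \<Rightarrow> 'w measure"
    and Z :: "nat \<Rightarrow> real \<Rightarrow> 'w \<Rightarrow> real"
    and \<alpha> :: real and \<beta> \<gamma> :: "nat \<Rightarrow> real" and p :: "real \<Rightarrow> real"
  assumes basis: "orthonormal_basis e"
    and alpha: "0 < \<alpha>" "\<alpha> < 2"
    and stochastic_basis: "usual_stochastic_basis M F"
    and stable: "\<And>n. normalized_symmetric_stable_process M F \<alpha> (Z n)"
    and indep: "independent_processes M Z"
    and beta: "\<And>n. 0 < \<beta> n"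
    and A: "self_adjoint_operator D A" "\<And>n. e n \<in> D" "\<And>n. A (e n) = - \<gamma> n *\<^sub>R e n"
    and gamma: "\<And>n. 0 < \<gamma> n" "filterlim \<gamma> at_top sequentially"
    and p: "is_stable_density \<alpha> p"
    and summable: "summable (\<lambda>n. \<beta> n powr \<alpha> / \<gamma> n)"
  shows
    "((\<forall>t>0. bdd_above (range (\<lambda>n. exp (- \<gamma> n * t) * \<gamma> n powr (1 / \<alpha>) / \<beta> n))) \<longrightarrow>
       (\<forall>t>0. \<forall>x y.
          equivalent_measures (ou_law M Z \<beta> \<gamma> e t x) (ou_law M Z \<beta> \<gamma> e t y) \<and>
          converges_in_L1 (ou_law M Z \<beta> \<gamma> e t y)
            (\<lambda>N z. \<Prod>k<N.
               p ((z \<bullet> e k - exp (- \<gamma> k * t) * (x \<bullet> e k)) / ou_scale \<alpha> \<beta> \<gamma> k t) /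
               p ((z \<bullet> e k - exp (- \<gamma> k * t) * (y \<bullet> e k)) / ou_scale \<alpha> \<beta> \<gamma> k t))
            (\<lambda>z. enn2real (RN_deriv (ou_law M Z \<beta> \<gamma> e t y) (ou_law M Z \<beta> \<gamma> e t x) z))))
     \<and>
     (\<forall>t>0. \<not> bdd_above (range (\<lambda>n. exp (- \<gamma> n * t) * \<gamma> n powr (1 / \<alpha>) / \<beta> n)) \<longrightarrow>
       (\<exists>x. \<not> absolutely_continuous (ou_law M Z \<beta> \<gamma> e t 0) (ou_law M Z \<beta> \<gamma> e t x)))"
proof (intro conjI impI allI)
  have e: "\<And>i j. e i \<bullet> e j = (if i = j then 1 else 0)" using basis by (auto simp: orthonormal_basis_def)
  note law = ou_law_product[OF basis alpha stochastic_basis stable indep beta gamma(1) p summable]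
  \<comment> \<open>Compares the standardized shift factor with the quantity in the boundedness
    condition; the denominator stays below \<open>(1 / \<alpha>) powr (1 / \<alpha>)\<close> and
    tends to it.\<close>
  have ratio: "exp (- \<gamma> n * t) / ou_scale \<alpha> \<beta> \<gamma> n t =
      (exp (- \<gamma> n * t) * \<gamma> n powr (1 / \<alpha>) / \<beta> n) / ((1 - exp (- \<alpha> * \<gamma> n * t)) / \<alpha>) powr (1 / \<alpha>)" if t: "0 < t" for n t
    unfolding ou_scale_bounds(1)[OF alpha(1) gamma(1) beta t] by simp
  {
    fix t :: real
    assume bdd: "\<forall>t>0. bdd_above (range (\<lambda>n. exp (- \<gamma> n * t) * \<gamma> n powr (1 / \<alpha>) / \<beta> n))" and t: "0 < t"
    then obtain K where K: "\<And>n. exp (- \<gamma> n * t) * \<gamma> n powr (1 / \<alpha>) / \<beta> n \<le> K"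
      by (auto simp: bdd_above_def)
    have "(\<lambda>n. ((1 - exp (- \<alpha> * \<gamma> n * t)) / \<alpha>) powr (1 / \<alpha>)) \<longlonglongrightarrow> (1 / \<alpha>) powr (1 / \<alpha>)"
    proof -
      have "((\<lambda>g. ((1 - exp (- \<alpha> * g * t)) / \<alpha>) powr (1 / \<alpha>)) \<longlongrightarrow> (1 / \<alpha>) powr (1 / \<alpha>)) at_top"
        using alpha t unfolding inverse_eq_divide[symmetric] by real_asymp
      then show ?thesis by (rule filterlim_compose[OF _ gamma(2)])
    qed
    \<comment> \<open>Half the limit serves as lower bound from some index on; summability does not
      depend on the finitely many earlier terms.\<close>
    then have ev: "eventually (\<lambda>n. (1 / \<alpha>) powr (1 / \<alpha>) / 2 < ((1 - exp (- \<alpha> * \<gamma> n * t)) / \<alpha>) powr (1 / \<alpha>)) sequentially"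
      using alpha by (intro order_tendstoD(1)) auto
    define L where "L = K / ((1 / \<alpha>) powr (1 / \<alpha>) / 2)"
    have rL: "eventually (\<lambda>n. exp (- \<gamma> n * t) / ou_scale \<alpha> \<beta> \<gamma> n t \<le> L) sequentially"
      using ev
    proof eventually_elim
      case (elim n)
      have "0 \<le> K" using order_trans[OF _ K[of n], of 0] beta[of n] by simp
      then show ?case unfolding ratio[OF t] L_def using elim K[of n] alpha
        by (intro frac_le) auto
    qed
    have c: "\<And>n. 0 < ou_scale \<alpha> \<beta> \<gamma> n t" by (rule ou_scale_pos[where \<alpha>=\<alpha>, OF alpha(1) gamma(1) beta t])
    have sum: "summable (\<lambda>n. ((exp (- \<gamma> n * t) * (x \<bullet> e n) - exp (- \<gamma> n * t) * (y \<bullet> e n)) / ou_scale \<alpha> \<beta> \<gamma> n t)\<^sup>2)" for x y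
    proof (rule summable_comparison_test_ev)
      show "summable (\<lambda>n. L\<^sup>2 * ((x - y) \<bullet> e n)\<^sup>2)" by (intro summable_mult bessel_summable e)
      show "\<forall>\<^sub>F n in sequentially. norm (((exp (- \<gamma> n * t) * (x \<bullet> e n) - exp (- \<gamma> n * t) * (y \<bullet> e n)) / ou_scale \<alpha> \<beta> \<gamma> n t)\<^sup>2) \<le> L\<^sup>2 * ((x - y) \<bullet> e n)\<^sup>2"
        using rL
      proof eventually_elim
        case (elim n)
        have "(exp (- \<gamma> n * t) * (x \<bullet> e n) - exp (- \<gamma> n * t) * (y \<bullet> e n)) / ou_scale \<alpha> \<beta> \<gamma> n t =
            (exp (- \<gamma> n * t) / ou_scale \<alpha> \<beta> \<gamma> n t) * ((x - y) \<bullet> e n)"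
          by (simp add: inner_diff_left right_diff_distrib diff_divide_distrib)
        moreover have "(exp (- \<gamma> n * t) / ou_scale \<alpha> \<beta> \<gamma> n t)\<^sup>2 \<le> L\<^sup>2"
          using elim c[of n] by (intro power_mono) auto
        then have "((exp (- \<gamma> n * t) / ou_scale \<alpha> \<beta> \<gamma> n t) * ((x - y) \<bullet> e n))\<^sup>2 \<le> L\<^sup>2 * ((x - y) \<bullet> e n)\<^sup>2"
          unfolding power_mult_distrib by (rule mult_right_mono) simp
        ultimately show ?case by (simp only: real_norm_def abs_power2)
      qed
    qed
    note eq = affine_product_equivalence[OF p alpha c sum law(2)[OF t], folded law(1)[OF t]]
    \<comment> \<open>Both directions are instances of \<open>eq(1)\<close>, with \<open>x\<close>
      and \<open>y\<close> exchanged.\<close>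
    show "equivalent_measures (ou_law M Z \<beta> \<gamma> e t x) (ou_law M Z \<beta> \<gamma> e t y)" for x y
      unfolding equivalent_measures_def using eq(1) by blast
    show "converges_in_L1 (ou_law M Z \<beta> \<gamma> e t y)
            (\<lambda>N z. \<Prod>k<N.
               p ((z \<bullet> e k - exp (- \<gamma> k * t) * (x \<bullet> e k)) / ou_scale \<alpha> \<beta> \<gamma> k t) /
               p ((z \<bullet> e k - exp (- \<gamma> k * t) * (y \<bullet> e k)) / ou_scale \<alpha> \<beta> \<gamma> k t))
            (\<lambda>z. enn2real (RN_deriv (ou_law M Z \<beta> \<gamma> e t y) (ou_law M Z \<beta> \<gamma> e t x) z))" for x y
      by (rule eq(2))
  next
    fix t :: real
    assume t: "0 < t" and unb: "\<not> bdd_above (range (\<lambda>n. exp (- \<gamma> n * t) * \<gamma> n powr (1 / \<alpha>) / \<beta> n))"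
    have c: "\<And>n. 0 < ou_scale \<alpha> \<beta> \<gamma> n t" by (rule ou_scale_pos[where \<alpha>=\<alpha>, OF alpha(1) gamma(1) beta t])
    have "\<not> bdd_above (range (\<lambda>n. exp (- \<gamma> n * t) / ou_scale \<alpha> \<beta> \<gamma> n t))"
    proof
      assume "bdd_above (range (\<lambda>n. exp (- \<gamma> n * t) / ou_scale \<alpha> \<beta> \<gamma> n t))"
      then obtain K where K: "\<And>n. exp (- \<gamma> n * t) / ou_scale \<alpha> \<beta> \<gamma> n t \<le> K" by (auto simp: bdd_above_def)
      \<comment> \<open>Here the upper bound of the factor \<open>d\<close> is the relevant one, and
        it holds for every \<open>n\<close>.\<close>
      have "exp (- \<gamma> n * t) * \<gamma> n powr (1 / \<alpha>) / \<beta> n \<le> K * (1 / \<alpha>) powr (1 / \<alpha>)" for n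
      proof -
        define d where "d = ((1 - exp (- \<alpha> * \<gamma> n * t)) / \<alpha>) powr (1 / \<alpha>)"
        have "0 < 1 - exp (- \<alpha> * \<gamma> n * t)" using alpha t gamma(1)[of n] by simp
        then have d: "0 < d" "d \<le> (1 / \<alpha>) powr (1 / \<alpha>)"
          unfolding d_def using alpha by (auto intro!: powr_mono2 divide_right_mono)
        have "exp (- \<gamma> n * t) * \<gamma> n powr (1 / \<alpha>) / \<beta> n = exp (- \<gamma> n * t) / ou_scale \<alpha> \<beta> \<gamma> n t * d"
          unfolding ratio[OF t] d_def[symmetric] using d by simp
        also have "\<dots> \<le> K * (1 / \<alpha>) powr (1 / \<alpha>)"
          using K[of n] d c[of n] order_trans[OF _ K[of n], of 0] by (intro mult_mono) auto
        finally show ?thesis .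
      qed
      then show False using unb by (auto simp: bdd_above_def)
    qed
    then show "\<exists>x. \<not> absolutely_continuous (ou_law M Z \<beta> \<gamma> e t 0) (ou_law M Z \<beta> \<gamma> e t x)"
      by (rule affine_product_not_absolutely_continuous[OF basis p c exp_gt_zero _ law[OF t]])
  }
qed

end
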